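(* Assume the Riemann hypothesis. Fix a constant $C>1/\pi$ and, for large $t$, let $$L(t)=\max_{|u-t|\leqslant C\log\log t}|S(u)|.$$ Let $X=X(t)$ be any function satisfying $\max(L(t)^2,\log t)=o(X)$ as $t\to\infty$. Then, as $t\to\infty$, $$\zeta(1+it)=(1+o(1))\prod_{p\leqslant X}\bigg(1-\frac{1}{p^{1+it}}\bigg)^{-1},$$ where the product is over primes $p\leqslant X$. In particular, as $t\to\infty$, $$|\zeta(1+it)|\leqslant e^{\gamma}(1+o(1))\log\big(L(t)^2+\log t\big),$$ where $\gamma$ is Euler's constant. Hence, the Riemann hypothesis together with the assertion $$\limsup_{t\to\infty}\frac{\log|S(t)|}{\log\log t}=\frac12$$ implies that $$\max_{t\in[1,T]}|\zeta(1+it)|\sim e^{\gamma}\log\log T\qquad (T\to\infty).$$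
   Context: $\zeta$ is the Riemann zeta function. For $t>0$, $N(t)$ is the number of zeros $\rho=\beta+i\gamma'$ of $\zeta$ with $0<\beta<1$ and $0<\gamma'\leqslant t$, counted with multiplicity. $S(t)=\frac1\pi\Delta\arg\zeta$, where $\Delta\arg$ denotes the change of argument of $\zeta$ along the straight line from $2$ to $2+it$ and then along the straight line from $2+it$ to $\frac12+it$ (if $t$ is the ordinate of a zero, $S(t)=\lim_{\epsilon\to0^+}S(t+\epsilon)$). It is the remainder term in $$N(t)=\frac{t}{2\pi}\log\Big(\frac{t}{2\pi e}\Big)+\frac78+S(t)+O(1/t).$$ The maximum defining $L(t)$ is understood as a supremum. *)

theory Defs
  imports
    "HOL-Complex_Analysis.Complex_Analysis"
    "HOL-Library.Landau_Symbols"
begin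

text \<open>
  The Riemann zeta function, as the analytic continuation of its Dirichlet series to the plane
  without the point 1. The value at the pole is fixed to be 0 only to make the description unique.
\<close>

definition zeta :: "complex \<Rightarrow> complex" where
  "zeta = (THE f. f holomorphic_on - {1} \<and>
                  (\<forall>s. Re s > 1 \<longrightarrow> f s = (\<Sum>n. 1 / of_nat (Suc n) powr s)) \<and>
                  f 1 = 0)"

definition nontrivial_zeros :: "complex set" where
  "nontrivial_zeros = {\<rho>. zeta \<rho> = 0 \<and> 0 < Re \<rho> \<and> Re \<rho> < 1}"

definition riemann_hypothesis :: bool where
  "riemann_hypothesis \<longleftrightarrow> (\<forall>\<rho>\<in>nontrivial_zeros. Re \<rho> = 1 / 2)"

text \<open>
  The variation of a continuous branch \<open>\<theta>\<close> of the argument of \<open>f\<close> along the path \<open>p\<close>. It is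
  meaningful when \<open>f\<close> is continuous and has no zero on \<open>p\<close>: then \<open>\<theta>\<close> exists and is unique up to
  an additive constant.
\<close>

definition arg_change :: "(complex \<Rightarrow> complex) \<Rightarrow> (real \<Rightarrow> complex) \<Rightarrow> real" where
  "arg_change f p = (THE d. \<exists>\<theta>::real \<Rightarrow> real. continuous_on {0..1} \<theta> \<and>
     (\<forall>x\<in>{0..1}. f (p x) = of_real (cmod (f (p x))) * cis (\<theta> x)) \<and> d = \<theta> 1 - \<theta> 0)"

definition S_path :: "real \<Rightarrow> real \<Rightarrow> complex" where
  "S_path t = linepath 2 (Complex 2 t) +++ linepath (Complex 2 t) (Complex (1 / 2) t)"

definition S_pre :: "real \<Rightarrow> real" where
  "S_pre t = arg_change zeta (S_path t) / pi"

text \<open>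
  \<open>S t\<close> is of interest for \<open>t > 0\<close> only. When \<open>t\<close> is the ordinate of a zero, the path meets
  a zero and the value is the limit from the right; as the ordinates are isolated, \<open>S\<close> agrees
  with \<open>S_pre\<close> immediately to the right of \<open>t\<close>.
\<close>

definition S :: "real \<Rightarrow> real" where
  "S t = (if t \<in> Im ` nontrivial_zeros then Lim (at_right t) S_pre else S_pre t)"

definition L :: "real \<Rightarrow> real \<Rightarrow> real" where
  "L C t = (SUP u\<in>{u. \<bar>u - t\<bar> \<le> C * ln (ln t)}. \<bar>S u\<bar>)"

definition euler_prod :: "real \<Rightarrow> complex \<Rightarrow> complex" where
  "euler_prod x s = (\<Prod>p | prime p \<and> real p \<le> x. inverse (1 - 1 / of_nat p powr s))"

text \<open>
  The ratio of the logarithms in the growth condition on \<open>S\<close>, with \<open>log 0\<close> read as minus infinity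
  (whereas \<open>ln 0 = 0\<close> in the library).
\<close>

definition S_exponent :: "real \<Rightarrow> ereal" where
  "S_exponent t = (if S t = 0 then - \<infinity> else ereal (ln \<bar>S t\<bar> / ln (ln t)))"

end

theory Submission
  imports Defs "HOL-Number_Theory.Number_Theory" "HOL-Probability.Probability" "HOL-Real_Asymp.Real_Asymp"
begin

text \<open>
  Under the Riemann hypothesis \<open>log \<zeta>\<close> is holomorphic to the right of the critical line, away from the
  pole at \<open>1\<close> and the real half line to its left. The whole theorem comes from an estimate for it at the edge
  \<open>Re s = 1\<close>: with \<open>log_term s n = \<Lambda>(n) / (n\<^sup>s ln n)\<close>, the difference of \<open>log \<zeta>(1 + it)\<close> and the sum of
  \<open>log_term (1 + it) n\<close> over \<open>n \<le> X\<close> is \<open>O((1 + L(t)) / \<surd>X)\<close> up to an error that is arbitrarily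
  small for large \<open>X\<close> and \<open>t\<close> (\<open>log_zeta_approximation\<close>).

  To see this, weight the term \<open>n\<close> by \<open>cutoff (y - ln n)\<close>, where \<open>X = e\<^sup>y\<close> and \<open>2\<pi>i cutoff y\<close> is the integral
  of \<open>ker y w = exp (y w + w\<^sup>2) / w\<close> over a vertical line to the right of \<open>0\<close>. The weighted sum is an integral of \<open>log \<zeta>\<close> against the kernel
  on a line to the right of \<open>Re s = 1\<close> (\<open>smoothed_log_dir\<close>). Moving the line to \<open>Re s = 1/2 + \<delta>\<close> picks up
  the residue \<open>log \<zeta>(1 + it)\<close> and gains the factor \<open>exp (- y / 2) = 1 / \<surd>X\<close>. The real part of \<open>log \<zeta>\<close> on
  the new line is not controlled by \<open>S\<close>, but it can be avoided. On that line the complex conjugate of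
  \<open>log \<zeta>\<close> agrees with the reflection of \<open>log \<zeta>\<close>, which is holomorphic to the left of the line; its integral is
  moved further left, to where the reflection is an absolutely convergent Dirichlet series and the
  kernel has size \<open>O(1/X)\<close>. What remains is the difference of \<open>log \<zeta>\<close> and its conjugate, that is \<open>2i\<close> times
  the argument of \<open>\<zeta>\<close> (\<open>contour_estimate\<close>). As \<open>\<delta>\<close> tends to \<open>0\<close> the argument tends to
  \<open>\<pi> S\<close> (\<open>S_boundary_value\<close>). Within distance \<open>C log log t\<close> of \<open>t\<close> it is at most \<open>\<pi> L(t)\<close>; outside this window
  it is \<open>O(log t)\<close> by Backlund's argument (\<open>arg_zeta_bound\<close>), and there the Gaussian factor of the kernel is at most
  \<open>exp (- (C log log t)\<^sup>2)\<close>, smaller than every power of \<open>log t\<close> (\<open>left_edge_limit\<close>).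

  The weights are removed with Mertens' theorem, by which the terms with \<open>X/Y < n \<le> XY\<close>
  contribute little for fixed \<open>Y\<close> and large \<open>X\<close> (\<open>unsmoothing\<close>). Since the logarithm of the Euler product over
  \<open>p \<le> X\<close> differs from the sum of the terms \<open>n \<le> X\<close> by a tail of a convergent series, the asymptotic formula
  follows when \<open>X\<close> is of larger order than both \<open>L(t)\<^sup>2\<close> and \<open>log t\<close>. The upper bound takes absolute values of all terms, with
  \<open>X\<close> slightly larger than \<open>M = L(t)\<^sup>2 + log t\<close>; Mertens' theorem gives \<open>ln ln X + \<gamma>\<close>, and
  \<open>ln ln X = ln ln M + o(1)\<close>.

  If \<open>S\<close> grows like \<open>(log t)\<close> to the power \<open>1/2 + o(1)\<close>, then \<open>M\<close> is \<open>(log t)\<close> to the power \<open>1 + o(1)\<close>, which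
  makes the upper bound \<open>e\<^sup>\<gamma> (1 + o(1)) log log t\<close>. It is attained: Dirichlet's theorem on simultaneous approximation
  yields some \<open>t \<le> T\<close> with \<open>n\<^sup>i\<^sup>t\<close> close to \<open>1\<close> for all \<open>n\<close> up to nearly \<open>log T\<close>, while the approximation to \<open>log \<zeta>(1 + it)\<close>
  is no longer than \<open>(log t)\<close> to the power \<open>1 + o(1)\<close>; the terms in between contribute \<open>o(1)\<close>
  (\<open>zeta_line_lower\<close>).
\<close>

section \<open>Analytic continuation of the zeta function\<close>

lemma norm_of_nat_powr [simp]: "cmod (of_nat n powr s) = real n powr Re s"
proof -
  have "cmod (of_real (real n) powr s) = real n powr Re s"
    by (subst norm_powr_real_powr) auto
  thus ?thesis by simp
qed

text \<open>
  The majorant may depend on the disc. Dirichlet series need this freedom: they converge uniformly only on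
  half planes that stay away from the line of convergence.
\<close>

lemma holomorphic_on_suminf_loc:
  fixes f :: "nat \<Rightarrow> complex \<Rightarrow> complex"
  assumes "open A" and hol: "\<And>n. f n holomorphic_on A"
    and bd: "\<And>z. z \<in> A \<Longrightarrow> \<exists>d>0. \<exists>M. cball z d \<subseteq> A \<and> summable M \<and> (\<forall>n. \<forall>w\<in>cball z d. norm (f n w) \<le> M n)"
  shows "(\<lambda>z. \<Sum>n. f n z) holomorphic_on A"
proof (rule holomorphic_uniform_sequence[where f = "\<lambda>n z. \<Sum>i<n. f i z"])
  show "(\<lambda>z. \<Sum>i<n. f i z) holomorphic_on A" for n
    by (intro holomorphic_intros hol)
  fix z assume "z \<in> A"
  then obtain d M where dM: "d > 0" "cball z d \<subseteq> A" "summable M" "\<And>n w. w \<in> cball z d \<Longrightarrow> norm (f n w) \<le> M n"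
    using bd by metis
  have "uniform_limit (cball z d) (\<lambda>n z. \<Sum>i<n. f i z) (\<lambda>z. \<Sum>n. f n z) sequentially"
    by (rule Weierstrass_m_test) (use dM in auto)
  thus "\<exists>d>0. cball z d \<subseteq> A \<and> uniform_limit (cball z d) (\<lambda>n z. \<Sum>i<n. f i z) (\<lambda>z. \<Sum>n. f n z) sequentially"
    using dM by blast
qed fact

lemma summable_Suc_powr: "\<sigma> > 1 \<Longrightarrow> summable (\<lambda>n. real (Suc n) powr (-\<sigma>))"
  using summable_Suc_iff[of "\<lambda>n. real n powr (-\<sigma>)"] by (simp only: summable_real_powr_iff)

definition dir_zeta :: "complex \<Rightarrow> complex" where
  "dir_zeta s = (\<Sum>n. 1 / of_nat (Suc n) powr s)"

lemma norm_dir_zeta_term: "cmod (1 / of_nat (Suc n) powr s) = real (Suc n) powr (- Re s)"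
  unfolding norm_divide norm_of_nat_powr norm_one powr_minus_divide ..

lemma summable_norm_dir_zeta: "Re s > 1 \<Longrightarrow> summable (\<lambda>n. cmod (1 / of_nat (Suc n) powr s))"
  unfolding norm_dir_zeta_term by (rule summable_Suc_powr)

lemma summable_dir_zeta: "Re s > 1 \<Longrightarrow> summable (\<lambda>n. 1 / of_nat (Suc n) powr s)"
  by (rule summable_norm_cancel[OF summable_norm_dir_zeta])

lemma dir_zeta_sums: "Re s > 1 \<Longrightarrow> (\<lambda>n. 1 / of_nat (Suc n) powr s) sums dir_zeta s"
  unfolding dir_zeta_def using summable_dir_zeta by (rule summable_sums)

lemma Re_cball_ge: "w \<in> cball z d \<Longrightarrow> Re w \<ge> Re z - d"
  using abs_Re_le_cmod[of "z - w"] by (auto simp: dist_norm)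

lemma open_Re_gt [simp]: "open {s. Re s > c}"
  using open_halfspace_Re_gt[of c] by simp

lemma connected_Re_gt [simp]: "connected {s. Re s > c}"
  using convex_halfspace_Re_gt[of c] convex_connected by blast

lemma holomorphic_dir_zeta: "dir_zeta holomorphic_on {s. Re s > 1}"
  unfolding dir_zeta_def
proof (rule holomorphic_on_suminf_loc)
  fix z assume z: "z \<in> {s. Re s > 1}"
  define d where "d = (Re z - 1) / 2"
  have d: "d > 0" "Re z - d > 1" using z by (auto simp: d_def field_simps)
  show "\<exists>d>0. \<exists>M. cball z d \<subseteq> {s. Re s > 1} \<and> summable M \<and>
          (\<forall>n. \<forall>w\<in>cball z d. cmod (1 / of_nat (Suc n) powr w) \<le> M n)"
  proof (intro exI[of _ d] conjI exI[of _ "\<lambda>n. real (Suc n) powr (-(Re z - d))"] allI ballI)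
    show "cball z d \<subseteq> {s. Re s > 1}" using Re_cball_ge[of _ z d] d by force
    show "summable (\<lambda>n. real (Suc n) powr (-(Re z - d)))" by (rule summable_Suc_powr) (use d in auto)
    show "cmod (1 / of_nat (Suc n) powr w) \<le> real (Suc n) powr (-(Re z - d))" if "w \<in> cball z d" for n w
      unfolding norm_dir_zeta_term using Re_cball_ge[OF that] by (intro powr_mono) auto
  qed (use d in auto)
qed (auto intro!: holomorphic_intros simp del: of_nat_Suc)

text \<open>
  The falling factorial of \<open>1 - s\<close>, which appears in the derivatives of \<open>x\<close> to the power \<open>1 - s\<close>.
\<close>

definition falling :: "nat \<Rightarrow> complex \<Rightarrow> complex" where
  "falling j s = (\<Prod>i<j. 1 - s - of_nat i)"

lemma falling_0 [simp]: "falling 0 s = 1" by (simp add: falling_def)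
lemma falling_Suc: "falling (Suc j) s = falling j s * (1 - s - of_nat j)" by (simp add: falling_def)

text \<open>
  The remainder at \<open>n + 2\<close> of the Taylor expansion about \<open>n + 1\<close> of \<open>x\<close> to the power \<open>1 - s\<close>.
\<close>

definition taylor_rem :: "nat \<Rightarrow> nat \<Rightarrow> complex \<Rightarrow> complex" where
  "taylor_rem K n s = of_nat (Suc (Suc n)) powr (1 - s) -
     (\<Sum>i\<le>K. falling i s * of_nat (Suc n) powr (1 - s - of_nat i) / fact i)"

text \<open>
  Each order of the expansion gains a power of \<open>n\<close>, so that the sum over \<open>n\<close> of the remainders of order \<open>K\<close> converges
  for \<open>Re s > 1 - K\<close>.
\<close>

lemma norm_taylor_rem:
  assumes "Re s + real K \<ge> 0"
  shows "cmod (taylor_rem K n s) \<le> cmod (falling (Suc K) s) * real (Suc n) powr (- (Re s + real K))"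
proof -
  define f where "f = (\<lambda>i x. falling i s * x powr (1 - s - of_nat i))"
  define w :: complex where "w = of_nat (Suc n)"
  define z :: complex where "z = of_nat (Suc (Suc n))"
  have seg: "\<exists>r\<ge>real (Suc n). x = of_real r" if "x \<in> closed_segment w z" for x
  proof -
    from that obtain u where u: "0 \<le> u" "u \<le> 1" "x = (1 - u) *\<^sub>R w + u *\<^sub>R z"
      by (auto simp: closed_segment_def)
    have "x = of_real (real (Suc n) + u)"
      using u by (simp add: w_def z_def scaleR_conv_of_real algebra_simps)
    thus ?thesis using u by (intro exI[of _ "real (Suc n) + u"]) auto
  qed
  have "cmod (f 0 z - (\<Sum>i\<le>K. f i w * (z - w) ^ i / fact i))
          \<le> (cmod (falling (Suc K) s) * real (Suc n) powr (- (Re s + real K))) * cmod (z - w) ^ Suc K / fact K"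
  proof (rule complex_Taylor[of "closed_segment w z"])
    fix i x assume x: "x \<in> closed_segment w z" "i \<le> K"
    then obtain r where r: "r \<ge> real (Suc n)" "x = of_real r" using seg by blast
    hence nx: "x \<notin> \<real>\<^sub>\<le>\<^sub>0" by auto
    show "(f i has_field_derivative f (Suc i) x) (at x within closed_segment w z)"
      unfolding f_def using nx
      by (auto intro!: derivative_eq_intros simp: falling_Suc algebra_simps)
  next
    fix x assume x: "x \<in> closed_segment w z"
    then obtain r where r: "r \<ge> real (Suc n)" "x = of_real r" using seg by blast
    have "cmod (x powr (1 - s - of_nat (Suc K))) = r powr (- (Re s + real K))"
      using r by (subst norm_powr_real_powr) auto
    also have "\<dots> \<le> real (Suc n) powr (- (Re s + real K))"
      using r assms by (intro powr_mono2') auto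
    finally show "cmod (f (Suc K) x) \<le> cmod (falling (Suc K) s) * real (Suc n) powr (- (Re s + real K))"
      unfolding f_def norm_mult by (intro mult_left_mono) auto
  qed auto
  moreover have "z - w = 1" by (simp add: z_def w_def)
  ultimately have "cmod (taylor_rem K n s) \<le> cmod (falling (Suc K) s) * real (Suc n) powr (- (Re s + real K)) / fact K"
    by (simp add: taylor_rem_def f_def z_def w_def)
  also have "\<dots> \<le> cmod (falling (Suc K) s) * real (Suc n) powr (- (Re s + real K)) / 1"
    by (intro divide_left_mono) auto
  finally show ?thesis by simp
qed

lemma holomorphic_falling [holomorphic_intros]: "falling j holomorphic_on A"
  unfolding falling_def by (intro holomorphic_intros)

lemma holomorphic_taylor_rem: "taylor_rem K n holomorphic_on A"
  unfolding taylor_rem_def by (intro holomorphic_intros) (auto simp del: of_nat_Suc)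

lemma holomorphic_sum_taylor_rem:
  "(\<lambda>s. \<Sum>n. taylor_rem K n s) holomorphic_on {s. Re s > 1 - real K}"
proof (rule holomorphic_on_suminf_loc)
  fix z assume z: "z \<in> {s. Re s > 1 - real K}"
  define d where "d = (Re z - (1 - real K)) / 2"
  have d: "d > 0" "Re z - d > 1 - real K" using z by (auto simp: d_def field_simps)
  have "compact (falling (Suc K) ` cball z d)"
    by (intro compact_continuous_image holomorphic_on_imp_continuous_on holomorphic_falling) auto
  then obtain B where B: "\<And>w. w \<in> cball z d \<Longrightarrow> cmod (falling (Suc K) w) \<le> B"
    by (meson bounded_iff compact_imp_bounded imageI)
  show "\<exists>d>0. \<exists>M. cball z d \<subseteq> {s. Re s > 1 - real K} \<and> summable M \<and>
          (\<forall>n. \<forall>w\<in>cball z d. cmod (taylor_rem K n w) \<le> M n)"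
  proof (intro exI[of _ d] conjI exI[of _ "\<lambda>n. B * real (Suc n) powr (-(Re z - d + real K))"] allI ballI)
    show "cball z d \<subseteq> {s. Re s > 1 - real K}" using Re_cball_ge[of _ z d] d by force
    show "summable (\<lambda>n. B * real (Suc n) powr (-(Re z - d + real K)))"
      by (intro summable_mult summable_Suc_powr) (use d in auto)
    show "cmod (taylor_rem K n w) \<le> B * real (Suc n) powr (-(Re z - d + real K))" if w: "w \<in> cball z d" for n w
    proof -
      have "cmod (taylor_rem K n w) \<le> cmod (falling (Suc K) w) * real (Suc n) powr (- (Re w + real K))"
        by (rule norm_taylor_rem) (use Re_cball_ge[OF w] d in linarith)
      also have "\<dots> \<le> B * real (Suc n) powr (-(Re z - d + real K))"
        using B[OF w] norm_ge_zero[of "falling (Suc K) w"] Re_cball_ge[OF w] by (intro mult_mono powr_mono) (auto simp del: norm_ge_zero)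
      finally show ?thesis .
    qed
  qed (use d in auto)
qed (auto intro!: holomorphic_taylor_rem)

text \<open>
  Sum the Taylor expansion over \<open>n\<close>. The left-hand side telescopes, and the term of order \<open>j + 1\<close> becomes a multiple of
  \<open>\<zeta>(s + j)\<close>. Solving for the term \<open>j = 0\<close> expresses \<open>(s - 1) \<zeta>(s)\<close> by the remainders and
  the values of \<open>\<zeta>\<close> at \<open>s + 1, s + 2, \<dots>\<close>; here \<open>F\<close> stands for \<open>(s - 1) \<zeta>(s)\<close>.
\<close>

definition zeta_step :: "nat \<Rightarrow> (complex \<Rightarrow> complex) \<Rightarrow> complex \<Rightarrow> complex" where
  "zeta_step K F s = 1 + (\<Sum>n. taylor_rem K n s) - (\<Sum>j\<in>{1..<K}. falling j s / fact (Suc j) * F (s + of_nat j))"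

lemma zeta_step_dir_zeta:
  assumes s: "Re s > 1" and K: "K \<ge> 1"
  shows "(s - 1) * dir_zeta s = zeta_step K (\<lambda>s. (s - 1) * dir_zeta s) s"
proof -
  define F where "F = (\<lambda>s. (s - 1) * dir_zeta s)"
  have tend: "(\<lambda>n. of_nat (Suc n) powr (1 - s)) \<longlonglongrightarrow> 0"
  proof (rule tendsto_norm_zero_cancel)
    have "(\<lambda>n. real (Suc n) powr (1 - Re s)) \<longlonglongrightarrow> 0"
      using s by real_asymp
    thus "(\<lambda>n. cmod (of_nat (Suc n) powr (1 - s))) \<longlonglongrightarrow> 0"
      by (subst norm_of_nat_powr) simp
  qed
  have tele: "(\<lambda>n. of_nat (Suc (Suc n)) powr (1 - s) - of_nat (Suc n) powr (1 - s)) sums (-1)"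
    using telescope_sums[OF tend] by simp
  have ter: "(\<lambda>n. falling (Suc j) s * of_nat (Suc n) powr (1 - s - of_nat (Suc j)) / fact (Suc j)) sums
      (- (falling j s / fact (Suc j) * F (s + of_nat j)))" for j
  proof -
    have "(\<lambda>n. falling (Suc j) s / fact (Suc j) * (1 / of_nat (Suc n) powr (s + of_nat j))) sums
            (falling (Suc j) s / fact (Suc j) * dir_zeta (s + of_nat j))"
      using s by (intro sums_mult dir_zeta_sums) auto
    also have "(\<lambda>n. falling (Suc j) s / fact (Suc j) * (1 / of_nat (Suc n) powr (s + of_nat j))) =
        (\<lambda>n. falling (Suc j) s * of_nat (Suc n) powr (1 - s - of_nat (Suc j)) / fact (Suc j))"
    proof
      fix n
      have "1 - s - of_nat (Suc j) = - (s + of_nat j)" by simp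
      hence e: "of_nat (Suc n) powr (1 - s - of_nat (Suc j)) = 1 / of_nat (Suc n) powr (s + of_nat j)"
        by (simp only: powr_minus_divide)
      show "falling (Suc j) s / fact (Suc j) * (1 / of_nat (Suc n) powr (s + of_nat j)) =
          falling (Suc j) s * of_nat (Suc n) powr (1 - s - of_nat (Suc j)) / fact (Suc j)"
        unfolding e by (simp del: fact_Suc of_nat_Suc)
    qed
    also have "falling (Suc j) s / fact (Suc j) * dir_zeta (s + of_nat j) = - (falling j s / fact (Suc j) * F (s + of_nat j))"
      by (simp add: falling_Suc F_def algebra_simps divide_simps del: fact_Suc)
    finally show ?thesis .
  qed
  have eq: "taylor_rem K n s = (of_nat (Suc (Suc n)) powr (1 - s) - of_nat (Suc n) powr (1 - s)) -
      (\<Sum>j<K. falling (Suc j) s * of_nat (Suc n) powr (1 - s - of_nat (Suc j)) / fact (Suc j))" for n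
  proof -
    have "(\<Sum>i\<le>K. falling i s * of_nat (Suc n) powr (1 - s - of_nat i) / fact i) =
       falling 0 s * of_nat (Suc n) powr (1 - s - of_nat 0) / fact 0 +
       (\<Sum>j<K. falling (Suc j) s * of_nat (Suc n) powr (1 - s - of_nat (Suc j)) / fact (Suc j))"
      by (subst lessThan_Suc_atMost [symmetric], subst sum.lessThan_Suc_shift) simp
    thus ?thesis unfolding taylor_rem_def by simp
  qed
  have "(\<lambda>n. taylor_rem K n s) sums (-1 - (\<Sum>j<K. - (falling j s / fact (Suc j) * F (s + of_nat j))))"
    unfolding eq by (intro sums_diff tele sums_sum ter)
  hence "(\<Sum>n. taylor_rem K n s) = -1 + (\<Sum>j<K. falling j s / fact (Suc j) * F (s + of_nat j))"
    by (simp add: sums_iff sum_negf)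
  also have "{..<K} = insert 0 {1..<K}" using K by auto
  also have "(\<Sum>j\<in>insert 0 {1..<K}. falling j s / fact (Suc j) * F (s + of_nat j)) =
      F s + (\<Sum>j\<in>{1..<K}. falling j s / fact (Suc j) * F (s + of_nat j))"
    by (subst sum.insert) auto
  finally show ?thesis unfolding zeta_step_def F_def by (simp del: fact_Suc)
qed

text \<open>
  One application continues to a half plane that is larger by \<open>1\<close>, because \<open>F\<close> is only evaluated at
  \<open>s + j\<close> with \<open>j \<ge> 1\<close>.
\<close>

lemma holomorphic_zeta_step:
  assumes "F holomorphic_on {s. Re s > 1 - real m}"
  shows "zeta_step (Suc m) F holomorphic_on {s. Re s > - real m}"
proof -
  have *: "(\<lambda>s. F (s + of_nat j)) holomorphic_on {s. Re s > - real m}" if "j \<ge> 1" for j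
    using that by (intro holomorphic_on_compose_gen[OF _ assms, unfolded o_def]) (auto intro!: holomorphic_intros)
  show ?thesis unfolding zeta_step_def
    using holomorphic_sum_taylor_rem[of "Suc m"]
    by (intro holomorphic_intros *) (auto simp del: fact_Suc)
qed

primrec zeta_strip :: "nat \<Rightarrow> complex \<Rightarrow> complex" where
  "zeta_strip 0 = (\<lambda>s. (s - 1) * dir_zeta s)"
| "zeta_strip (Suc m) = zeta_step (Suc m) (zeta_strip m)"

lemma zeta_strip_eq: "Re s > 1 \<Longrightarrow> zeta_strip m s = (s - 1) * dir_zeta s"
proof (induction m arbitrary: s)
  case (Suc m)
  have "zeta_step (Suc m) (zeta_strip m) s = zeta_step (Suc m) (\<lambda>s. (s - 1) * dir_zeta s) s"
    unfolding zeta_step_def using Suc by (intro arg_cong2[of _ _ _ _ "(-)"] sum.cong) auto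
  thus ?case using zeta_step_dir_zeta[of s "Suc m"] Suc.prems by simp
qed auto

lemma holomorphic_zeta_strip: "zeta_strip m holomorphic_on {s. Re s > 1 - real m}"
proof (induction m)
  case 0
  show ?case using holomorphic_dir_zeta by (auto intro!: holomorphic_intros)
next
  case (Suc m)
  thus ?case using holomorphic_zeta_step[OF Suc] by simp
qed

lemma zeta_strip_agree:
  assumes "Re s > 1 - real m" "m \<le> n"
  shows "zeta_strip n s = zeta_strip m s"
proof (rule analytic_continuation_open[of "{s. Re s > 1}" "{s. Re s > 1 - real m}" "zeta_strip n" "zeta_strip m"])
  show "{s::complex. Re s > 1} \<noteq> {}" by (auto intro: exI[of _ 2])
  show "zeta_strip n holomorphic_on {s. Re s > 1 - real m}"
    using assms by (intro holomorphic_on_subset[OF holomorphic_zeta_strip[of n]]) auto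
qed (use assms in \<open>auto simp: zeta_strip_eq holomorphic_zeta_strip\<close>)

text \<open>The entire function \<open>(s - 1) \<zeta>(s)\<close>, pieced together from the continuations to the half planes.\<close>

definition Zeta1 :: "complex \<Rightarrow> complex" where
  "Zeta1 s = zeta_strip (nat \<lceil>2 - Re s\<rceil>) s"

lemma Zeta1_eq_strip: "Re s > 1 - real m \<Longrightarrow> Zeta1 s = zeta_strip m s"
proof -
  assume a: "Re s > 1 - real m"
  define k where "k = nat \<lceil>2 - Re s\<rceil>"
  have k: "Re s > 1 - real k" unfolding k_def by linarith
  show ?thesis unfolding Zeta1_def k_def[symmetric]
    using zeta_strip_agree[OF a] zeta_strip_agree[OF k] by (metis nat_le_linear)
qed

lemma holomorphic_Zeta1 [holomorphic_intros]: "Zeta1 holomorphic_on A"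
proof -
  have "Zeta1 holomorphic_on UNIV"
  proof (rule holomorphic_onI)
    fix z :: complex
    define m where "m = nat \<lceil>2 - Re z\<rceil>"
    have z: "z \<in> {s. Re s > 1 - real m}" unfolding m_def by (auto, linarith)
    have "Zeta1 holomorphic_on {s. Re s > 1 - real m}"
      by (rule holomorphic_transform[OF holomorphic_zeta_strip[of m]]) (auto simp: Zeta1_eq_strip)
    hence "Zeta1 field_differentiable at z"
      using z by (rule holomorphic_on_imp_differentiable_at[OF _ open_Re_gt])
    thus "Zeta1 field_differentiable at z within UNIV" by simp
  qed
  thus ?thesis using holomorphic_on_subset by blast
qed

lemma Zeta1_dir: "Re s > 1 \<Longrightarrow> Zeta1 s = (s - 1) * dir_zeta s"
  using Zeta1_eq_strip[of 0 s] by simp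

text \<open>
  The punctured plane is connected, so analytic continuation makes the description of \<open>zeta\<close> unique.
\<close>

lemma zeta_conv_Zeta1: "zeta = (\<lambda>s. if s = 1 then 0 else Zeta1 s / (s - 1))"
  unfolding zeta_def
proof (rule the_equality, intro conjI allI impI)
  let ?z = "\<lambda>s. if s = 1 then 0 else Zeta1 s / (s - 1)"
  have "(\<lambda>s. Zeta1 s / (s - 1)) holomorphic_on - {1}"
    by (intro holomorphic_intros) auto
  thus h: "?z holomorphic_on - {1}"
    by (rule holomorphic_transform) auto
  show e: "?z s = (\<Sum>n. 1 / of_nat (Suc n) powr s)" if "Re s > 1" for s
  proof -
    have "s \<noteq> 1" using that by auto
    thus ?thesis using Zeta1_dir[OF that] by (simp add: dir_zeta_def)
  qed
  show "?z 1 = 0" by simp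
  fix f :: "complex \<Rightarrow> complex"
  assume f: "f holomorphic_on - {1} \<and> (\<forall>s. Re s > 1 \<longrightarrow> f s = (\<Sum>n. 1 / of_nat (Suc n) powr s)) \<and> f 1 = 0"
  show "f = ?z"
  proof
    fix s :: complex
    show "f s = ?z s"
    proof (cases "s = 1")
      case False
      have con: "connected (- {1::complex})"
        by (intro connected_punctured_universe) (auto simp: DIM_complex)
      show ?thesis
        by (rule analytic_continuation_open[of "{s. Re s > 1}" "- {1}"])
           (use f h e con False in \<open>auto intro: exI[of _ 2]\<close>)
    qed (use f in auto)
  qed
qed

lemma zeta_eq_Zeta1: "s \<noteq> 1 \<Longrightarrow> zeta s = Zeta1 s / (s - 1)"
  by (simp add: zeta_conv_Zeta1)

lemma Zeta1_taylor: "Re s > 0 \<Longrightarrow> Zeta1 s = 1 + (\<Sum>n. taylor_rem 1 n s)"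
  using Zeta1_eq_strip[of 1 s] by (simp add: zeta_step_def)

text \<open>
  At \<open>s = 1\<close> the expanded function is constant and all remainders vanish.
\<close>

lemma Zeta1_1 [simp]: "Zeta1 1 = 1"
proof -
  have "taylor_rem 1 n 1 = 0" for n using of_nat_neq_0[of "Suc n", where 'a = complex] of_nat_neq_0[of n, where 'a = complex]
    by (simp add: taylor_rem_def falling_def del: of_nat_Suc)
  thus ?thesis by (subst Zeta1_taylor) auto
qed

text \<open>
  Only the logarithm of this bound matters for counting zeros, so any polynomial bound in a
  half plane that reaches beyond the critical line will do.
\<close>

lemma Zeta1_growth: "\<exists>C>0. \<forall>s. Re s \<ge> 1/4 \<longrightarrow> cmod (Zeta1 s) \<le> C * (cmod s + 2) ^ 2"
proof (intro exI conjI allI impI)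
  define c where "c = (\<Sum>n. real (Suc n) powr (-(5/4)))"
  have sm: "summable (\<lambda>n. real (Suc n) powr (-(5/4)))" by (rule summable_Suc_powr) auto
  have c: "c \<ge> 0" unfolding c_def by (intro suminf_nonneg sm) auto
  thus "1 + c > 0" by auto
  fix s assume s: "Re s \<ge> 1/4"
  have fl: "cmod (falling (Suc 1) s) \<le> (cmod s + 2) ^ 2"
  proof -
    have "cmod (falling (Suc 1) s) = cmod (1 - s) * cmod s"
      by (simp add: falling_def lessThan_Suc norm_mult)
    also have "\<dots> \<le> (cmod s + 2) * (cmod s + 2)"
      using norm_triangle_ineq4[of 1 s] by (intro mult_mono) auto
    finally show ?thesis by (simp add: power2_eq_square)
  qed
  have b: "cmod (taylor_rem 1 n s) \<le> (cmod s + 2) ^ 2 * real (Suc n) powr (-(5/4))" for n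
  proof -
    have "cmod (taylor_rem 1 n s) \<le> cmod (falling (Suc 1) s) * real (Suc n) powr (- (Re s + real 1))"
      by (rule norm_taylor_rem) (use s in auto)
    also have "\<dots> \<le> (cmod s + 2) ^ 2 * real (Suc n) powr (-(5/4))"
      using fl s by (intro mult_mono powr_mono) auto
    finally show ?thesis .
  qed
  have sb: "summable (\<lambda>n. (cmod s + 2) ^ 2 * real (Suc n) powr (-(5/4)))" by (intro summable_mult sm)
  have "cmod (\<Sum>n. taylor_rem 1 n s) \<le> (\<Sum>n. (cmod s + 2) ^ 2 * real (Suc n) powr (-(5/4)))"
    by (rule norm_suminf_le[OF b sb])
  also have "\<dots> = (cmod s + 2) ^ 2 * c" unfolding c_def by (rule suminf_mult[OF sm])
  finally have 1: "cmod (\<Sum>n. taylor_rem 1 n s) \<le> (cmod s + 2) ^ 2 * c" .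
  have "cmod (Zeta1 s) \<le> 1 + cmod (\<Sum>n. taylor_rem 1 n s)"
    using Zeta1_taylor[of s] s norm_triangle_ineq[of 1 "\<Sum>n. taylor_rem 1 n s"] by simp
  also have "\<dots> \<le> (cmod s + 2) ^ 2 + (cmod s + 2) ^ 2 * c"
    by (intro add_mono 1 one_le_power) auto
  finally show "cmod (Zeta1 s) \<le> (1 + c) * (cmod s + 2) ^ 2" by (simp add: algebra_simps)
qed

section \<open>The Dirichlet series of the logarithm\<close>

text \<open>
  The value is \<open>1 / k\<close> at the \<open>k\<close>-th power of a prime and \<open>0\<close> elsewhere: these are the Dirichlet coefficients of \<open>log \<zeta>\<close>.
\<close>

definition log_coeff :: "nat \<Rightarrow> real" where
  "log_coeff n = mangoldt n / ln (real n)"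

lemma log_coeff_0 [simp]: "log_coeff 0 = 0"
  by (simp add: log_coeff_def)

lemma log_coeff_1 [simp]: "log_coeff (Suc 0) = 0"
  by (simp add: log_coeff_def)

lemma log_coeff_nonneg: "log_coeff n \<ge> 0"
  by (cases "n = 0") (auto simp: log_coeff_def mangoldt_nonneg intro!: divide_nonneg_nonneg)

lemma log_coeff_le_1: "log_coeff n \<le> 1"
proof (cases "n > 1")
  case True
  thus ?thesis using mangoldt_le[of n] by (simp add: log_coeff_def divide_simps)
qed (use log_coeff_0 log_coeff_1 in \<open>auto simp: not_less le_Suc_eq\<close>)

lemma log_coeff_prime_power: "prime p \<Longrightarrow> k > 0 \<Longrightarrow> log_coeff (p ^ k) = 1 / real k"
  using prime_gt_1_nat[of p] by (simp add: log_coeff_def ln_realpow divide_simps)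

lemma log_coeff_not_primepow: "\<not>primepow n \<Longrightarrow> log_coeff n = 0"
  by (simp add: log_coeff_def mangoldt_def)

definition log_term :: "complex \<Rightarrow> nat \<Rightarrow> complex" where
  "log_term s n = of_real (log_coeff n) / of_nat n powr s"

definition log_dir :: "complex \<Rightarrow> complex" where
  "log_dir s = (\<Sum>n. log_term s n)"

lemma norm_log_term: "cmod (log_term s n) = log_coeff n * real n powr (- Re s)"
  by (simp add: log_term_def norm_divide log_coeff_nonneg powr_minus_divide)

lemma norm_log_term_le: "cmod (log_term s n) \<le> real n powr (- Re s)"
  unfolding norm_log_term using log_coeff_le_1[of n] by (simp add: mult_left_le_one_le log_coeff_nonneg)

lemma summable_powr: "\<sigma> > 1 \<Longrightarrow> summable (\<lambda>n. real n powr (-\<sigma>))"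
  by (simp add: summable_real_powr_iff)

lemma summable_norm_log_term: "Re s > 1 \<Longrightarrow> summable (\<lambda>n. cmod (log_term s n))"
  by (rule summable_comparison_test'[OF summable_powr[of "Re s"], of 0]) (auto intro: norm_log_term_le)

lemma log_dir_has_sum: "Re s > 1 \<Longrightarrow> (log_term s has_sum log_dir s) UNIV"
  unfolding log_dir_def
  by (intro norm_summable_imp_has_sum summable_norm_log_term summable_sums summable_norm_cancel[OF summable_norm_log_term])

text \<open>
  Truncated Euler products lead to sums over sets such as the powers of the primes up to \<open>N\<close>, which have no
  natural enumeration. They are compared with an ordinary tail of a majorant.
\<close>

lemma has_sum_tail_bound:
  fixes f :: "nat \<Rightarrow> complex"
  assumes f: "(f has_sum c) D" and g: "\<And>n. norm (f n) \<le> g n" "summable g"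
    and N: "\<And>n. n \<in> D \<Longrightarrow> n \<le> N \<Longrightarrow> f n = 0"
  shows "norm c \<le> (\<Sum>n. g (n + Suc N))"
proof -
  have g0: "g n \<ge> 0" for n using order_trans[OF norm_ge_zero g(1)] .
  define h where "h = (\<lambda>n. if n \<in> D then f n else 0)"
  have "(h has_sum c) {N<..}"
    using f by (subst (asm) has_sum_cong_neutral[of "{N<..}" D h f]) (use N in \<open>auto simp: h_def not_less\<close>)
  moreover have "(g has_sum (\<Sum>n. g (n + Suc N))) {N<..}"
  proof -
    have "((\<lambda>n. g (n + Suc N)) has_sum (\<Sum>n. g (n + Suc N))) UNIV"
      by (intro sums_nonneg_imp_has_sum summable_sums g0) (use g(2) in \<open>subst summable_iff_shift\<close>)
    moreover have "{N<..} = (\<lambda>n. n + Suc N) ` UNIV"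
      using less_iff_Suc_add by (force simp: image_iff)
    ultimately show ?thesis
      using has_sum_reindex[of "\<lambda>n. n + Suc N" UNIV g "\<Sum>n. g (n + Suc N)"] by (simp add: o_def inj_def)
  qed
  ultimately show ?thesis
    by (rule norm_infsum_le) (use g g0 in \<open>auto simp: h_def\<close>)
qed

lemma tail_sum_tendsto_0:
  fixes g :: "nat \<Rightarrow> real"
  assumes "summable g"
  shows "(\<lambda>N. \<Sum>n. g (n + Suc N)) \<longlonglongrightarrow> 0"
proof -
  have "(\<lambda>N. \<Sum>n. g (n + N)) \<longlonglongrightarrow> 0"
    using suminf_exist_split2[OF assms] .
  thus ?thesis by (rule LIMSEQ_Suc)
qed

lemma of_nat_power_powr: "p > 0 \<Longrightarrow> of_nat (p ^ k) powr (s :: complex) = (of_nat p powr s) ^ k"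
proof -
  assume p: "p > 0"
  have "of_nat (p ^ k) powr s = exp (s * Ln (of_nat (p ^ k)))" using p by (simp add: powr_def)
  also have "Ln (of_nat (p ^ k)) = of_real (ln (real (p ^ k)))" using p by (subst Ln_of_nat) auto
  also have "\<dots> = of_nat k * of_real (ln (real p))" using p by (simp add: ln_realpow)
  also have "exp (s * (of_nat k * of_real (ln (real p)))) = exp (of_nat k * (s * of_real (ln (real p))))"
    by (simp add: mult_ac)
  also have "\<dots> = (of_nat p powr s) ^ k" using p by (simp add: exp_of_nat_mult powr_def)
  finally show ?thesis .
qed

lemma norm_prime_powr_less_1: "prime p \<Longrightarrow> Re s > 0 \<Longrightarrow> cmod (1 / of_nat p powr s) < 1"
proof -
  assume "prime p" "Re s > 0"
  moreover from this have "real p powr Re s > 1" using prime_gt_1_nat[of p] by (intro gr_one_powr) auto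
  ultimately show ?thesis by (simp add: norm_divide)
qed

text \<open>The Taylor series of \<open>- Ln (1 - q)\<close> at \<open>q = 1 / p\<^sup>s\<close>.\<close>

lemma log_term_prime_powers:
  assumes p: "prime p" and s: "Re s > 0"
  shows "(log_term s has_sum (- Ln (1 - 1 / of_nat p powr s))) ((\<lambda>k. p ^ k) ` {1..})"
proof -
  define q where "q = 1 / of_nat p powr s"
  have q: "cmod q < 1" unfolding q_def by (rule norm_prime_powr_less_1[OF p s])
  have "(\<lambda>n. - ((- (-q)) ^ n) / of_nat n) sums Ln (1 + (-q))" by (rule Ln_series') (use q in simp)
  hence "(\<lambda>n. - (- (q ^ n) / of_nat n)) sums (- Ln (1 - q))" by (intro sums_minus) simp
  hence 1: "(\<lambda>n. q ^ n / of_nat n) sums (- Ln (1 - q))" by simp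
  have "summable (\<lambda>n. cmod q ^ n)" using q by (intro summable_geometric) auto
  hence "summable (\<lambda>n. cmod (q ^ n / of_nat n))"
  proof (rule summable_comparison_test'[of _ 0])
    fix n
    have "cmod q ^ n / real n \<le> cmod q ^ n / 1" if "n > 0"
      using that by (intro divide_left_mono) auto
    thus "norm (cmod (q ^ n / of_nat n)) \<le> cmod q ^ n"
      by (cases "n = 0") (auto simp: norm_divide norm_power)
  qed
  with 1 have "((\<lambda>n. q ^ n / of_nat n) has_sum (- Ln (1 - q))) UNIV"
    by (intro norm_summable_imp_has_sum)
  also have "?this \<longleftrightarrow> ((\<lambda>n. q ^ n / of_nat n) has_sum (- Ln (1 - q))) {1..}"
    by (rule has_sum_cong_neutral) (auto simp: not_le)
  also have "\<dots> \<longleftrightarrow> ((log_term s \<circ> (\<lambda>k. p ^ k)) has_sum (- Ln (1 - q))) {1..}"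
    using p by (intro has_sum_cong)
      (auto simp: log_term_def log_coeff_prime_power q_def of_nat_power_powr prime_gt_0_nat power_divide divide_simps simp del: of_nat_power)
  also have "\<dots> \<longleftrightarrow> (log_term s has_sum (- Ln (1 - q))) ((\<lambda>k. p ^ k) ` {1..})"
    by (rule has_sum_reindex[symmetric]) (use p in \<open>auto intro!: inj_onI dest: prime_power_inj\<close>)
  finally show ?thesis unfolding q_def .
qed

definition powers_of :: "nat set \<Rightarrow> nat set" where
  "powers_of P = (\<Union>p\<in>P. (\<lambda>k. p ^ k) ` {1..})"

lemma log_term_powers_of:
  assumes "finite P" "\<And>p. p \<in> P \<Longrightarrow> prime p" "Re s > 0"
  shows "(log_term s has_sum (\<Sum>p\<in>P. - Ln (1 - 1 / of_nat p powr s))) (powers_of P)"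
  using assms(1,2)
proof (induction P rule: finite_induct)
  case (insert p P)
  have "((\<lambda>k. p ^ k) ` {1..}) \<inter> powers_of P = {}"
  proof (rule ccontr)
    assume "\<not> ?thesis"
    then obtain q k l where q: "q \<in> P" "k \<ge> 1" "l \<ge> 1" "p ^ k = q ^ l"
      by (auto simp: powers_of_def)
    hence "p = q" using prime_power_inj'(1)[of p q k l] insert.prems by auto
    thus False using q insert.hyps by auto
  qed
  hence "(log_term s has_sum (- Ln (1 - 1 / of_nat p powr s) + (\<Sum>p\<in>P. - Ln (1 - 1 / of_nat p powr s))))
          ((\<lambda>k. p ^ k) ` {1..} \<union> powers_of P)"
    using insert assms(3) by (intro has_sum_Un_disjoint log_term_prime_powers insert.IH) auto
  thus ?case using insert by (simp add: powers_of_def)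
qed (auto simp: powers_of_def)

lemma exp_sum_neg_Ln:
  assumes "finite P" "\<And>p. p \<in> P \<Longrightarrow> prime p" "Re s > 0"
  shows "exp (\<Sum>p\<in>P. - Ln (1 - 1 / of_nat p powr s)) = (\<Prod>p\<in>P. inverse (1 - 1 / of_nat p powr s))"
proof -
  have "1 - 1 / of_nat p powr s \<noteq> 0" if "p \<in> P" for p
    using norm_prime_powr_less_1[OF assms(2)[OF that] assms(3)] by auto
  thus ?thesis using assms(1) by (simp add: exp_sum exp_minus)
qed

text \<open>
  The sieve of Eratosthenes: multiplication by \<open>1 - 1 / p\<^sup>s\<close> removes the multiples of \<open>p\<close> from the series.
\<close>

lemma dir_zeta_sieve:
  assumes "finite P" "\<And>p. p \<in> P \<Longrightarrow> prime p" and s: "Re s > 1"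
  shows "((\<lambda>n. 1 / of_nat n powr s) has_sum (dir_zeta s * (\<Prod>p\<in>P. 1 - 1 / of_nat p powr s)))
           {n. n > 0 \<and> (\<forall>p\<in>P. \<not> p dvd n)}"
  using assms(1,2)
proof (induction P rule: finite_induct)
  case empty
  have "((\<lambda>n. 1 / of_nat (Suc n) powr s) has_sum dir_zeta s) UNIV"
    by (intro norm_summable_imp_has_sum summable_norm_dir_zeta dir_zeta_sums s)
  hence "(((\<lambda>n. 1 / of_nat n powr s) \<circ> Suc) has_sum dir_zeta s) UNIV" by (simp add: o_def)
  hence "((\<lambda>n. 1 / of_nat n powr s) has_sum dir_zeta s) (range Suc)"
    by (subst has_sum_reindex) auto
  moreover have "range Suc = {n. n > 0}" by (auto simp: image_iff gr0_conv_Suc)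
  ultimately show ?case by simp
next
  case (insert p P)
  let ?f = "\<lambda>n. 1 / of_nat n powr s :: complex"
  define A where "A = {n. n > 0 \<and> (\<forall>p\<in>P. \<not> p dvd n)}"
  define D where "D = dir_zeta s * (\<Prod>p\<in>P. 1 - 1 / of_nat p powr s)"
  have p: "prime p" using insert by auto
  have A: "(?f has_sum D) A" using insert unfolding A_def D_def by auto
  have "((\<lambda>n. ?f p * ?f n) has_sum (?f p * D)) A" by (rule has_sum_cmult_right[OF A])
  also have "?this \<longleftrightarrow> ((?f \<circ> (\<lambda>n. p * n)) has_sum (?f p * D)) A"
    by (intro has_sum_cong) (simp add: powr_times_real)
  also have "\<dots> \<longleftrightarrow> (?f has_sum (?f p * D)) ((\<lambda>n. p * n) ` A)"
    by (rule has_sum_reindex[symmetric]) (use p in \<open>auto simp: inj_on_def\<close>)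
  finally have B: "(?f has_sum (?f p * D)) ((\<lambda>n. p * n) ` A)" .
  have ndvd: "\<not> q dvd p" if "q \<in> P" for q
    using that insert p primes_dvd_imp_eq[of q p] by auto
  have sub: "(\<lambda>n. p * n) ` A = {n\<in>A. p dvd n}"
  proof (intro equalityI subsetI)
    fix n assume "n \<in> (\<lambda>n. p * n) ` A"
    thus "n \<in> {n\<in>A. p dvd n}"
      using p ndvd insert by (auto simp: A_def prime_gt_0_nat prime_dvd_mult_iff)
  next
    fix n assume "n \<in> {n\<in>A. p dvd n}"
    then obtain k where k: "n = p * k" by (auto elim: dvdE)
    have "k \<in> A" using \<open>n \<in> _\<close> by (auto simp: A_def k)
    thus "n \<in> (\<lambda>n. p * n) ` A" using k by blast
  qed
  have "(?f has_sum (D - ?f p * D)) (A - (\<lambda>n. p * n) ` A)"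
    by (intro has_sum_Diff A B) (use sub in auto)
  also have "A - (\<lambda>n. p * n) ` A = {n. n > 0 \<and> (\<forall>q\<in>insert p P. \<not> q dvd n)}"
    unfolding sub by (auto simp: A_def)
  also have "D - ?f p * D = dir_zeta s * (\<Prod>p\<in>insert p P. 1 - 1 / of_nat p powr s)"
    using insert by (simp add: D_def algebra_simps)
  finally show ?case .
qed

definition prime_set :: "nat \<Rightarrow> nat set" where
  "prime_set N = {p. prime p \<and> p \<le> N}"

lemma finite_prime_set [simp]: "finite (prime_set N)"
  unfolding prime_set_def by (rule finite_subset[of _ "{..N}"]) auto

lemma prime_prime_set: "p \<in> prime_set N \<Longrightarrow> prime p"
  by (simp add: prime_set_def)

lemma primepow_in_powers_of: "primepow n \<Longrightarrow> n \<le> N \<Longrightarrow> n \<in> powers_of (prime_set N)"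
proof -
  assume a: "primepow n" "n \<le> N"
  then obtain p k where pk: "prime p" "k > 0" "n = p ^ k" unfolding primepow_def by auto
  have "p \<le> p ^ k" using pk prime_ge_1_nat[OF pk(1)] by (intro self_le_power) auto
  hence "p \<in> prime_set N" using pk a by (auto simp: prime_set_def)
  moreover have "n \<in> (\<lambda>k. p ^ k) ` {1..}" using pk by auto
  ultimately show ?thesis unfolding powers_of_def by blast
qed

lemma log_coeff_eq_0: "n \<notin> powers_of (prime_set N) \<Longrightarrow> n \<le> N \<Longrightarrow> log_coeff n = 0"
  using primepow_in_powers_of[of n N] log_coeff_not_primepow by blast

text \<open>
  The sum \<open>E N\<close> of the logarithms of the Euler factors for \<open>p \<le> N\<close> tends to \<open>log_dir s\<close>, since the powers of these primes
  include all prime powers up to \<open>N\<close>. On the other hand \<open>dir_zeta s * exp (- E N)\<close> tends to \<open>1\<close>, since the sieve leaves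
  \<open>1\<close> and numbers larger than \<open>N\<close>. Both errors are at most a tail of the sum of
  \<open>n\<close> to the power \<open>- Re s\<close>.
\<close>

theorem exp_log_dir:
  assumes s: "Re s > 1"
  shows "exp (log_dir s) = dir_zeta s"
proof -
  define E where "E = (\<lambda>N. \<Sum>p\<in>prime_set N. - Ln (1 - 1 / of_nat p powr s))"
  have tail0: "(\<lambda>N. \<Sum>n. real (n + Suc N) powr (- Re s)) \<longlonglongrightarrow> 0"
    using tail_sum_tendsto_0[OF summable_powr[OF s]] .
  have E: "E \<longlonglongrightarrow> log_dir s"
  proof (rule Lim_transform2[OF tendsto_const])
    show "(\<lambda>N. log_dir s - E N) \<longlonglongrightarrow> 0"
    proof (rule Lim_null_comparison[OF _ tail0], rule eventuallyI)
      fix N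
      have *: "(log_term s has_sum E N) (powers_of (prime_set N))"
        unfolding E_def by (rule log_term_powers_of) (use s prime_prime_set in auto)
      have "(log_term s has_sum (log_dir s - E N)) (UNIV - powers_of (prime_set N))"
        by (intro has_sum_Diff log_dir_has_sum s *) auto
      thus "cmod (log_dir s - E N) \<le> (\<Sum>n. real (n + Suc N) powr (- Re s))"
      proof (rule has_sum_tail_bound[where g = "\<lambda>n. real n powr (- Re s)"])
        show "log_term s n = 0" if "n \<in> UNIV - powers_of (prime_set N)" "n \<le> N" for n
          using that by (simp add: log_term_def log_coeff_eq_0)
      qed (intro norm_log_term_le summable_powr s)+
    qed
  qed
  have "(\<lambda>N. dir_zeta s * exp (- E N)) \<longlonglongrightarrow> dir_zeta s * exp (- log_dir s)"
    by (intro tendsto_intros E)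
  moreover have "(\<lambda>N. dir_zeta s * exp (- E N)) \<longlonglongrightarrow> 1"
  proof (rule Lim_transform2[OF tendsto_const])
    show "(\<lambda>N. 1 - dir_zeta s * exp (- E N)) \<longlonglongrightarrow> 0"
    proof (rule Lim_null_comparison[OF _ tail0], rule eventually_sequentiallyI[of 1])
      fix N :: nat assume N: "N \<ge> 1"
      define A where "A = {n. n > 0 \<and> (\<forall>p\<in>prime_set N. \<not> p dvd n)}"
      have "exp (- E N) = inverse (exp (E N))" by (simp add: exp_minus)
      also have "exp (E N) = (\<Prod>p\<in>prime_set N. inverse (1 - 1 / of_nat p powr s))"
        unfolding E_def by (rule exp_sum_neg_Ln) (use s prime_prime_set in auto)
      also have "inverse \<dots> = (\<Prod>p\<in>prime_set N. 1 - 1 / of_nat p powr s)"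
        by (simp add: prod_inversef[symmetric])
      finally have e: "exp (- E N) = (\<Prod>p\<in>prime_set N. 1 - 1 / of_nat p powr s)" .
      have "((\<lambda>n. 1 / of_nat n powr s) has_sum (dir_zeta s * exp (- E N))) A"
        unfolding e A_def by (rule dir_zeta_sieve) (use s prime_prime_set in auto)
      moreover have "((\<lambda>n. 1 / of_nat n powr s) has_sum (1 / of_nat 1 powr s)) {1::nat}"
        using has_sum_finite[of "{1::nat}" "\<lambda>n. 1 / of_nat n powr s"] by simp
      ultimately have "((\<lambda>n. 1 / of_nat n powr s) has_sum (dir_zeta s * exp (- E N) - 1 / of_nat 1 powr s)) (A - {1})"
        by (intro has_sum_Diff) (auto simp: A_def prime_set_def)
      hence "cmod (dir_zeta s * exp (- E N) - 1 / of_nat 1 powr s) \<le> (\<Sum>n. real (n + Suc N) powr (- Re s))"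
      proof (rule has_sum_tail_bound[where g = "\<lambda>n. real n powr (- Re s)"])
        fix n assume n: "n \<in> A - {1}" "n \<le> N"
        then obtain p where p: "prime p" "p dvd n" using prime_factor_nat[of n] by auto
        have "p \<le> n" using p n by (auto simp: A_def intro: dvd_imp_le)
        hence False using p n by (auto simp: A_def prime_set_def)
        thus "1 / of_nat n powr s = (0::complex)" ..
      qed (use s summable_powr[of "Re s"] in \<open>auto simp: norm_divide powr_minus_divide\<close>)
      thus "cmod (1 - dir_zeta s * exp (- E N)) \<le> (\<Sum>n. real (n + Suc N) powr (- Re s))"
        by (simp add: norm_minus_commute)
    qed
  qed
  ultimately have "dir_zeta s * exp (- log_dir s) = 1" using LIMSEQ_unique by blast
  thus ?thesis by (simp add: exp_minus divide_simps)
qed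

section \<open>The Euler product on the line \<open>Re s = 1\<close>\<close>

definition proper_powers :: "nat set" where
  "proper_powers = (\<lambda>(p, k). p ^ k) ` ({p. prime p} \<times> {2..})"

lemma summable_proper_powers: "summable (\<lambda>n. indicator proper_powers n / real n)"
proof -
  have 1: "((\<lambda>k. (1 / real p) ^ k) has_sum (1 / (real p * (real p - 1)))) {2..}" if "p \<ge> 2" for p :: nat
  proof -
    have "(\<lambda>k. (1 / real p) ^ k * (1 / real p) ^ 2) sums (1 / (1 - 1 / real p) * (1 / real p)^2)"
      by (intro sums_mult2 geometric_sums) (use that in auto)
    hence "((\<lambda>k. (1 / real p) ^ k * (1 / real p) ^ 2) has_sum (1 / (1 - 1 / real p) * (1 / real p)^2)) UNIV"
      by (rule sums_nonneg_imp_has_sum) auto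
    also have "(\<lambda>k. (1 / real p) ^ k * (1 / real p) ^ 2) = (\<lambda>k. (1 / real p) ^ k) \<circ> (\<lambda>k. k + 2)"
      by (rule ext) (simp add: power2_eq_square)
    finally have "((\<lambda>k. (1 / real p) ^ k) has_sum (1 / (1 - 1 / real p) * (1 / real p)^2)) ((\<lambda>k. k + 2) ` UNIV)"
      by (subst has_sum_reindex) (auto simp only: inj_def add_right_cancel)
    also have "(\<lambda>k. k + 2) ` UNIV = {2::nat..}"
    proof (intro equalityI subsetI)
      fix k :: nat assume "k \<in> {2..}"
      thus "k \<in> range (\<lambda>k. k + 2)" by (intro image_eqI[of _ _ "k - 2"]) auto
    qed auto
    also have "1 / (1 - 1 / real p) * (1 / real p)^2 = 1 / (real p * (real p - 1))"
      using that by (simp add: field_simps power2_eq_square)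
    finally show ?thesis .
  qed
  have "summable (\<lambda>p. 4 * (1 / real p ^ 2))"
    by (intro summable_mult inverse_power_summable[where 'a = real, of 2, unfolded inverse_eq_divide]) auto
  hence "summable (\<lambda>p. 1 / (real p * (real p - 1)))"
  proof (rule summable_comparison_test'[of _ 2])
    fix n :: nat assume "n \<ge> 2"
    thus "norm (1 / (real n * (real n - 1))) \<le> 4 * (1 / real n ^ 2)"
      by (simp add: divide_simps power2_eq_square)
  qed
  hence "(\<lambda>p. 1 / (real p * (real p - 1))) summable_on UNIV"
    by (rule summable_nonneg_imp_summable_on_strong[OF _ eventually_sequentiallyI[of 1]]) auto
  hence 2: "(\<lambda>p. 1 / (real p * (real p - 1))) summable_on {2..}"
    by (rule summable_on_subset_banach) auto
  have "(\<lambda>(p, k). (1 / real p) ^ k) summable_on (SIGMA p:{2::nat..}. {2..})"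
    by (rule summable_on_SigmaI[OF _ 2]) (use 1 in auto)
  hence 3: "(\<lambda>(p, k). (1 / real p) ^ k) summable_on ({p::nat. prime p} \<times> {2..})"
    by (rule summable_on_subset_banach) (auto simp: prime_ge_2_nat)
  have "(\<lambda>n. 1 / real n) summable_on proper_powers"
    unfolding proper_powers_def
  proof (subst summable_on_reindex)
    show "inj_on (\<lambda>(p, k). p ^ k) ({p::nat. prime p} \<times> {2..})"
    proof (rule inj_onI)
      fix x y assume xy: "x \<in> {p::nat. prime p} \<times> {2::nat..}" "y \<in> {p::nat. prime p} \<times> {2::nat..}"
        "(case x of (p, k) \<Rightarrow> p ^ k) = (case y of (p, k) \<Rightarrow> p ^ k)"
      obtain p k q l where "x = (p, k)" "y = (q, l)" by (cases x, cases y) auto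
      thus "x = y" using xy prime_power_inj'[of p q k l] by simp
    qed
    show "((\<lambda>n. 1 / real n) \<circ> (\<lambda>(p, k). p ^ k)) summable_on {p. prime p} \<times> {2..}"
      using 3 by (simp add: o_def case_prod_unfold power_divide)
  qed
  hence "(\<lambda>n. indicator proper_powers n / real n) summable_on UNIV"
    by (rule summable_on_cong_neutral[THEN iffD1, rotated 3]) auto
  thus ?thesis by (rule summable_on_imp_summable)
qed

lemma filterlim_nat_floor: "filterlim (\<lambda>X::real. nat \<lfloor>X\<rfloor>) sequentially at_top"
  by (rule filterlim_compose[OF filterlim_nat_sequentially filterlim_floor_sequentially])

text \<open>
  Besides the terms \<open>n \<le> X\<close>, the logarithm of the product contains the powers \<open>p\<^sup>k > X\<close> of the primes
  \<open>p \<le> X\<close>. These have \<open>k \<ge> 2\<close>, so they are covered by a tail of a convergent series that is the same for all \<open>t\<close>.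
\<close>

theorem euler_prod_log_approx:
  "\<exists>\<tau>::real \<Rightarrow> real. (\<tau> \<longlongrightarrow> 0) at_top \<and> (\<forall>X t. X \<ge> 0 \<longrightarrow>
     (\<exists>G. euler_prod X (Complex 1 t) = exp G \<and> cmod (G - (\<Sum>n\<le>nat \<lfloor>X\<rfloor>. log_term (Complex 1 t) n)) \<le> \<tau> X))"
proof -
  define g where "g = (\<lambda>n. indicator proper_powers n / real n :: real)"
  let ?\<tau> = "\<lambda>X. \<Sum>n. g (n + Suc (nat \<lfloor>X::real\<rfloor>))"
  show ?thesis
  proof (rule exI[of _ ?\<tau>], intro conjI allI impI)
    show "(?\<tau> \<longlongrightarrow> 0) at_top"
      by (rule filterlim_compose[OF tail_sum_tendsto_0 filterlim_nat_floor]) (use summable_proper_powers in \<open>simp add: g_def\<close>)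
    fix X t :: real assume X: "X \<ge> 0"
    define N where "N = nat \<lfloor>X\<rfloor>"
    define s where "s = Complex 1 t"
    define G where "G = (\<Sum>p\<in>prime_set N. - Ln (1 - 1 / of_nat p powr s))"
    have pn: "{p. prime p \<and> real p \<le> X} = prime_set N"
      using X by (auto simp: prime_set_def N_def le_nat_floor le_nat_iff le_floor_iff)
    have "euler_prod X s = exp G"
      unfolding euler_prod_def pn G_def
      by (rule exp_sum_neg_Ln[symmetric]) (auto simp: s_def prime_prime_set)
    moreover have "cmod (G - (\<Sum>n\<le>N. log_term s n)) \<le> (\<Sum>n. g (n + Suc N))"
    proof (rule has_sum_tail_bound[where D = "powers_of (prime_set N) - {..N}" and f = "\<lambda>n. if n \<in> powers_of (prime_set N) - {..N} then log_term s n else 0"])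
      have "(log_term s has_sum G) (powers_of (prime_set N))"
        unfolding G_def by (rule log_term_powers_of) (auto simp: s_def prime_prime_set)
      moreover have "(log_term s has_sum (\<Sum>n\<in>powers_of (prime_set N) \<inter> {..N}. log_term s n)) (powers_of (prime_set N) \<inter> {..N})"
        by (rule has_sum_finite) auto
      ultimately have "(log_term s has_sum (G - (\<Sum>n\<in>powers_of (prime_set N) \<inter> {..N}. log_term s n)))
         (powers_of (prime_set N) - powers_of (prime_set N) \<inter> {..N})"
        by (intro has_sum_Diff) auto
      also have "powers_of (prime_set N) - powers_of (prime_set N) \<inter> {..N} = powers_of (prime_set N) - {..N}" by auto
      also have "(\<Sum>n\<in>powers_of (prime_set N) \<inter> {..N}. log_term s n) = (\<Sum>n\<le>N. log_term s n)"
        by (rule sum.mono_neutral_left) (use log_coeff_eq_0 in \<open>auto simp: log_term_def\<close>)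
      also have "(log_term s has_sum (G - (\<Sum>n\<le>N. log_term s n))) (powers_of (prime_set N) - {..N}) \<longleftrightarrow>
        ((\<lambda>n. if n \<in> powers_of (prime_set N) - {..N} then log_term s n else 0) has_sum (G - (\<Sum>n\<le>N. log_term s n))) (powers_of (prime_set N) - {..N})"
        by (intro has_sum_cong) auto
      finally show "((\<lambda>n. if n \<in> powers_of (prime_set N) - {..N} then log_term s n else 0) has_sum (G - (\<Sum>n\<le>N. log_term s n))) (powers_of (prime_set N) - {..N})" .
      fix n
      show "cmod (if n \<in> powers_of (prime_set N) - {..N} then log_term s n else 0) \<le> g n"
      proof (cases "n \<in> powers_of (prime_set N) - {..N}")
        case True
        then obtain p k where pk: "prime p" "p \<le> N" "k \<ge> 1" "n = p ^ k" "n > N"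
          by (auto simp: powers_of_def prime_set_def)
        have "k \<ge> 2" using pk by (cases "k = 1") auto
        hence "n \<in> proper_powers" using pk unfolding proper_powers_def by auto
        hence "g n = 1 / real n" by (simp add: g_def)
        moreover have "cmod (log_term s n) \<le> real n powr (- Re s)" by (rule norm_log_term_le)
        moreover have "real n powr (- Re s) = 1 / real n" by (simp add: s_def powr_minus_divide)
        ultimately show ?thesis using True by simp
      next
        case False
        show ?thesis unfolding if_not_P[OF False] by (simp add: g_def)
      qed
    qed (use summable_proper_powers in \<open>auto simp: g_def\<close>)
    ultimately show "\<exists>G. euler_prod X (Complex 1 t) = exp G \<and> cmod (G - (\<Sum>n\<le>nat \<lfloor>X\<rfloor>. log_term (Complex 1 t) n)) \<le> ?\<tau> X"
      unfolding N_def s_def by blast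
  qed
qed

section \<open>Mertens' theorem\<close>

text \<open>
  The partial sum at \<open>s = 1\<close> of the Dirichlet series of \<open>log \<zeta>\<close>, equal to the sum of the absolute values of the
  terms at every \<open>1 + it\<close>.
\<close>

definition log_sum :: "nat \<Rightarrow> real" where
  "log_sum N = (\<Sum>n\<le>N. log_coeff n / real n)"

lemma card_multiples_upto: "d > 0 \<Longrightarrow> card {m\<in>{1..N}. d dvd m} = N div d" for d N :: nat
proof -
  assume d: "d > 0"
  have "{m\<in>{1..N}. d dvd m} = (\<lambda>k. d * k) ` {1..N div d}"
  proof (intro equalityI subsetI)
    fix m assume m: "m \<in> {m\<in>{1..N}. d dvd m}"
    then obtain k where k: "m = d * k" by auto
    have "k \<le> N div d" using m k d by (simp add: less_eq_div_iff_mult_less_eq mult.commute)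
    thus "m \<in> (\<lambda>k. d * k) ` {1..N div d}" using m k by (intro image_eqI[of _ _ k]) (auto simp: Suc_le_eq)
  next
    fix m assume "m \<in> (\<lambda>k. d * k) ` {1..N div d}"
    then obtain k where k: "m = d * k" "k \<ge> 1" "k \<le> N div d" by (elim imageE) auto
    hence "d * k \<le> N" using d by (simp add: less_eq_div_iff_mult_less_eq mult.commute)
    thus "m \<in> {m\<in>{1..N}. d dvd m}" using k d by (auto simp: Suc_le_eq)
  qed
  also have "card \<dots> = N div d" using d by (subst card_image) (auto simp: inj_on_def)
  finally show ?thesis .
qed

text \<open>
  Legendre's formula. The upper limit \<open>M\<close> is free so that the formulas for \<open>N!\<close> and \<open>(2N)!\<close> can be subtracted term by term.
\<close>

lemma ln_fact_mangoldt:
  assumes "N \<le> M"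
  shows "ln (fact N) = (\<Sum>d\<in>{1..M}. mangoldt d * real (N div d))"
proof -
  have "ln (fact N) = ln (\<Prod>m\<in>{1..N}. real m)" by (simp add: fact_prod)
  also have "\<dots> = (\<Sum>m\<in>{1..N}. ln (real m))" by (rule ln_prod) auto
  also have "\<dots> = (\<Sum>m\<in>{1..N}. \<Sum>d\<in>{1..M}. if d dvd m then mangoldt d else 0)"
  proof (rule sum.cong)
    fix m assume m: "m \<in> {1..N}"
    hence "ln (real m) = (\<Sum>d | d dvd m. mangoldt d)"
      using mangoldt_sum[of m, where 'a = real] by simp
    also have "\<dots> = (\<Sum>d\<in>{1..M}. if d dvd m then mangoldt d else 0)"
    proof (rule sum.mono_neutral_cong_left)
      show "{d. d dvd m} \<subseteq> {1..M}"
      proof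
        fix d assume "d \<in> {d. d dvd m}"
        hence "d \<le> m" "d \<noteq> 0" using m by (auto intro: dvd_imp_le)
        thus "d \<in> {1..M}" using m assms by auto
      qed
    qed auto
    finally show "ln (real m) = (\<Sum>d\<in>{1..M}. if d dvd m then mangoldt d else 0)" .
  qed auto
  also have "\<dots> = (\<Sum>d\<in>{1..M}. \<Sum>m\<in>{1..N}. if d dvd m then mangoldt d else 0)" by (rule sum.swap)
  also have "\<dots> = (\<Sum>d\<in>{1..M}. mangoldt d * real (card {m\<in>{1..N}. d dvd m}))"
    by (intro sum.cong refl) (simp add: sum.If_cases Int_def)
  also have "\<dots> = (\<Sum>d\<in>{1..M}. mangoldt d * real (N div d))"
    by (intro sum.cong refl) (subst card_multiples_upto, auto)
  finally show ?thesis .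
qed

text \<open>
  Chebyshev's function \<open>\<psi>\<close>.
\<close>

definition psi_sum :: "nat \<Rightarrow> real" where
  "psi_sum N = (\<Sum>d\<in>{1..N}. mangoldt d)"

text \<open>Chebyshev's bound: the primes in \<open>(N, 2N]\<close> all divide the central binomial coefficient.\<close>

lemma psi_sum_double: "psi_sum (2 * N) \<le> psi_sum N + 2 * real N"
proof -
  have "psi_sum (2 * N) - psi_sum N = (\<Sum>d\<in>{N<..2*N}. mangoldt d)"
  proof -
    have "{1..2*N} = {1..N} \<union> {N<..2*N}" by auto
    thus ?thesis unfolding psi_sum_def by (subst \<open>{1..2*N} = _\<close>, subst sum.union_disjoint) auto
  qed
  also have "\<dots> \<le> (\<Sum>d\<in>{1..2*N}. mangoldt d * (real (2 * N div d) - 2 * real (N div d)))"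
  proof -
    have "(\<Sum>d\<in>{N<..2*N}. mangoldt d) = (\<Sum>d\<in>{N<..2*N}. mangoldt d * (real (2 * N div d) - 2 * real (N div d)))"
    proof (intro sum.cong refl)
      fix d assume d: "d \<in> {N<..2*N}"
      have "2 * N div d = 1" using d by (intro div_nat_eqI) auto
      thus "mangoldt d = mangoldt d * (real (2 * N div d) - 2 * real (N div d))" using d by simp
    qed
    also have "\<dots> \<le> (\<Sum>d\<in>{1..2*N}. mangoldt d * (real (2 * N div d) - 2 * real (N div d)))"
    proof (rule sum_mono2)
      fix d assume "d \<in> {1..2*N} - {N<..2*N}"
      hence "2 * (N div d) \<le> 2 * N div d"
        by (simp add: less_eq_div_iff_mult_less_eq)
      hence "2 * real (N div d) \<le> real (2 * N div d)" by linarith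
      thus "mangoldt d * (real (2 * N div d) - 2 * real (N div d)) \<ge> 0"
        by (intro mult_nonneg_nonneg mangoldt_nonneg) auto
    qed auto
    finally show ?thesis .
  qed
  also have "\<dots> = ln (fact (2 * N)) - 2 * ln (fact N)"
    using ln_fact_mangoldt[of "2*N" "2*N"] ln_fact_mangoldt[of N "2*N"]
    by (simp add: sum_distrib_left sum_subtractf algebra_simps)
  also have "\<dots> = ln (real (2 * N choose N))"
  proof -
    have "fact N * fact (2 * N - N) * (2 * N choose N) = (fact (2 * N) :: nat)"
      by (rule binomial_fact_lemma) auto
    hence "real (fact (2 * N)) = real (fact N * fact N * (2 * N choose N))" by simp
    hence "(fact (2 * N) :: real) = fact N * fact N * real (2 * N choose N)" by simp
    thus ?thesis by (simp add: ln_mult)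
  qed
  also have "\<dots> \<le> ln (2 ^ (2 * N))"
  proof -
    have "real (2 * N choose N) \<le> 2 ^ (2 * N)" using binomial_le_pow2[of "2*N" N]
      by (metis of_nat_le_iff of_nat_numeral of_nat_power)
    moreover have "2 * N choose N > 0" by simp
    ultimately show ?thesis by (subst ln_le_cancel_iff) auto
  qed
  also have "\<dots> = 2 * real N * ln 2" by (simp add: ln_realpow)
  also have "\<dots> \<le> 2 * real N" using ln_2_less_1 by (intro mult_left_le) auto
  finally show ?thesis by simp
qed

lemma psi_sum_le: "psi_sum N \<le> 4 * real N"
proof (induction N rule: less_induct)
  case (less N)
  show ?case
  proof (cases "N = 0")
    case False
    define M where "M = N div 2"
    have M: "psi_sum (2 * M) \<le> 6 * real M"
      using less.IH[of M] psi_sum_double[of M] False by (simp add: M_def)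
    show ?thesis
    proof (cases "even N")
      case True
      hence "N = 2 * M" by (simp add: M_def)
      thus ?thesis using M by simp
    next
      case odd: False
      hence N: "N = Suc (2 * M)" by (simp add: M_def)
      have "psi_sum N = psi_sum (2 * M) + mangoldt N"
        unfolding psi_sum_def N by (subst sum.nat_ivl_Suc') auto
      moreover have "mangoldt N \<le> ln (real N)" using mangoldt_le[of N] False by simp
      moreover have "ln (real N) \<le> real N - 1" using False by (intro ln_le_minus_one) auto
      ultimately show ?thesis using M N by simp
    qed
  qed (simp add: psi_sum_def)
qed

lemma ln_fact_lower: "ln (fact N) \<ge> real N * ln (real N) - real N"
proof (induction N)
  case (Suc N)
  show ?case
  proof (cases "N = 0")
    case False
    have "ln (real (Suc N)) - ln (real N) = ln (real (Suc N) / real N)"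
      using False by (subst ln_div) auto
    also have "real (Suc N) / real N = 1 + 1 / real N" using False by (simp add: field_simps)
    also have "ln (1 + 1 / real N) \<le> 1 / real N" by (rule ln_add_one_self_le_self) auto
    finally have "real N * (ln (real (Suc N)) - ln (real N)) \<le> 1"
      using False by (simp add: field_simps)
    moreover have "ln (fact (Suc N)) = ln (real (Suc N)) + ln (fact N :: real)"
      unfolding fact_Suc of_nat_mult by (subst ln_mult) auto
    ultimately show ?thesis using Suc by (simp add: algebra_simps)
  qed auto
qed auto

lemma ln_fact_upper: "ln (fact N) \<le> real N * ln (real N)"
proof (cases "N = 0")
  case False
  have "ln (fact N) \<le> ln (real (N ^ N))"
    using fact_le_power[of N, where 'a = real] False by (subst ln_le_cancel_iff) auto
  thus ?thesis using False by (simp add: ln_realpow)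
qed auto

text \<open>
  Divide Legendre's formula for \<open>ln N!\<close> by \<open>N\<close>: removing the rounding from \<open>N div n\<close> costs at most
  \<open>psi_sum N\<close>, which is \<open>O(N)\<close>.
\<close>

lemma mertens_first:
  assumes "N \<ge> 1"
  shows "\<bar>(\<Sum>n\<in>{1..N}. mangoldt n / real n) - ln (real N)\<bar> \<le> 4"
proof -
  define W where "W = (\<Sum>n\<in>{1..N}. mangoldt n / real n :: real)"
  have 1: "real N * W \<ge> ln (fact N)"
    unfolding ln_fact_mangoldt[OF order_refl] W_def sum_distrib_left
  proof (rule sum_mono)
    fix n assume "n \<in> {1..N}"
    have "real (N div n) \<le> real N / real n" by (rule of_nat_div_le_of_nat)
    hence "mangoldt n * real (N div n) \<le> mangoldt n * (real N / real n)"
      by (intro mult_left_mono mangoldt_nonneg)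
    thus "mangoldt n * real (N div n) \<le> real N * (mangoldt n / real n)" by (simp add: mult.commute)
  qed
  have 2: "real N * W \<le> ln (fact N) + psi_sum N"
    unfolding ln_fact_mangoldt[OF order_refl] W_def sum_distrib_left psi_sum_def sum.distrib[symmetric]
  proof (rule sum_mono)
    fix n assume "n \<in> {1..N}"
    have "real (N div n) = of_int \<lfloor>real N / real n\<rfloor>" by (simp add: floor_divide_of_nat_eq)
    hence "real N / real n - real (N div n) \<le> 1" by linarith
    hence "mangoldt n * (real N / real n) \<le> mangoldt n * (real (N div n) + 1)"
      by (intro mult_left_mono mangoldt_nonneg) auto
    thus "real N * (mangoldt n / real n) \<le> mangoldt n * real (N div n) + mangoldt n"
      by (simp add: algebra_simps)
  qed
  have "real N * (W - ln (real N)) \<le> real N * 4"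
    using 2 psi_sum_le[of N] ln_fact_upper[of N] by (simp add: algebra_simps)
  moreover have "real N * (W - ln (real N)) \<ge> real N * (- 1)"
    using 1 ln_fact_lower[of N] by (simp add: algebra_simps)
  ultimately have "W - ln (real N) \<le> 4" "W - ln (real N) \<ge> -1"
    using assms by (simp_all only: mult_le_cancel_left_pos of_nat_0_less_iff Suc_le_eq One_nat_def)
  thus ?thesis unfolding W_def by auto
qed

lemma sum_by_parts_lessThan:
  fixes v x :: "nat \<Rightarrow> real"
  shows "(\<Sum>n<N. v n * x n) = (\<Sum>n<N. v n) * x N + (\<Sum>n<N. (\<Sum>k\<le>n. v k) * (x n - x (Suc n)))"
  by (induction N) (simp_all add: algebra_simps lessThan_Suc_atMost flip: lessThan_Suc_atMost)

text \<open>
  Dirichlet's test: after summation by parts the bounded sums of \<open>v\<close> meet the increments of \<open>x\<close>, which telescope.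
\<close>

lemma summable_bounded_decreasing:
  fixes v x :: "nat \<Rightarrow> real"
  assumes B: "\<And>N. \<bar>\<Sum>n<N. v n\<bar> \<le> B" and dec: "\<And>n. x (Suc n) \<le> x n" and lim: "x \<longlonglongrightarrow> 0"
  shows "summable (\<lambda>n. v n * x n)"
proof -
  have "summable (\<lambda>n. x n - x (Suc n))" using telescope_summable'[OF lim] by simp
  hence "summable (\<lambda>n. B * (x n - x (Suc n)))" by (rule summable_mult)
  hence "summable (\<lambda>n. (\<Sum>k\<le>n. v k) * (x n - x (Suc n)))"
  proof (rule summable_comparison_test'[of _ 0])
    fix n
    show "norm ((\<Sum>k\<le>n. v k) * (x n - x (Suc n))) \<le> B * (x n - x (Suc n))"
      using B[of "Suc n"] dec[of n] by (simp add: abs_mult lessThan_Suc_atMost mult_right_mono)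
  qed
  moreover have "(\<lambda>N. (\<Sum>n<N. v n) * x N) \<longlonglongrightarrow> 0"
  proof (rule Lim_null_comparison)
    show "\<forall>\<^sub>F N in sequentially. norm ((\<Sum>n<N. v n) * x N) \<le> B * \<bar>x N\<bar>"
      using B by (intro always_eventually allI) (simp add: abs_mult mult_right_mono)
    show "(\<lambda>N. B * \<bar>x N\<bar>) \<longlonglongrightarrow> 0" using tendsto_mult_right_zero[OF tendsto_rabs_zero[OF lim]] .
  qed
  ultimately have "(\<lambda>N. (\<Sum>n<N. v n) * x N + (\<Sum>n<N. (\<Sum>k\<le>n. v k) * (x n - x (Suc n)))) \<longlonglongrightarrow> 0 + (\<Sum>n. (\<Sum>k\<le>n. v k) * (x n - x (Suc n)))"
    by (intro tendsto_add summable_LIMSEQ)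
  thus ?thesis unfolding sum_by_parts_lessThan[symmetric] summable_def sums_def by blast
qed

text \<open>
  Abel's theorem for Dirichlet series. After summation by parts the partial sums beyond \<open>N0\<close>, where they are close to their
  limit, contribute at most \<open>e / 3\<close>; the weight of the finitely many earlier ones tends to \<open>0\<close> with \<open>\<delta>\<close>.
\<close>

lemma abel_dirichlet:
  fixes v :: "nat \<Rightarrow> real" and g :: "real \<Rightarrow> real"
  assumes V: "(\<lambda>N. \<Sum>n<N. v n) \<longlonglongrightarrow> l"
    and g: "\<And>\<delta>. \<delta> > 0 \<Longrightarrow> (\<lambda>n. v n * real (Suc n) powr (-\<delta>)) sums g \<delta>"
  shows "(g \<longlongrightarrow> l) (at_right 0)"
proof (rule tendstoI)
  fix e :: real assume e: "e > 0"
  define D where "D = (\<lambda>N. (\<Sum>n<N. v n) - l)"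
  have D0: "D \<longlonglongrightarrow> 0" using V by (simp add: D_def LIM_zero)
  then obtain K where K: "\<And>N. \<bar>D N\<bar> \<le> K"
    using convergent_imp_Bseq[of D] by (auto simp: convergent_def Bseq_def)
  obtain N0 where N0: "\<And>n. n \<ge> N0 \<Longrightarrow> \<bar>D n\<bar> \<le> e / 3"
    using D0 e unfolding LIMSEQ_iff by (metis diff_zero divide_pos_pos less_imp_le real_norm_def zero_less_numeral)
  have bound: "\<bar>g \<delta> - l\<bar> \<le> K * (1 - real (Suc N0) powr (-\<delta>)) + e / 3" if d: "\<delta> > 0" for \<delta>
  proof -
    define x where "x = (\<lambda>n. real (Suc n) powr (-\<delta>))"
    have dec: "x (Suc n) \<le> x n" for n unfolding x_def using d by (intro powr_mono2') auto
    have x0: "x 0 = 1" by (simp add: x_def)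
    have xlim: "x \<longlonglongrightarrow> 0" unfolding x_def using d by real_asymp
    have b: "\<bar>(\<Sum>n<N. v n * x n) - l\<bar> \<le> K * x N + (K * (1 - x N0) + e / 3)" if N: "N \<ge> N0" for N
    proof -
      have tel: "(\<Sum>n<M. x n - x (Suc n)) = 1 - x M" for M
        using sum_lessThan_telescope'[of x M] x0 by simp
      have "(\<Sum>n<N. (\<Sum>k\<le>n. v k) * (x n - x (Suc n))) = (\<Sum>n<N. D (Suc n) * (x n - x (Suc n)) + l * (x n - x (Suc n)))"
        by (intro sum.cong refl) (simp add: D_def lessThan_Suc_atMost algebra_simps)
      also have "\<dots> = (\<Sum>n<N. D (Suc n) * (x n - x (Suc n))) + l * (1 - x N)"
        by (simp add: sum.distrib sum_distrib_left[symmetric] tel)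
      finally have "(\<Sum>n<N. v n * x n) - l = D N * x N + (\<Sum>n<N. D (Suc n) * (x n - x (Suc n)))"
        by (simp add: sum_by_parts_lessThan D_def algebra_simps)
      also have "\<bar>\<dots>\<bar> \<le> \<bar>D N * x N\<bar> + \<bar>\<Sum>n<N. D (Suc n) * (x n - x (Suc n))\<bar>" by linarith
      also have "\<bar>D N * x N\<bar> \<le> K * x N" using K[of N] by (simp add: abs_mult x_def mult_right_mono)
      also have "\<bar>\<Sum>n<N. D (Suc n) * (x n - x (Suc n))\<bar> \<le> (\<Sum>n<N. \<bar>D (Suc n)\<bar> * (x n - x (Suc n)))"
        using sum_abs[of "\<lambda>n. D (Suc n) * (x n - x (Suc n))" "{..<N}"] dec by (simp add: abs_mult)
      also have "(\<Sum>n<N. \<bar>D (Suc n)\<bar> * (x n - x (Suc n))) =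
         (\<Sum>n<N0. \<bar>D (Suc n)\<bar> * (x n - x (Suc n))) + (\<Sum>n\<in>{N0..<N}. \<bar>D (Suc n)\<bar> * (x n - x (Suc n)))"
        using N by (simp add: lessThan_atLeast0 sum.atLeastLessThan_concat)
      also have "(\<Sum>n<N0. \<bar>D (Suc n)\<bar> * (x n - x (Suc n))) \<le> (\<Sum>n<N0. K * (x n - x (Suc n)))"
        using K dec by (intro sum_mono mult_right_mono) auto
      also have "\<dots> = K * (1 - x N0)" by (simp add: sum_distrib_left[symmetric] tel)
      also have "(\<Sum>n\<in>{N0..<N}. \<bar>D (Suc n)\<bar> * (x n - x (Suc n))) \<le> (\<Sum>n\<in>{N0..<N}. e / 3 * (x n - x (Suc n)))"
        using N0 dec by (intro sum_mono mult_right_mono) auto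
      also have "\<dots> \<le> (\<Sum>n<N. e / 3 * (x n - x (Suc n)))"
        using dec e by (intro sum_mono2) auto
      also have "\<dots> = e / 3 * (1 - x N)" by (simp only: sum_distrib_left[symmetric] tel)
      also have "\<dots> \<le> e / 3 * 1" using e by (intro mult_left_mono) (auto simp: x_def)
      finally show ?thesis by simp
    qed
    have "(\<lambda>N. \<bar>(\<Sum>n<N. v n * x n) - l\<bar>) \<longlonglongrightarrow> \<bar>g \<delta> - l\<bar>"
      using g[OF d] unfolding sums_def x_def by (intro tendsto_intros)
    moreover have "(\<lambda>N. K * x N + (K * (1 - x N0) + e / 3)) \<longlonglongrightarrow> K * 0 + (K * (1 - x N0) + e / 3)"
      by (intro tendsto_intros xlim)
    ultimately have "\<bar>g \<delta> - l\<bar> \<le> K * 0 + (K * (1 - x N0) + e / 3)"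
      by (rule LIMSEQ_le) (use b in blast)
    thus ?thesis by (simp add: x_def)
  qed
  have "((\<lambda>\<delta>. K * (1 - real (Suc N0) powr (-\<delta>)) + e / 3) \<longlongrightarrow> K * (1 - real (Suc N0) powr (-0)) + e / 3) (at_right 0)"
    by (intro tendsto_intros) auto
  hence "eventually (\<lambda>\<delta>. K * (1 - real (Suc N0) powr (-\<delta>)) + e / 3 < e) (at_right 0)"
    by (rule order_tendstoD) (use e in auto)
  with eventually_at_right_less[of 0] show "eventually (\<lambda>\<delta>. dist (g \<delta>) l < e) (at_right 0)"
  proof eventually_elim
    case (elim \<delta>)
    thus ?case using bound[of \<delta>] by (simp add: dist_real_def)
  qed
qed

text \<open>
  Write \<open>\<Lambda>(n) / n\<close> as \<open>ln n - ln (n - 1)\<close> plus \<open>v\<close>. By Mertens' estimate \<open>v\<close> has bounded sums, so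
  Dirichlet's test applies with the factor \<open>1 / ln n\<close>. The main part
  divided by \<open>ln n\<close> is close to the increment of \<open>ln ln n\<close>, with a telescoping bound for the difference.
\<close>

lemma summable_log_sum_increments:
  "summable (\<lambda>n. log_coeff (n+3) / real (n+3) - (ln (ln (real (n+3))) - ln (ln (real (n+2)))))"
proof -
  define b where "b = (\<lambda>n. ln (real (n+3)) - ln (real (n+2)))"
  define v where "v = (\<lambda>n. mangoldt (n+3) / real (n+3) - b n)"
  define x where "x = (\<lambda>n::nat. 1 / ln (real (n+3)))"
  have sb: "(\<Sum>n<N. b n) = ln (real (N+2)) - ln 2" for N
    unfolding b_def by (induction N) (auto simp: eval_nat_numeral algebra_simps)
  have sm: "(\<Sum>n<N. mangoldt (n+3) / real (n+3)) = (\<Sum>n\<in>{1..N+2}. mangoldt n / real n) - ln 2 / (2::real)" for N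
  proof (induction N)
    case 0
    have "{1..2} = {1, 2::nat}" by auto
    moreover have "mangoldt 2 = ln (2::real)" using mangoldt_prime[of 2, where 'a = real] by simp
    ultimately show ?case by (simp add: numeral_2_eq_2)
  next
    case (Suc N)
    have "{1..Suc N + 2} = insert (N + 3) {1..N+2}" by auto
    thus ?case using Suc by simp
  qed
  have 1: "summable (\<lambda>n. v n * x n)"
  proof (rule summable_bounded_decreasing)
    fix N
    have "(\<Sum>n<N. v n) = (\<Sum>n\<in>{1..N+2}. mangoldt n / real n) - ln (real (N+2)) + ln 2 / 2"
      unfolding v_def sum_subtractf sb sm by (simp add: field_simps)
    moreover have "\<bar>(\<Sum>n\<in>{1..N+2}. mangoldt n / real n) - ln (real (N+2))\<bar> \<le> 4" by (rule mertens_first) auto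
    moreover have "ln 2 / 2 \<le> (1::real)" "ln 2 / 2 \<ge> (0::real)" using ln_2_less_1 by auto
    ultimately show "\<bar>\<Sum>n<N. v n\<bar> \<le> 5" by linarith
    show "x (Suc n) \<le> x n" for n unfolding x_def by (intro divide_left_mono mult_pos_pos) auto
    show "x \<longlonglongrightarrow> 0" unfolding x_def by real_asymp
  qed
  have 2: "summable (\<lambda>n. b n * x n - (ln (ln (real (n+3))) - ln (ln (real (n+2)))))"
  proof (rule summable_comparison_test'[of "\<lambda>n. 1 / ln (real (n+2)) - 1 / ln (real (Suc n+2))" 0])
    have "(\<lambda>n. 1 / ln (real (n+2))) \<longlonglongrightarrow> 0" by real_asymp
    from telescope_summable'[OF this] show "summable (\<lambda>n. 1 / ln (real (n+2)) - 1 / ln (real (Suc n+2)))" by simp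
    fix n :: nat
    define p where "p = ln (real (n+2))"
    define q where "q = ln (real (n+3))"
    have pq: "0 < p" "p \<le> q" unfolding p_def q_def by auto
    have "q - p = ln (real (n+3) / real (n+2))" unfolding p_def q_def by (subst ln_div) auto
    also have "real (n+3) / real (n+2) = 1 + 1 / real (n+2)" by (simp add: field_simps)
    also have "ln (1 + 1 / real (n+2)) \<le> 1 / real (n+2)" by (rule ln_add_one_self_le_self) auto
    also have "\<dots> \<le> 1" by simp
    finally have b1: "q - p \<le> 1" .
    have "ln q - ln p = ln (q / p)" using pq by (subst ln_div) auto
    also have "\<dots> \<le> q / p - 1" using pq by (intro ln_le_minus_one) auto
    also have "\<dots> = (q - p) / p" using pq by (simp add: field_simps)
    finally have up: "ln q - ln p \<le> (q - p) / p" .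
    have "ln p - ln q = ln (p / q)" using pq by (subst ln_div) auto
    also have "\<dots> \<le> p / q - 1" using pq by (intro ln_le_minus_one) auto
    also have "\<dots> = - ((q - p) / q)" using pq by (simp add: field_simps)
    finally have lo: "ln q - ln p \<ge> (q - p) / q" by simp
    have "(q - p) / p - (q - p) / q = (q - p) * (1 / p - 1 / q)" by (simp add: algebra_simps)
    also have "\<dots> \<le> 1 * (1 / p - 1 / q)" using b1 pq by (intro mult_right_mono) (auto simp: divide_simps)
    finally have d: "(q - p) / p - (q - p) / q \<le> 1 / p - 1 / q" by simp
    have e: "b n * x n - (ln (ln (real (n+3))) - ln (ln (real (n+2)))) = (q - p) / q - (ln q - ln p)"
      by (simp add: b_def x_def p_def q_def)
    have e2: "1 / ln (real (n+2)) - 1 / ln (real (Suc n+2)) = 1 / p - 1 / q"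
      by (simp add: p_def q_def eval_nat_numeral)
    show "norm (b n * x n - (ln (ln (real (n+3))) - ln (ln (real (n+2))))) \<le> 1 / ln (real (n+2)) - 1 / ln (real (Suc n+2))"
      unfolding e e2 using up lo d by (simp only: real_norm_def)
  qed
  have eq: "v n * x n + (b n * x n - (ln (ln (real (n+3))) - ln (ln (real (n+2))))) =
      log_coeff (n+3) / real (n+3) - (ln (ln (real (n+3))) - ln (ln (real (n+2))))" for n
    by (simp add: v_def x_def log_coeff_def algebra_simps)
  show ?thesis using summable_add[OF 1 2] unfolding eq .
qed

lemma log_sum_convergent: "convergent (\<lambda>N. log_sum (N+2) - ln (ln (real (N+2))))"
proof -
  have s: "(\<Sum>n<N. log_coeff (n+3) / real (n+3) - (ln (ln (real (n+3))) - ln (ln (real (n+2))))) + (log_sum 2 - ln (ln 2)) =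
     log_sum (N+2) - ln (ln (real (N+2)))" for N
  proof (induction N)
    case (Suc N)
    have "log_sum (Suc N + 2) = log_sum (N + 2) + log_coeff (N+3) / real (N+3)"
      by (simp add: log_sum_def eval_nat_numeral)
    thus ?case using Suc by (simp add: eval_nat_numeral algebra_simps)
  qed (simp add: numeral_2_eq_2)
  have "(\<lambda>N. (\<Sum>n<N. log_coeff (n+3) / real (n+3) - (ln (ln (real (n+3))) - ln (ln (real (n+2))))) + (log_sum 2 - ln (ln 2)))
      \<longlonglongrightarrow> (\<Sum>n. log_coeff (n+3) / real (n+3) - (ln (ln (real (n+3))) - ln (ln (real (n+2))))) + (log_sum 2 - ln (ln 2))"
    by (intro tendsto_intros summable_LIMSEQ summable_log_sum_increments)
  thus ?thesis unfolding s convergent_def by blast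
qed

text \<open>
  Weight \<open>1 / m\<close> at \<open>2\<^sup>m\<close>: a model for \<open>log_coeff n / n\<close> whose partial sums are harmonic numbers and whose Dirichlet series is
  \<open>- ln (1 - q)\<close> with \<open>q\<close> the power \<open>- \<delta>\<close> of \<open>2\<close>. Both asymptotic expansions are explicit, which allows to compare constants
  by Abel's theorem.
\<close>

definition dyadic_weight :: "nat \<Rightarrow> real" where
  "dyadic_weight n = (if n \<in> (\<lambda>m. 2 ^ m) ` {1..} then 1 / log 2 (real n) else 0)"

lemma dyadic_weight_power: "m \<ge> 1 \<Longrightarrow> dyadic_weight (2 ^ m) = 1 / real m"
  by (auto simp: dyadic_weight_def log_nat_power)

lemma dyadic_weight_sum: "(\<Sum>n\<in>{1..N}. dyadic_weight n) = harm (nat \<lfloor>log 2 (real N)\<rfloor>)" if "N \<ge> 1"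
proof -
  define M where "M = nat \<lfloor>log 2 (real N)\<rfloor>"
  have l0: "log 2 (real N) \<ge> 0" using that by simp
  have le: "2 ^ m \<le> N \<longleftrightarrow> m \<le> M" for m
  proof -
    have "2 ^ m \<le> N \<longleftrightarrow> real (2 ^ m) \<le> real N" by (simp only: of_nat_le_iff)
    also have "\<dots> \<longleftrightarrow> 2 powr real m \<le> real N" by (simp add: powr_realpow)
    also have "\<dots> \<longleftrightarrow> real m \<le> log 2 (real N)" using that by (simp add: le_log_iff)
    also have "\<dots> \<longleftrightarrow> m \<le> M" unfolding M_def using l0 by linarith
    finally show ?thesis .
  qed
  have "(\<Sum>n\<in>{1..N}. dyadic_weight n) = (\<Sum>n\<in>(\<lambda>m. 2 ^ m) ` {1..M}. dyadic_weight n)"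
    by (rule sum.mono_neutral_right) (auto simp: dyadic_weight_def le)
  also have "\<dots> = (\<Sum>m\<in>{1..M}. dyadic_weight (2 ^ m))"
    by (subst sum.reindex) (auto simp: inj_on_def)
  also have "\<dots> = harm M" unfolding harm_def
    by (intro sum.cong refl) (simp add: dyadic_weight_power inverse_eq_divide)
  finally show ?thesis unfolding M_def .
qed

lemma dyadic_weight_asymp:
  "(\<lambda>N. (\<Sum>n\<in>{1..N}. dyadic_weight n) - ln (ln (real N))) \<longlonglongrightarrow> euler_mascheroni - ln (ln 2)"
proof -
  define M where "M = (\<lambda>N. nat \<lfloor>log 2 (real N)\<rfloor>)"
  have M: "filterlim M sequentially sequentially"
    unfolding M_def
  proof (rule filterlim_compose[OF filterlim_nat_sequentially filterlim_compose[OF filterlim_floor_sequentially]])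
    show "filterlim (\<lambda>N. log 2 (real N)) at_top sequentially" by real_asymp
  qed
  have "(\<lambda>N. harm (M N) - ln (real (M N))) \<longlonglongrightarrow> euler_mascheroni"
    using filterlim_compose[OF euler_mascheroni_LIMSEQ M] by simp
  moreover have "(\<lambda>N. ln (real (M N)) - ln (log 2 (real N))) \<longlonglongrightarrow> 0"
  proof (rule real_tendsto_sandwich)
    show "(\<lambda>N::nat. ln (log 2 (real N) - 1) - ln (log 2 (real N))) \<longlonglongrightarrow> 0" by real_asymp
    have b: "log 2 (real N) - 1 \<le> real (M N)" "real (M N) \<le> log 2 (real N)" "log 2 (real N) \<ge> 2" if "N \<ge> 4" for N
    proof -
      have "log 2 4 \<le> log 2 (real N)" using that by (subst log_le_cancel_iff) auto
      moreover have "log 2 4 = (2::real)" using log_nat_power[of 2 2 2] by simp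
      ultimately show "log 2 (real N) \<ge> 2" by simp
      thus "log 2 (real N) - 1 \<le> real (M N)" "real (M N) \<le> log 2 (real N)" unfolding M_def by linarith+
    qed
    show "\<forall>\<^sub>F N in sequentially. ln (log 2 (real N) - 1) - ln (log 2 (real N)) \<le> ln (real (M N)) - ln (log 2 (real N))"
    proof (rule eventually_sequentiallyI[of 4])
      fix N :: nat assume "N \<ge> 4"
      thus "ln (log 2 (real N) - 1) - ln (log 2 (real N)) \<le> ln (real (M N)) - ln (log 2 (real N))"
        using b[of N] by (intro diff_right_mono ln_mono) auto
    qed
    show "\<forall>\<^sub>F N in sequentially. ln (real (M N)) - ln (log 2 (real N)) \<le> 0"
    proof (rule eventually_sequentiallyI[of 4])
      fix N :: nat assume "N \<ge> 4"
      hence "ln (real (M N)) \<le> ln (log 2 (real N))"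
        using b[of N] by (intro ln_mono) auto
      thus "ln (real (M N)) - ln (log 2 (real N)) \<le> 0" by simp
    qed
  qed auto
  moreover have "(\<lambda>N. ln (log 2 (real N)) - ln (ln (real N))) \<longlonglongrightarrow> - ln (ln 2)"
  proof (rule tendsto_eventually, rule eventually_sequentiallyI[of 2])
    fix N :: nat assume "N \<ge> 2"
    hence "ln (real N) > 0" "ln 2 > (0::real)" by auto
    thus "ln (log 2 (real N)) - ln (ln (real N)) = - ln (ln 2)"
      unfolding log_def by (subst ln_div) auto
  qed
  ultimately have "(\<lambda>N. (harm (M N) - ln (real (M N))) + (ln (real (M N)) - ln (log 2 (real N))) + (ln (log 2 (real N)) - ln (ln (real N))))
      \<longlonglongrightarrow> euler_mascheroni + 0 + - ln (ln 2)" by (intro tendsto_add)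
  also have "?this \<longleftrightarrow> ?thesis"
    by (intro filterlim_cong eventually_sequentiallyI[of 1]) (use dyadic_weight_sum in \<open>auto simp: M_def\<close>)
  finally show ?thesis .
qed

lemma dyadic_weight_transform:
  assumes d: "\<delta> > 0"
  shows "(\<lambda>n. dyadic_weight (Suc n) * real (Suc n) powr (-\<delta>)) sums (- ln (1 - 2 powr (-\<delta>)))"
proof -
  define q where "q = 2 powr (-\<delta>)"
  have q: "0 < q" "q < 1" unfolding q_def using d by (auto simp: powr_less_one)
  have "(\<lambda>n. - ((- (-q)) ^ n) / of_nat n) sums ln (1 + (-q))" by (rule ln_series') (use q in simp)
  from sums_minus[OF this] have "(\<lambda>n. q ^ n / of_nat n) sums (- ln (1 - q))" by simp
  hence "((\<lambda>n. q ^ n / of_nat n) has_sum (- ln (1 - q))) UNIV"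
    by (rule sums_nonneg_imp_has_sum) (use q in auto)
  also have "?this \<longleftrightarrow> ((\<lambda>n. q ^ n / of_nat n) has_sum (- ln (1 - q))) {1..}"
    by (rule has_sum_cong_neutral) (auto simp: not_le)
  also have "\<dots> \<longleftrightarrow> (((\<lambda>n. dyadic_weight n * real n powr (-\<delta>)) \<circ> (\<lambda>m. 2 ^ m)) has_sum (- ln (1 - q))) {1..}"
  proof (rule has_sum_cong)
    fix m :: nat assume m: "m \<in> {1..}"
    have "real (2 ^ m) powr (-\<delta>) = q ^ m"
      unfolding q_def by (simp add: powr_realpow[symmetric] powr_powr mult.commute flip: powr_realpow)
    thus "q ^ m / of_nat m = ((\<lambda>n. dyadic_weight n * real n powr (-\<delta>)) \<circ> (\<lambda>m. 2 ^ m)) m"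
      using m by (simp add: dyadic_weight_power)
  qed
  also have "\<dots> \<longleftrightarrow> ((\<lambda>n. dyadic_weight n * real n powr (-\<delta>)) has_sum (- ln (1 - q))) ((\<lambda>m. 2 ^ m) ` {1..})"
    by (rule has_sum_reindex[symmetric]) (auto simp: inj_on_def)
  also have "\<dots> \<longleftrightarrow> ((\<lambda>n. dyadic_weight n * real n powr (-\<delta>)) has_sum (- ln (1 - q))) (range Suc)"
    by (rule has_sum_cong_neutral) (auto simp: dyadic_weight_def image_iff, metis Suc_pred zero_less_numeral zero_less_power)
  also have "\<dots> \<longleftrightarrow> ((\<lambda>n. dyadic_weight (Suc n) * real (Suc n) powr (-\<delta>)) has_sum (- ln (1 - q))) UNIV"
    by (subst has_sum_reindex) (auto simp: o_def)
  finally show ?thesis unfolding q_def by (rule has_sum_imp_sums)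
qed

lemma log_coeff_transform:
  assumes d: "\<delta> > 0"
  shows "(\<lambda>n. log_coeff (Suc n) / real (Suc n) * real (Suc n) powr (-\<delta>)) sums (ln (cmod (Zeta1 (of_real (1 + \<delta>)))) - ln \<delta>)"
proof -
  define s where "s = complex_of_real (1 + \<delta>)"
  have s: "Re s > 1" using d by (simp add: s_def)
  have trm: "log_term s n = of_real (log_coeff n / real n * real n powr (-\<delta>))" for n
  proof (cases "n = 0")
    case False
    have "(of_nat n :: complex) powr s = of_real (real n powr (1 + \<delta>))"
      unfolding s_def using powr_of_real[of "real n" "1 + \<delta>"] by simp
    thus ?thesis using False by (simp add: log_term_def powr_add powr_minus_divide)
  qed (simp add: log_term_def)
  have "summable (log_term s)" using summable_norm_cancel[OF summable_norm_log_term[OF s]] .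
  hence "log_term s sums log_dir s" unfolding log_dir_def by (rule summable_sums)
  hence 1: "(\<lambda>n. log_coeff n / real n * real n powr (-\<delta>)) sums Re (log_dir s)"
    using sums_Re[of "log_term s"] unfolding trm by simp
  have "exp (log_dir s) = dir_zeta s" by (rule exp_log_dir[OF s])
  also have "\<dots> = Zeta1 s / of_real \<delta>" using Zeta1_dir[OF s] d by (simp add: s_def)
  finally have "cmod (exp (log_dir s)) = cmod (Zeta1 s / of_real \<delta>)" by simp
  hence e: "exp (Re (log_dir s)) = cmod (Zeta1 s) / \<delta>" using d by (simp add: norm_divide)
  hence pos: "cmod (Zeta1 s) > 0" using d exp_gt_zero[of "Re (log_dir s)"] by (auto simp: zero_less_divide_iff)
  have "Re (log_dir s) = ln (cmod (Zeta1 s) / \<delta>)" using e by (metis ln_exp)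
  also have "\<dots> = ln (cmod (Zeta1 s)) - ln \<delta>" using pos d by (subst ln_div) auto
  finally have "(\<lambda>n. log_coeff n / real n * real n powr (-\<delta>)) sums (ln (cmod (Zeta1 s)) - ln \<delta>)" using 1 by simp
  thus ?thesis unfolding s_def by (subst sums_Suc_iff) simp
qed

text \<open>
  The difference of \<open>log_coeff n / n\<close> and the dyadic weights has a convergent sum, whose value by Abel's theorem is the limit
  for \<open>\<delta> \<rightarrow> 0\<close> of the difference of the Dirichlet series. There \<open>\<zeta>(1 + \<delta>)\<close> behaves like \<open>1 / \<delta>\<close>, and
  Euler's constant comes from the harmonic numbers.
\<close>

theorem mertens_log_sum: "((\<lambda>x::real. log_sum (nat \<lfloor>x\<rfloor>) - ln (ln x)) \<longlongrightarrow> euler_mascheroni) at_top"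
proof -
  obtain M where "(\<lambda>N. log_sum (N+2) - ln (ln (real (N+2)))) \<longlonglongrightarrow> M"
    using log_sum_convergent by (auto simp: convergent_def)
  hence M: "(\<lambda>N. log_sum N - ln (ln (real N))) \<longlonglongrightarrow> M" by (rule LIMSEQ_offset)
  define v where "v = (\<lambda>n. log_coeff (Suc n) / real (Suc n) - dyadic_weight (Suc n))"
  have v: "(\<Sum>n<N. v n) = log_sum N - (\<Sum>n\<in>{1..N}. dyadic_weight n)" for N
    unfolding v_def log_sum_def by (induction N) auto
  have "(\<lambda>N. (log_sum N - ln (ln (real N))) - ((\<Sum>n\<in>{1..N}. dyadic_weight n) - ln (ln (real N)))) \<longlonglongrightarrow> M - (euler_mascheroni - ln (ln 2))"
    by (intro tendsto_diff M dyadic_weight_asymp)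
  hence V: "(\<lambda>N. \<Sum>n<N. v n) \<longlonglongrightarrow> M - (euler_mascheroni - ln (ln 2))" unfolding v by simp
  define g where "g = (\<lambda>\<delta>. (ln (cmod (Zeta1 (of_real (1 + \<delta>)))) - ln \<delta>) - (- ln (1 - 2 powr (-\<delta>))))"
  have "(g \<longlongrightarrow> M - (euler_mascheroni - ln (ln 2))) (at_right 0)"
  proof (rule abel_dirichlet[OF V])
    fix \<delta> :: real assume d: "\<delta> > 0"
    show "(\<lambda>n. v n * real (Suc n) powr (-\<delta>)) sums g \<delta>"
      using sums_diff[OF log_coeff_transform[OF d] dyadic_weight_transform[OF d]]
      unfolding v_def g_def left_diff_distrib .
  qed
  moreover have "(g \<longlongrightarrow> ln (ln 2)) (at_right 0)"
  proof -
    have "continuous_on UNIV Zeta1" by (intro holomorphic_on_imp_continuous_on holomorphic_Zeta1)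
    hence "isCont Zeta1 1" by (simp add: continuous_on_eq_continuous_at)
    moreover have "((\<lambda>\<delta>. complex_of_real (1 + \<delta>)) \<longlongrightarrow> of_real (1 + 0)) (at_right 0)" by (intro tendsto_intros)
    ultimately have "((\<lambda>\<delta>. Zeta1 (of_real (1 + \<delta>))) \<longlongrightarrow> Zeta1 1) (at_right 0)"
      using isCont_tendsto_compose[of "1" Zeta1 "\<lambda>\<delta>. complex_of_real (1 + \<delta>)" "at_right 0"] by simp
    hence "((\<lambda>\<delta>. ln (cmod (Zeta1 (of_real (1 + \<delta>))))) \<longlongrightarrow> ln (cmod (Zeta1 1))) (at_right 0)"
      by (intro tendsto_intros) auto
    moreover have "((\<lambda>\<delta>::real. ln (1 - 2 powr (-\<delta>)) - ln \<delta>) \<longlongrightarrow> ln (ln 2)) (at_right 0)" by real_asymp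
    ultimately have "((\<lambda>\<delta>. ln (cmod (Zeta1 (of_real (1 + \<delta>)))) + (ln (1 - 2 powr (-\<delta>)) - ln \<delta>)) \<longlongrightarrow> ln (cmod (Zeta1 1)) + ln (ln 2)) (at_right 0)"
      by (rule tendsto_add)
    thus ?thesis by (simp add: g_def algebra_simps)
  qed
  ultimately have "M - (euler_mascheroni - ln (ln 2)) = ln (ln 2)"
    using tendsto_unique trivial_limit_at_right_real by blast
  hence "M = euler_mascheroni" by simp
  with M have "(\<lambda>N. log_sum N - ln (ln (real N))) \<longlonglongrightarrow> euler_mascheroni" by simp
  from filterlim_compose[OF this filterlim_nat_floor]
  have 1: "((\<lambda>x::real. log_sum (nat \<lfloor>x\<rfloor>) - ln (ln (real (nat \<lfloor>x\<rfloor>)))) \<longlongrightarrow> euler_mascheroni) at_top" .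
  have "((\<lambda>x::real. ln (ln (real (nat \<lfloor>x\<rfloor>))) - ln (ln x)) \<longlongrightarrow> 0) at_top"
  proof (rule real_tendsto_sandwich)
    show "((\<lambda>x::real. ln (ln (x - 1)) - ln (ln x)) \<longlongrightarrow> 0) at_top" by real_asymp
    have b: "ln (ln (x - 1)) \<le> ln (ln (real (nat \<lfloor>x\<rfloor>)))" "ln (ln (real (nat \<lfloor>x\<rfloor>))) \<le> ln (ln x)" if x: "x \<ge> 3" for x :: real
    proof -
      have n: "x - 1 \<le> real (nat \<lfloor>x\<rfloor>)" "real (nat \<lfloor>x\<rfloor>) \<le> x" using x by linarith+
      have "ln (x - 1) > 0" "ln (real (nat \<lfloor>x\<rfloor>)) > 0" using x n by (intro ln_gt_zero; linarith)+
      moreover have "ln (x - 1) \<le> ln (real (nat \<lfloor>x\<rfloor>))" "ln (real (nat \<lfloor>x\<rfloor>)) \<le> ln x" using n x by (intro ln_mono; linarith)+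
      ultimately have "ln (ln (x - 1)) \<le> ln (ln (real (nat \<lfloor>x\<rfloor>))) \<and> ln (ln (real (nat \<lfloor>x\<rfloor>))) \<le> ln (ln x)"
        by (metis ln_mono order_less_le_trans)
      thus "ln (ln (x - 1)) \<le> ln (ln (real (nat \<lfloor>x\<rfloor>)))" "ln (ln (real (nat \<lfloor>x\<rfloor>))) \<le> ln (ln x)" by auto
    qed
    show "\<forall>\<^sub>F x::real in at_top. ln (ln (x - 1)) - ln (ln x) \<le> ln (ln (real (nat \<lfloor>x\<rfloor>))) - ln (ln x)"
      using eventually_ge_at_top[of 3] by eventually_elim (use b in auto)
    show "\<forall>\<^sub>F x::real in at_top. ln (ln (real (nat \<lfloor>x\<rfloor>))) - ln (ln x) \<le> 0"
      using eventually_ge_at_top[of 3] by eventually_elim (use b in auto)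
  qed auto
  from tendsto_add[OF 1 this] show ?thesis by simp
qed

section \<open>Non-vanishing on the line \<open>Re s = 1\<close>\<close>

lemma Re_log_term: "Re (log_term (Complex \<sigma> t) n) = log_coeff n * real n powr (-\<sigma>) * cos (t * ln (real n))"
proof (cases "n = 0")
  case False
  have "log_term (Complex \<sigma> t) n = of_real (log_coeff n) * of_nat n powr (- Complex \<sigma> t)"
    by (simp add: log_term_def powr_minus_divide)
  also have "of_nat n powr (- Complex \<sigma> t) = exp (- Complex \<sigma> t * of_real (ln (real n)))"
    using False by (simp add: powr_def)
  also have "\<dots> = of_real (exp (- \<sigma> * ln (real n))) * cis (- (t * ln (real n)))"
    by (simp add: exp_eq_polar algebra_simps)
  also have "exp (- \<sigma> * ln (real n)) = real n powr (-\<sigma>)" using False by (simp add: powr_def)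
  finally show ?thesis by simp
qed (simp add: log_term_def)

lemma cnj_log_term: "cnj (log_term s n) = log_term (cnj s) n"
  by (cases "n = 0") (simp_all add: log_term_def powr_def exp_cnj)

lemma log_dir_sums: "Re s > 1 \<Longrightarrow> log_term s sums log_dir s"
  unfolding log_dir_def by (intro summable_sums summable_norm_cancel[OF summable_norm_log_term])

lemma cnj_log_dir: "Re s > 1 \<Longrightarrow> cnj (log_dir s) = log_dir (cnj s)"
  using log_dir_sums[of s] log_dir_sums[of "cnj s"] sums_unique2
  unfolding sums_cnj[of "log_term s", symmetric] cnj_log_term by fastforce

lemma norm_log_dir_le: "Re s \<ge> \<sigma> \<Longrightarrow> \<sigma> > 1 \<Longrightarrow> cmod (log_dir s) \<le> (\<Sum>n. real n powr (-\<sigma>))"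
  unfolding log_dir_def
proof (rule norm_suminf_le[OF _ summable_powr])
  fix n assume "Re s \<ge> \<sigma>" "\<sigma> > 1"
  show "cmod (log_term s n) \<le> real n powr (-\<sigma>)"
  proof (cases "n = 0")
    case False
    have "cmod (log_term s n) \<le> real n powr (- Re s)" by (rule norm_log_term_le)
    also have "\<dots> \<le> real n powr (-\<sigma>)" using False \<open>Re s \<ge> \<sigma>\<close> by (intro powr_mono) auto
    finally show ?thesis .
  qed (simp add: log_term_def)
qed

lemma norm_Zeta1_log_dir: "Re s > 1 \<Longrightarrow> cmod (Zeta1 s) = cmod (s - 1) * exp (Re (log_dir s))"
  using exp_log_dir[of s] Zeta1_dir[of s] by (simp add: norm_mult flip: norm_exp_eq_Re)

text \<open>
  The inequality \<open>3 + 4 cos x + cos 2x = 2 (1 + cos x)\<^sup>2 \<ge> 0\<close>, applied to each term.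
\<close>

lemma three_four_one:
  assumes "\<sigma> > 1"
  shows "3 * Re (log_dir (Complex \<sigma> 0)) + 4 * Re (log_dir (Complex \<sigma> t)) + Re (log_dir (Complex \<sigma> (2 * t))) \<ge> 0"
proof -
  have S: "(\<lambda>n. Re (log_term (Complex \<sigma> u) n)) sums Re (log_dir (Complex \<sigma> u))" for u
    using assms by (intro sums_Re log_dir_sums) auto
  have s: "(\<lambda>n. 3 * Re (log_term (Complex \<sigma> 0) n) + 4 * Re (log_term (Complex \<sigma> t) n) + Re (log_term (Complex \<sigma> (2 * t)) n))
      sums (3 * Re (log_dir (Complex \<sigma> 0)) + 4 * Re (log_dir (Complex \<sigma> t)) + Re (log_dir (Complex \<sigma> (2 * t))))"
    by (intro sums_add sums_mult S)
  have nn: "3 * Re (log_term (Complex \<sigma> 0) n) + 4 * Re (log_term (Complex \<sigma> t) n) + Re (log_term (Complex \<sigma> (2 * t)) n) \<ge> 0" for n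
  proof -
    define c where "c = cos (t * ln (real n))"
    have c2: "cos (2 * t * ln (real n)) = 2 * c\<^sup>2 - 1"
      using cos_double_cos[of "t * ln (real n)"] by (simp add: c_def mult.assoc)
    have "3 * Re (log_term (Complex \<sigma> 0) n) + 4 * Re (log_term (Complex \<sigma> t) n) + Re (log_term (Complex \<sigma> (2 * t)) n)
       = log_coeff n * real n powr (-\<sigma>) * (2 * (1 + c)\<^sup>2)"
      unfolding Re_log_term c2 by (simp add: c_def power2_eq_square algebra_simps)
    thus ?thesis by (simp add: log_coeff_nonneg)
  qed
  show ?thesis by (rule sums_le[OF nn sums_zero s])
qed

text \<open>
  The product \<open>\<bar>\<zeta>(\<sigma>)\<^sup>3 \<zeta>(\<sigma> + it)\<^sup>4 \<zeta>(\<sigma> + 2it)\<bar>\<close> is at least \<open>1\<close> for \<open>\<sigma> > 1\<close>. A zero at \<open>1 + it\<close> would outweigh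
  the triple pole: in terms of \<open>Zeta1\<close>, a factor \<open>\<sigma> - 1\<close> is left over and the product would tend to \<open>0\<close>.
\<close>

lemma Zeta1_nonzero_line_1: "Zeta1 (Complex 1 t) \<noteq> 0"
proof (cases "t = 0")
  case True
  hence "Complex 1 t = 1" by (simp add: complex_eq_iff)
  thus ?thesis by simp
next
  case t: False
  show ?thesis
  proof
    assume z: "Zeta1 (Complex 1 t) = 0"
    have hol: "(Zeta1 has_field_derivative deriv Zeta1 (Complex 1 t)) (at (Complex 1 t))"
      by (rule holomorphic_derivI[OF holomorphic_Zeta1[of UNIV]]) auto
    have C: "isCont Zeta1 s" for s
      using holomorphic_on_imp_continuous_on[OF holomorphic_Zeta1[of UNIV]] by (simp add: continuous_on_eq_continuous_at)
    have to: "((\<lambda>\<sigma>. Complex \<sigma> u) \<longlongrightarrow> Complex 1 u) (at_right 1)" for u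
      by (intro tendsto_Complex tendsto_const tendsto_ident_at)
    define d where "d = deriv Zeta1 (Complex 1 t)"
    have "((\<lambda>\<sigma>. (Zeta1 (Complex \<sigma> t) - Zeta1 (Complex 1 t)) / (Complex \<sigma> t - Complex 1 t)) \<longlongrightarrow> d) (at_right 1)"
    proof (rule filterlim_compose[of "\<lambda>s. (Zeta1 s - Zeta1 (Complex 1 t)) / (s - Complex 1 t)"])
      show "((\<lambda>s. (Zeta1 s - Zeta1 (Complex 1 t)) / (s - Complex 1 t)) \<longlongrightarrow> d) (at (Complex 1 t))"
        using hol unfolding has_field_derivative_iff d_def by simp
      show "filterlim (\<lambda>\<sigma>. Complex \<sigma> t) (at (Complex 1 t)) (at_right 1)"
        using to[of t] by (intro filterlim_atI) (auto simp: eventually_at_filter)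
    qed
    moreover have e: "Complex \<sigma> t - Complex 1 t = of_real (\<sigma> - 1)" for \<sigma> by (simp add: complex_eq_iff)
    ultimately have D: "((\<lambda>\<sigma>. Zeta1 (Complex \<sigma> t) / of_real (\<sigma> - 1)) \<longlongrightarrow> d) (at_right 1)"
      by (simp only: z e diff_zero)
    have t1: "((\<lambda>\<sigma>. cmod (Zeta1 (Complex \<sigma> 0)) ^ 3 * cmod (Zeta1 (Complex \<sigma> t) / of_real (\<sigma> - 1)) ^ 4 * (\<sigma> - 1) * cmod (Zeta1 (Complex \<sigma> (2 * t))))
       \<longlongrightarrow> cmod (Zeta1 (Complex 1 0)) ^ 3 * cmod d ^ 4 * (1 - 1) * cmod (Zeta1 (Complex 1 (2 * t)))) (at_right 1)"
      by (intro tendsto_intros D isCont_tendsto_compose[OF C] to)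
    have t2: "((\<lambda>\<sigma>. cmod (Complex \<sigma> t - 1) ^ 4 * cmod (Complex \<sigma> (2 * t) - 1)) \<longlongrightarrow> cmod (Complex 1 t - 1) ^ 4 * cmod (Complex 1 (2 * t) - 1)) (at_right 1)"
      by (intro tendsto_intros to)
    have t3: "\<forall>\<^sub>F \<sigma> in at_right 1. cmod (Complex \<sigma> t - 1) ^ 4 * cmod (Complex \<sigma> (2 * t) - 1) \<le>
        cmod (Zeta1 (Complex \<sigma> 0)) ^ 3 * cmod (Zeta1 (Complex \<sigma> t) / of_real (\<sigma> - 1)) ^ 4 * (\<sigma> - 1) * cmod (Zeta1 (Complex \<sigma> (2 * t)))"
      using eventually_at_right_less[of 1]
    proof eventually_elim
      case (elim \<sigma>)
      have alg: "(x * A) ^ 3 * (b * B / x) ^ 4 * x * (c * D) = b ^ 4 * c * (A ^ 3 * B ^ 4 * D)" if "x \<noteq> 0" for x A b B c D :: real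
        using that by (simp add: field_simps eval_nat_numeral)
      define R where "R = (\<lambda>u. Re (log_dir (Complex \<sigma> u)))"
      have n: "cmod (Zeta1 (Complex \<sigma> u)) = cmod (Complex \<sigma> u - 1) * exp (R u)" for u
        using elim norm_Zeta1_log_dir[of "Complex \<sigma> u"] by (simp add: R_def)
      have n0: "cmod (Complex \<sigma> 0 - 1) = \<sigma> - 1"
        using elim by (simp add: cmod_def)
      have "cmod (Zeta1 (Complex \<sigma> 0)) ^ 3 * cmod (Zeta1 (Complex \<sigma> t) / of_real (\<sigma> - 1)) ^ 4 * (\<sigma> - 1) * cmod (Zeta1 (Complex \<sigma> (2 * t)))
        = cmod (Complex \<sigma> t - 1) ^ 4 * cmod (Complex \<sigma> (2 * t) - 1) * (exp (R 0) ^ 3 * exp (R t) ^ 4 * exp (R (2 * t)))"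
        unfolding norm_divide n n0 norm_of_real abs_of_pos[OF elim[THEN diff_gt_0_iff_gt[THEN iffD2]]]
        by (rule alg) (use elim in simp)
      also have "exp (R 0) ^ 3 * exp (R t) ^ 4 * exp (R (2 * t)) = exp (3 * R 0 + 4 * R t + R (2 * t))"
        by (simp add: exp_add exp_of_nat_mult[of 3 "R 0", simplified] exp_of_nat_mult[of 4 "R t", simplified])
      finally have eq: "cmod (Zeta1 (Complex \<sigma> 0)) ^ 3 * cmod (Zeta1 (Complex \<sigma> t) / of_real (\<sigma> - 1)) ^ 4 * (\<sigma> - 1) * cmod (Zeta1 (Complex \<sigma> (2 * t)))
        = cmod (Complex \<sigma> t - 1) ^ 4 * cmod (Complex \<sigma> (2 * t) - 1) * exp (3 * R 0 + 4 * R t + R (2 * t))" .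
      have "exp (3 * R 0 + 4 * R t + R (2 * t)) \<ge> 1" using three_four_one[of \<sigma> t] elim by (simp add: R_def)
      hence "cmod (Complex \<sigma> t - 1) ^ 4 * cmod (Complex \<sigma> (2 * t) - 1) * 1 \<le>
          cmod (Complex \<sigma> t - 1) ^ 4 * cmod (Complex \<sigma> (2 * t) - 1) * exp (3 * R 0 + 4 * R t + R (2 * t))"
        by (intro mult_left_mono) auto
      thus ?case unfolding eq by simp
    qed
    have "cmod (Complex 1 t - 1) ^ 4 * cmod (Complex 1 (2 * t) - 1) \<le> cmod (Zeta1 (Complex 1 0)) ^ 3 * cmod d ^ 4 * (1 - 1) * cmod (Zeta1 (Complex 1 (2 * t)))"
      by (rule tendsto_le[OF trivial_limit_at_right_real t1 t2 t3])
    moreover have "Complex 1 t - 1 \<noteq> 0" "Complex 1 (2 * t) - 1 \<noteq> 0" using t by (auto simp: complex_eq_iff)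
    hence "cmod (Complex 1 t - 1) ^ 4 * cmod (Complex 1 (2 * t) - 1) > 0"
      by (metis mult_pos_pos zero_less_power zero_less_norm_iff)
    ultimately show False by simp
  qed
qed

section \<open>The logarithm of zeta under the Riemann hypothesis\<close>

text \<open>
  Used to compare branches of logarithms: a continuous function with values in the discrete set \<open>2\<pi>i\<int>\<close> is
  constant on connected sets.
\<close>

lemma exp_eq_1_const:
  fixes f :: "'a :: topological_space \<Rightarrow> complex"
  assumes A: "connected A" "continuous_on A f" and e: "\<And>x. x \<in> A \<Longrightarrow> exp (f x) = 1"
    and xy: "x \<in> A" "y \<in> A"
  shows "f x = f y"
proof -
  have "f constant_on A"
  proof (rule continuous_discrete_range_constant[OF A])
    fix x assume x: "x \<in> A"
    show "\<exists>e>0. \<forall>y. y \<in> A \<and> f y \<noteq> f x \<longrightarrow> e \<le> cmod (f y - f x)"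
    proof (intro exI[of _ "2 * pi"] conjI allI impI)
      fix y assume y: "y \<in> A \<and> f y \<noteq> f x"
      have "exp (f y - f x) = 1" using e x y by (simp add: exp_diff)
      then obtain k :: int where k: "Re (f y - f x) = 0" "Im (f y - f x) = of_int (2 * k) * pi"
        by (auto simp: exp_eq_1)
      have "k \<noteq> 0" using k y by (auto simp: complex_eq_iff)
      hence "\<bar>real_of_int k\<bar> \<ge> 1" by linarith
      hence "2 * pi * 1 \<le> 2 * pi * \<bar>real_of_int k\<bar>" by (intro mult_left_mono) auto
      also have "\<dots> = \<bar>Im (f y - f x)\<bar>" unfolding k by (simp add: abs_mult)
      also have "\<dots> \<le> cmod (f y - f x)" by (rule abs_Im_le_cmod)
      finally show "2 * pi \<le> cmod (f y - f x)" by simp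
    qed auto
  qed
  thus ?thesis using xy unfolding constant_on_def by metis
qed

lemma holomorphic_log_dir: "log_dir holomorphic_on {s. Re s > 1}"
  unfolding log_dir_def
proof (rule holomorphic_on_suminf_loc)
  show "(\<lambda>s. log_term s n) holomorphic_on {s. Re s > 1}" for n
    by (cases "n = 0") (auto intro!: holomorphic_intros simp: log_term_def)
  fix z assume z: "z \<in> {s. Re s > 1}"
  define d where "d = (Re z - 1) / 2"
  have d: "d > 0" "Re z - d > 1" using z by (auto simp: d_def field_simps)
  show "\<exists>d>0. \<exists>M. cball z d \<subseteq> {s. Re s > 1} \<and> summable M \<and>
          (\<forall>n. \<forall>w\<in>cball z d. cmod (log_term w n) \<le> M n)"
  proof (intro exI[of _ d] conjI exI[of _ "\<lambda>n. real n powr (-(Re z - d))"] allI ballI)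
    show "cball z d \<subseteq> {s. Re s > 1}" using Re_cball_ge[of _ z d] d by force
    show "summable (\<lambda>n. real n powr (-(Re z - d)))" by (rule summable_powr) (use d in auto)
    show "cmod (log_term w n) \<le> real n powr (-(Re z - d))" if "w \<in> cball z d" for n w
    proof (cases "n = 0")
      case False
      have "cmod (log_term w n) \<le> real n powr (- Re w)" by (rule norm_log_term_le)
      also have "\<dots> \<le> real n powr (-(Re z - d))" using False Re_cball_ge[OF that] by (intro powr_mono) auto
      finally show ?thesis .
    qed (simp add: log_term_def)
  qed (use d in auto)
qed auto

text \<open>
  A logarithm of \<open>(s - 1) \<zeta>(s)\<close> has no singularity at the pole of \<open>\<zeta>\<close>. The last clause fixes the branch; subtracting
  \<open>Ln (s - 1)\<close> then gives the branch of \<open>log \<zeta>\<close> with cut along the real axis to the left of \<open>1\<close>.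
\<close>

definition log_Zeta1 :: "complex \<Rightarrow> complex" where
  "log_Zeta1 = (SOME g. g holomorphic_on {s. Re s > 1/2} \<and> (\<forall>s. Re s > 1/2 \<longrightarrow> exp (g s) = Zeta1 s) \<and>
      (\<forall>s. Re s > 1 \<longrightarrow> g s = log_dir s + Ln (s - 1)))"

definition log_zeta :: "complex \<Rightarrow> complex" where
  "log_zeta s = log_Zeta1 s - Ln (s - 1)"

lemma Zeta1_nonzero:
  assumes rh: "riemann_hypothesis" and s: "Re s > 1/2"
  shows "Zeta1 s \<noteq> 0"
proof (cases "Re s > 1")
  case True
  hence "s \<noteq> 1" by auto
  thus ?thesis using norm_Zeta1_log_dir[OF True] by auto
next
  case False
  show ?thesis
  proof (cases "Re s = 1")
    case True
    hence "s = Complex 1 (Im s)" by (simp add: complex_eq_iff)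
    thus ?thesis using Zeta1_nonzero_line_1 by metis
  next
    case ne: False
    hence "s \<noteq> 1" by auto
    have "zeta s \<noteq> 0"
    proof
      assume "zeta s = 0"
      hence "s \<in> nontrivial_zeros" using s ne False by (auto simp: nontrivial_zeros_def)
      thus False using rh s by (auto simp: riemann_hypothesis_def)
    qed
    thus ?thesis using \<open>s \<noteq> 1\<close> by (auto simp: zeta_eq_Zeta1)
  qed
qed

text \<open>
  The half plane is simply connected and \<open>Zeta1\<close> has no zero in it, so a holomorphic logarithm exists. On
  \<open>Re s > 1\<close> it differs from \<open>log_dir s + Ln (s - 1)\<close> by a constant, which is then added.
\<close>

lemma
  assumes rh: "riemann_hypothesis"
  shows holomorphic_log_Zeta1: "log_Zeta1 holomorphic_on {s. Re s > 1/2}"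
    and exp_log_Zeta1: "Re s > 1/2 \<Longrightarrow> exp (log_Zeta1 s) = Zeta1 s"
    and log_Zeta1_log_dir: "Re s > 1 \<Longrightarrow> log_Zeta1 s = log_dir s + Ln (s - 1)"
proof -
  let ?U = "{s::complex. Re s > 1/2}"
  have "convex ?U" using convex_halfspace_Re_gt[of "1/2"] by simp
  hence "simply_connected ?U" by (rule convex_imp_simply_connected)
  then obtain g where g: "g holomorphic_on ?U" "\<And>s. s \<in> ?U \<Longrightarrow> Zeta1 s = exp (g s)"
    using simply_connected_imp_holomorphic_log[OF holomorphic_Zeta1, of ?U] Zeta1_nonzero[OF rh]
      convex_imp_locally_path_connected[OF \<open>convex ?U\<close>] by (metis mem_Collect_eq)
  define h where "h = (\<lambda>s. log_dir s + Ln (s - 1) - g s)"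
  have hc: "continuous_on {s. Re s > 1} h"
    unfolding h_def
    by (intro continuous_intros holomorphic_on_imp_continuous_on holomorphic_log_dir holomorphic_on_subset[OF g(1)])
       (auto simp: complex_nonpos_Reals_iff)
  have eh: "exp (h s) = 1" if "Re s > 1" for s
  proof -
    have "s \<noteq> 1" using that by auto
    thus ?thesis using that g(2)[of s] exp_log_dir[OF that] Zeta1_dir[OF that] Zeta1_nonzero[OF rh, of s]
      by (auto simp: h_def exp_diff exp_add mult.commute)
  qed
  have hk: "h s = h 2" if "Re s > 1" for s
    by (rule exp_eq_1_const[OF connected_Re_gt hc]) (use that eh in auto)
  have "\<exists>g. g holomorphic_on ?U \<and> (\<forall>s. Re s > 1/2 \<longrightarrow> exp (g s) = Zeta1 s) \<and>
      (\<forall>s. Re s > 1 \<longrightarrow> g s = log_dir s + Ln (s - 1))"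
  proof (intro exI[of _ "\<lambda>s. g s + h 2"] conjI allI impI)
    show "(\<lambda>s. g s + h 2) holomorphic_on ?U" by (intro holomorphic_intros g)
    show "exp (g s + h 2) = Zeta1 s" if "Re s > 1/2" for s
      using that g(2)[of s] eh[of 2] by (simp add: exp_add)
    show "g s + h 2 = log_dir s + Ln (s - 1)" if "Re s > 1" for s
      using hk[OF that] by (simp add: h_def algebra_simps)
  qed
  note * = someI_ex[OF this, folded log_Zeta1_def]
  show "log_Zeta1 holomorphic_on ?U" using * by blast
  show "exp (log_Zeta1 s) = Zeta1 s" if "Re s > 1/2" using * that by blast
  show "log_Zeta1 s = log_dir s + Ln (s - 1)" if "Re s > 1" using * that by blast
qed

context
  assumes rh: "riemann_hypothesis"
begin

lemma log_zeta_log_dir: "Re s > 1 \<Longrightarrow> log_zeta s = log_dir s"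
  using log_Zeta1_log_dir[OF rh, of s] by (simp add: log_zeta_def)

lemma exp_log_zeta: "Re s > 1/2 \<Longrightarrow> s \<noteq> 1 \<Longrightarrow> exp (log_zeta s) = zeta s"
  using exp_log_Zeta1[OF rh, of s] by (simp add: log_zeta_def exp_diff zeta_eq_Zeta1)

lemma holomorphic_log_zeta:
  "log_zeta holomorphic_on ({s. Re s > 1/2} - {s. Im s = 0 \<and> Re s \<le> 1})"
  unfolding log_zeta_def
  by (intro holomorphic_intros holomorphic_on_subset[OF holomorphic_log_Zeta1[OF rh]])
     (auto simp: complex_nonpos_Reals_iff)

lemma holomorphic_log_zeta': "(\<And>s. s \<in> A \<Longrightarrow> Re s > 1/2 \<and> (Im s \<noteq> 0 \<or> Re s > 1)) \<Longrightarrow> log_zeta holomorphic_on A"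
  by (rule holomorphic_on_subset[OF holomorphic_log_zeta]) force

end

section \<open>The function \<open>S\<close> as a boundary value\<close>

text \<open>
  A continuous argument and the imaginary part of a continuous logarithm differ by a constant.
\<close>

lemma arg_change_eq:
  assumes l: "continuous_on {0..1} l" and fl: "\<And>x. x \<in> {0..1} \<Longrightarrow> f (p x) = exp (l x)"
  shows "arg_change f p = Im (l 1) - Im (l 0)"
  unfolding arg_change_def
proof (rule the_equality)
  show "\<exists>\<theta>. continuous_on {0..1} \<theta> \<and> (\<forall>x\<in>{0..1}. f (p x) = of_real (cmod (f (p x))) * cis (\<theta> x)) \<and>
          Im (l 1) - Im (l 0) = \<theta> 1 - \<theta> 0"
    by (rule exI[of _ "\<lambda>x. Im (l x)"]) (auto intro!: continuous_intros l simp: fl exp_eq_polar[of "l x" for x] norm_mult)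
  fix d assume "\<exists>\<theta>. continuous_on {0..1} \<theta> \<and> (\<forall>x\<in>{0..1}. f (p x) = of_real (cmod (f (p x))) * cis (\<theta> x)) \<and> d = \<theta> 1 - \<theta> 0"
  then obtain \<theta> where \<theta>: "continuous_on {0..1} \<theta>" "\<And>x. x \<in> {0..1} \<Longrightarrow> f (p x) = of_real (cmod (f (p x))) * cis (\<theta> x)" "d = \<theta> 1 - \<theta> 0"
    by blast
  define h where "h = (\<lambda>x::real. \<i> * of_real (\<theta> x - Im (l x)))"
  have "h 1 = h 0"
  proof (rule exp_eq_1_const[of "{0..1}" h])
    show "continuous_on {0..1} h" unfolding h_def by (intro continuous_intros \<theta> l)
    fix x :: real assume x: "x \<in> {0..1}"
    have "of_real (exp (Re (l x))) * cis (Im (l x)) = of_real (exp (Re (l x))) * cis (\<theta> x)"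
      using \<theta>(2)[OF x] exp_eq_polar[of "l x"] unfolding fl[OF x] norm_exp_eq_Re by simp
    hence "cis (\<theta> x) = cis (Im (l x))" by simp
    thus "exp (h x) = 1" unfolding h_def cis_conv_exp[symmetric] cis_divide[symmetric] by simp
  qed auto
  hence "of_real (\<theta> 1 - Im (l 1)) = (of_real (\<theta> 0 - Im (l 0)) :: complex)" unfolding h_def by simp
  thus "d = Im (l 1) - Im (l 0)" using \<theta>(3) unfolding of_real_eq_iff by linarith
qed

lemma S_path_first: "x \<in> {0..1/2} \<Longrightarrow> S_path t x = Complex 2 (2 * x * t)"
  by (auto simp: S_path_def joinpaths_def linepath_def complex_eq_iff scaleR_conv_of_real algebra_simps)

lemma S_path_second: "x \<in> {1/2..1} \<Longrightarrow> S_path t x = Complex (1/2 + 3 * (1 - x)) t"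
  by (cases "x = 1/2")
     (auto simp: S_path_def joinpaths_def linepath_def complex_eq_iff scaleR_conv_of_real algebra_simps)

text \<open>
  If \<open>t\<close> is not the ordinate of a zero, \<open>\<zeta>\<close> has a continuous logarithm \<open>l\<close> along the path that defines \<open>S t\<close>, end point included.
  Before the end point \<open>l\<close> differs from \<open>log_zeta\<close> by a constant, and \<open>log_zeta 2\<close> is real.
\<close>

lemma S_boundary_value:
  assumes rh: "riemann_hypothesis" and t: "t > 0" "t \<notin> Im ` nontrivial_zeros"
  shows "((\<lambda>\<sigma>. Im (log_zeta (Complex \<sigma> t))) \<longlongrightarrow> pi * S t) (at_right (1/2))"
proof -
  define p where "p = S_path t"
  have pc: "continuous_on {0..1} p"
  proof -
    have "path (S_path t)" by (simp add: S_path_def)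
    thus ?thesis by (simp add: path_def p_def)
  qed
  have Rep: "(Re (p x) > 1/2 \<or> x = 1) \<and> (Im (p x) \<noteq> 0 \<or> Re (p x) > 1) \<and> Re (p x) \<ge> 1/2" if "x \<in> {0..1}" for x
    using that t S_path_first[of x t] S_path_second[of x t] by (cases "x \<le> 1/2") (auto simp: p_def)
  hence p1: "p x \<noteq> 1" if "x \<in> {0..1}" for x using that by force
  have pend: "p 1 = Complex (1/2) t" using S_path_second[of 1 t] by (simp add: p_def)
  have zc: "continuous_on (- {1}) zeta"
  proof -
    have "(\<lambda>s. Zeta1 s / (s - 1)) holomorphic_on - {1}" by (intro holomorphic_intros) auto
    hence "zeta holomorphic_on - {1}" by (rule holomorphic_transform) (auto simp: zeta_eq_Zeta1)
    thus ?thesis by (rule holomorphic_on_imp_continuous_on)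
  qed
  have cont: "continuous_on {0..1} (zeta \<circ> p)"
    by (rule continuous_on_compose[OF pc continuous_on_subset[OF zc]]) (use p1 in auto)
  have nz: "(zeta \<circ> p) x \<noteq> 0" if x: "x \<in> {0..1}" for x
  proof (cases "x = 1")
    case True
    have "Complex (1/2) t \<notin> nontrivial_zeros" using t by force
    thus ?thesis using True by (simp add: pend nontrivial_zeros_def)
  next
    case False
    thus ?thesis using Rep[OF x] p1[OF x] exp_log_zeta[OF rh, of "p x"] by (metis comp_apply exp_not_eq_zero)
  qed
  obtain l where l: "continuous_on {0..1} l" "\<And>x. x \<in> {0..1} \<Longrightarrow> (zeta \<circ> p) x = exp (l x)"
    using continuous_logarithm_on_contractible[OF cont _ nz] convex_imp_contractible[of "{0..1::real}"] by auto
  have S: "pi * S t = Im (l 1) - Im (l 0)"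
    using t arg_change_eq[OF l(1), of zeta p] l(2) by (simp add: S_def S_pre_def p_def)
  have lz: "log_zeta holomorphic_on (p ` {0..<1})"
    using Rep by (intro holomorphic_log_zeta'[OF rh]) fastforce
  have const: "l x - log_zeta (p x) = l 0 - log_zeta (p 0)" if x: "x \<in> {0..<1}" for x
  proof (rule exp_eq_1_const[of "{0..<1}" "\<lambda>x. l x - log_zeta (p x)"])
    show "continuous_on {0..<1} (\<lambda>x. l x - log_zeta (p x))"
      using holomorphic_on_imp_continuous_on[OF lz]
      by (intro continuous_intros continuous_on_subset[OF l(1)] continuous_on_compose2[OF _ continuous_on_subset[OF pc]]) auto
    fix x :: real assume x: "x \<in> {0..<1}"
    show "exp (l x - log_zeta (p x)) = 1"
      using exp_log_zeta[OF rh, of "p x"] Rep[of x] p1[of x] l(2)[of x] nz[of x] x by (auto simp: exp_diff)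
  qed (use x in auto)
  have p0: "p 0 = 2" using S_path_first[of 0 t] by (simp add: p_def complex_eq_iff)
  have "Im (log_zeta 2) = 0"
  proof -
    have "cnj (log_dir 2) = log_dir 2" using cnj_log_dir[of 2] by simp
    thus ?thesis using log_zeta_log_dir[OF rh, of 2] by (simp add: complex_eq_iff)
  qed
  hence Im: "Im (log_zeta (p x)) = Im (l x) - Im (l 0)" if "x \<in> {0..<1}" for x
    using arg_cong[OF const[OF that], of Im] p0 by simp
  have lim: "((\<lambda>\<sigma>. Im (l (1 - (\<sigma> - 1/2) / 3)) - Im (l 0)) \<longlongrightarrow> Im (l 1) - Im (l 0)) (at_right (1/2))"
  proof (intro tendsto_intros)
    have "((\<lambda>\<sigma>::real. 1 - (\<sigma> - 1/2) / 3) \<longlongrightarrow> 1 - (1/2 - 1/2) / 3) (at_right (1/2))" by (intro tendsto_intros) simp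
    hence *: "((\<lambda>\<sigma>::real. 1 - (\<sigma> - 1/2) / 3) \<longlongrightarrow> 1) (at_right (1/2))" by simp
    show "((\<lambda>\<sigma>. l (1 - (\<sigma> - 1/2) / 3)) \<longlongrightarrow> l 1) (at_right (1/2))"
    proof (rule continuous_on_tendsto_compose[OF l(1) *])
      show "\<forall>\<^sub>F \<sigma> in at_right (1/2). 1 - (\<sigma> - 1/2) / 3 \<in> {0..1::real}"
        using eventually_at_right_real[of "1/2" "1::real"] by (auto elim!: eventually_mono)
    qed auto
  qed
  show ?thesis unfolding S
  proof (rule Lim_transform_eventually[OF lim])
    show "\<forall>\<^sub>F \<sigma> in at_right (1/2). Im (l (1 - (\<sigma> - 1/2) / 3)) - Im (l 0) = Im (log_zeta (Complex \<sigma> t))"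
      using eventually_at_right_real[of "1/2" "1::real", simplified]
    proof eventually_elim
      case (elim \<sigma>)
      have "1/2 + 3 * (1 - (1 - (\<sigma> - 1/2) / 3)) = \<sigma>" by (simp add: field_simps)
      hence "p (1 - (\<sigma> - 1/2) / 3) = Complex \<sigma> t"
        using elim S_path_second[of "1 - (\<sigma> - 1/2) / 3" t] unfolding p_def by auto
      thus ?case using Im[of "1 - (\<sigma> - 1/2) / 3"] elim by simp
    qed
  qed
qed

section \<open>The argument of zeta to the right of the critical line\<close>

text \<open>Jensen's inequality for the number of zeros: every zero is traded for a Blaschke factor.\<close>

lemma zeros_count_bound:
  fixes f :: "complex \<Rightarrow> complex"
  assumes U: "open U" "cball c R \<subseteq> U" and r: "0 < r" "r < R"
    and W: "finite W"
  shows "f holomorphic_on U \<Longrightarrow> (\<And>z. cmod (z - c) = R \<Longrightarrow> cmod (f z) \<le> M) \<Longrightarrow>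
     (\<And>w. w \<in> W \<Longrightarrow> cmod (w - c) \<le> r \<and> f w = 0) \<Longrightarrow> (R / r) ^ card W * cmod (f c) \<le> M"
  using W
proof (induction W arbitrary: f rule: finite_induct)
  case (empty f)
  have "cmod (f c) \<le> M"
  proof (rule maximum_modulus_frontier[of f "cball c R"])
    show "f holomorphic_on interior (cball c R)"
      using empty U by (meson holomorphic_on_subset interior_subset order_trans)
    show "continuous_on (closure (cball c R)) f"
      using empty U by (auto intro: holomorphic_on_imp_continuous_on holomorphic_on_subset)
    show "cmod (f z) \<le> M" if "z \<in> frontier (cball c R)" for z
      using that empty(2)[of z] r by (simp add: frontier_cball dist_norm norm_minus_commute sphere_def)
  qed (use r in auto)
  thus ?case by simp
next
  case (insert w W f)
  have w: "cmod (w - c) \<le> r" "f w = 0" using insert.prems by auto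
  hence wU: "w \<in> U" using U r by (auto simp: dist_norm norm_minus_commute subset_iff)
  define q where "q = (\<lambda>z. if z = w then deriv f w else f z / (z - w))"
  have q: "q holomorphic_on U"
    using pole_lemma_open[OF insert.prems(1) U(1), of w] w by (simp add: q_def cong: if_cong)
  have fq: "f z = (z - w) * q z" for z using w by (simp add: q_def)
  \<comment> \<open>the second factor has modulus \<open>\<bar>z - w\<bar>\<close> on the circle, so \<open>g\<close> and \<open>f\<close> have the same modulus there\<close>
  define g where "g = (\<lambda>z. q z * ((of_real R)\<^sup>2 - cnj (w - c) * (z - c)) / of_real R)"
  have R0: "R > 0" using r by simp
  have M: "(R / r) ^ card W * cmod (g c) \<le> M"
  proof (rule insert.IH)
    show "g holomorphic_on U" unfolding g_def using R0 by (intro holomorphic_intros q) auto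
    show "cmod (g z) \<le> M" if z: "cmod (z - c) = R" for z
    proof -
      have "(of_real R)\<^sup>2 = (z - c) * cnj (z - c)" using complex_norm_square[of "z - c"] z by simp
      hence "(of_real R)\<^sup>2 - cnj (w - c) * (z - c) = (z - c) * cnj (z - w)" by (simp add: algebra_simps)
      hence "cmod (g z) = cmod (q z) * (cmod (z - c) * cmod (z - w)) / R"
        using R0 by (simp add: g_def norm_mult norm_divide del: complex_cnj_diff)
      also have "\<dots> = cmod (f z)" using R0 z by (simp add: fq norm_mult)
      also have "\<dots> \<le> M" using insert.prems(2)[OF z] .
      finally show ?thesis .
    qed
    show "cmod (w' - c) \<le> r \<and> g w' = 0" if "w' \<in> W" for w'
      using that insert.prems(3)[of w'] insert.hyps by (auto simp: g_def q_def)
  qed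
  have "R / r * cmod (f c) \<le> cmod (g c)"
  proof -
    have "cmod (g c) = cmod (q c) * R"
      using R0 by (simp add: g_def norm_mult norm_divide power2_eq_square)
    moreover have "cmod (f c) = cmod (w - c) * cmod (q c)" by (simp add: fq norm_mult norm_minus_commute)
    moreover have "cmod (w - c) * cmod (q c) \<le> r * cmod (q c)" using w by (intro mult_right_mono) auto
    ultimately show ?thesis using r by (simp add: field_simps)
  qed
  hence "(R / r) ^ card W * (R / r * cmod (f c)) \<le> (R / r) ^ card W * cmod (g c)"
    using r by (intro mult_left_mono) auto
  also have "\<dots> \<le> M" by (rule M)
  finally show ?case using insert.hyps by (simp add: mult_ac)
qed

text \<open>
  An angle that grows by \<open>(N + 1) \<pi>\<close> passes at least \<open>N\<close> of the odd multiples of \<open>\<pi> / 2\<close>.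
\<close>

lemma cos_zeros_of_increasing_angle:
  fixes \<theta> :: "real \<Rightarrow> real"
  assumes c: "continuous_on {a..b} \<theta>" "a \<le> b" and d: "\<theta> b - \<theta> a \<ge> (real N + 1) * pi"
  shows "\<exists>W. finite W \<and> card W = N \<and> W \<subseteq> {a..b} \<and> (\<forall>x\<in>W. cos (\<theta> x) = 0)"
proof -
  define k0 where "k0 = \<lceil>\<theta> a / pi - 1/2\<rceil>"
  define y where "y = (\<lambda>k::nat. pi * (1/2 + of_int k0 + real k))"
  have k0: "\<theta> a / pi - 1/2 \<le> of_int k0" "of_int k0 < \<theta> a / pi + 1/2"
    unfolding k0_def by linarith+
  have "\<exists>x. x \<in> {a..b} \<and> \<theta> x = y k" if k: "k < N" for k
  proof -
    have "\<theta> a = pi * (\<theta> a / pi)" by simp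
    also have "\<dots> \<le> y k" unfolding y_def using k0 by (intro mult_left_mono) auto
    finally have 1: "\<theta> a \<le> y k" .
    have "y k \<le> pi * (\<theta> a / pi + real N + 1)"
      unfolding y_def using k0 k by (intro mult_left_mono) auto
    also have "\<dots> \<le> \<theta> b" using d by (simp add: algebra_simps)
    finally have 2: "y k \<le> \<theta> b" .
    show ?thesis using IVT'[OF 1 2 c(2,1)] by auto
  qed
  then obtain x where x: "\<And>k. k < N \<Longrightarrow> x k \<in> {a..b} \<and> \<theta> (x k) = y k" by metis
  have inj: "inj_on x {..<N}"
  proof (rule inj_onI)
    fix i j assume "i \<in> {..<N}" "j \<in> {..<N}" "x i = x j"
    hence "y i = y j" using x by (metis lessThan_iff)
    thus "i = j" by (simp add: y_def)
  qed
  have "cos (y k) = 0" for k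
  proof -
    have "y k = of_int (2 * (k0 + int k) + 1) * (pi / 2)" by (simp add: y_def algebra_simps)
    thus ?thesis unfolding cos_zero_iff_int by (intro exI[of _ "2 * (k0 + int k) + 1"]) auto
  qed
  thus ?thesis using x inj by (intro exI[of _ "x ` {..<N}"]) (auto simp: card_image)
qed

lemma cos_zeros_of_angle:
  fixes \<theta> :: "real \<Rightarrow> real"
  assumes c: "continuous_on {a..b} \<theta>" "a \<le> b" and d: "\<bar>\<theta> b - \<theta> a\<bar> \<ge> (real N + 1) * pi"
  shows "\<exists>W. finite W \<and> card W = N \<and> W \<subseteq> {a..b} \<and> (\<forall>x\<in>W. cos (\<theta> x) = 0)"
proof (cases "\<theta> b - \<theta> a \<ge> 0")
  case True
  thus ?thesis using cos_zeros_of_increasing_angle[OF c] d by simp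
next
  case False
  have "continuous_on {a..b} (\<lambda>x. - \<theta> x)" by (intro continuous_intros c)
  from cos_zeros_of_increasing_angle[OF this c(2), of N] False d show ?thesis by simp
qed

lemma norm_zeta_le:
  "\<exists>C>0. \<forall>s. Re s \<ge> 1/4 \<longrightarrow> Im s \<ge> 1 \<longrightarrow> cmod (zeta s) \<le> C * (cmod s + 2) ^ 2"
proof -
  obtain C where C: "C > 0" "\<And>s. Re s \<ge> 1/4 \<Longrightarrow> cmod (Zeta1 s) \<le> C * (cmod s + 2) ^ 2"
    using Zeta1_growth by blast
  show ?thesis
  proof (intro exI[of _ C] conjI allI impI C(1))
    fix s assume s: "Re s \<ge> 1/4" "Im s \<ge> 1"
    have "1 \<le> cmod (s - 1)" using abs_Im_le_cmod[of "s - 1"] s by simp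
    moreover have "s \<noteq> 1" using s by auto
    ultimately have "cmod (zeta s) \<le> cmod (Zeta1 s) / 1"
      unfolding zeta_eq_Zeta1[OF \<open>s \<noteq> 1\<close>] norm_divide by (intro divide_left_mono) auto
    hence "cmod (zeta s) \<le> cmod (Zeta1 s)" by simp
    also have "\<dots> \<le> C * (cmod s + 2) ^ 2" using C s by blast
    finally show "cmod (zeta s) \<le> C * (cmod s + 2) ^ 2" .
  qed
qed

lemma holomorphic_zeta: "1 \<notin> A \<Longrightarrow> zeta holomorphic_on A"
proof -
  assume A: "1 \<notin> A"
  have "(\<lambda>s. Zeta1 s / (s - 1)) holomorphic_on A" using A by (intro holomorphic_intros) auto
  thus ?thesis by (rule holomorphic_transform) (use A zeta_eq_Zeta1 in metis)
qed

text \<open>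
  A bound for \<open>log \<zeta>\<close> on the half plane \<open>Re s \<ge> 2\<close>.
\<close>

definition log_bound_2 :: real where
  "log_bound_2 = (\<Sum>n. real n powr (-2))"

lemma log_bound_2_nonneg: "log_bound_2 \<ge> 0"
  unfolding log_bound_2_def by (intro suminf_nonneg summable_powr) auto

lemma norm_log_dir_le_2: "Re s \<ge> 2 \<Longrightarrow> cmod (log_dir s) \<le> log_bound_2"
  unfolding log_bound_2_def by (rule norm_log_dir_le) auto

text \<open>
  Backlund's device: on a horizontal line, a real part is the restriction of a holomorphic function \<open>h\<close>, the mean of
  \<open>k(z)\<close> and the conjugate of \<open>k\<close> at the conjugate of \<open>z\<close>. The zeros of \<open>h\<close> are counted in discs about \<open>2\<close>: radius
  \<open>3/2\<close> reaches the critical line and radius \<open>7/4\<close> stays in the half plane where \<open>\<zeta>\<close> has polynomial growth; \<open>7/6\<close>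
  is their ratio.
\<close>

lemma re_rotated_zeta_zeros:
  assumes C: "C > 0" "\<And>s. Re s \<ge> 1/4 \<Longrightarrow> Im s \<ge> 1 \<Longrightarrow> cmod (zeta s) \<le> C * (cmod s + 2) ^ 2"
    and v: "v \<ge> 4" and om: "cmod \<omega> = 1"
    and W: "finite W" "\<And>x. x \<in> W \<Longrightarrow> x \<in> {1/2..2} \<and> Re (\<omega> * zeta (Complex x v)) = 0"
  shows "(7/6) ^ card W * \<bar>Re (\<omega> * zeta (Complex 2 v))\<bar> \<le> C * (3 * v) ^ 2"
proof -
  define k where "k = (\<lambda>z. \<omega> * zeta (z + \<i> * of_real v))"
  define h where "h = (\<lambda>z. (k z + cnj (k (cnj z))) / 2)"
  define U where "U = ball (2::complex) 2"
  have im: "\<bar>Im z\<bar> < 2" if "z \<in> U" for z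
    using that abs_Im_le_cmod[of "z - 2"] by (auto simp: U_def dist_norm norm_minus_commute)
  have cU: "cnj z \<in> U" if "z \<in> U" for z
  proof -
    have "cmod (2 - cnj z) = cmod (2 - z)" using complex_mod_cnj[of "2 - z"] by simp
    thus ?thesis using that by (simp add: U_def dist_norm)
  qed
  have k: "k holomorphic_on U"
  proof -
    have "zeta holomorphic_on ((\<lambda>z. z + \<i> * of_real v) ` U)"
    proof (rule holomorphic_zeta, rule notI)
      assume "1 \<in> (\<lambda>z. z + \<i> * of_real v) ` U"
      then obtain z where z: "z \<in> U" "1 = z + \<i> * of_real v" by blast
      have "Im z + v = 0" using arg_cong[OF z(2), of Im] by simp
      thus False using im[OF z(1)] v by simp
    qed
    hence "(zeta \<circ> (\<lambda>z. z + \<i> * of_real v)) holomorphic_on U"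
      by (intro holomorphic_on_compose holomorphic_intros)
    thus ?thesis unfolding k_def o_def by (intro holomorphic_intros)
  qed
  have opU: "open U" by (simp add: U_def)
  have k2: "(\<lambda>z. cnj (k (cnj z))) holomorphic_on U"
  proof -
    have "cnj ` U = U"
    proof (intro equalityI subsetI)
      fix z assume "z \<in> U"
      thus "z \<in> cnj ` U" using cU[of z] by (intro image_eqI[of _ _ "cnj z"]) auto
    qed (use cU in auto)
    hence "(cnj \<circ> k \<circ> cnj) holomorphic_on U"
      using k opU by (intro holomorphic_on_compose_cnj_cnj) auto
    thus ?thesis by (simp add: o_def)
  qed
  have h: "h holomorphic_on U" unfolding h_def by (intro holomorphic_intros k k2) simp
  have hx: "h (of_real x) = of_real (Re (\<omega> * zeta (Complex x v)))" for x
  proof -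
    have e: "of_real x + \<i> * of_real v = Complex x v" by (simp add: complex_eq_iff)
    show ?thesis unfolding h_def k_def complex_cnj_complex_of_real e by (simp add: complex_eq_iff)
  qed
  have kb: "cmod (k z) \<le> C * (3 * v) ^ 2" if z: "cmod (z - 2) = 7/4" for z
  proof -
    define s where "s = z + \<i> * of_real v"
    have "\<bar>Re (z - 2)\<bar> \<le> 7/4" "\<bar>Im (z - 2)\<bar> \<le> 7/4" using abs_Re_le_cmod[of "z-2"] abs_Im_le_cmod[of "z-2"] z by auto
    hence "Re z \<ge> 1/4" "Im z \<ge> - (7/4)" unfolding abs_le_iff by auto
    hence s: "Re s \<ge> 1/4" "Im s \<ge> 1" using v by (auto simp: s_def)
    have "cmod z \<le> 2 + 7/4" using norm_triangle_ineq[of "z - 2" 2] z by simp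
    hence "cmod s \<le> 2 + 7/4 + v" using norm_triangle_ineq[of z "\<i> * of_real v"] v by (simp add: s_def norm_mult)
    hence "cmod s + 2 \<le> 3 * v" using v by simp
    hence "(cmod s + 2) ^ 2 \<le> (3 * v) ^ 2" by (intro power_mono) auto
    hence "C * (cmod s + 2) ^ 2 \<le> C * (3 * v) ^ 2" using C by (intro mult_left_mono) auto
    moreover have "cmod (k z) = cmod (zeta s)" using om by (simp add: k_def s_def norm_mult)
    ultimately show ?thesis using C(2)[OF s] by simp
  qed
  have "((7/4) / (3/2)) ^ card (complex_of_real ` W) * cmod (h 2) \<le> C * (3 * v) ^ 2"
  proof (rule zeros_count_bound[where U = U and c = 2 and R = "7/4" and r = "3/2" and f = h])
    show "cball 2 (7/4) \<subseteq> U" by (auto simp: U_def)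
    fix z assume z: "cmod (z - 2) = 7/4"
    have "cnj z - 2 = cnj (z - 2)" by simp
    hence "cmod (cnj z - 2) = 7/4" using z by (simp only: complex_mod_cnj)
    hence "cmod (k (cnj z)) \<le> C * (3 * v) ^ 2" by (rule kb)
    moreover have "cmod (h z) \<le> (cmod (k z) + cmod (k (cnj z))) / 2"
      using norm_triangle_ineq[of "k z" "cnj (k (cnj z))"] by (simp add: h_def norm_divide)
    ultimately show "cmod (h z) \<le> C * (3 * v) ^ 2" using kb[OF z] by simp
  next
    fix w assume "w \<in> complex_of_real ` W"
    then obtain x where x: "x \<in> W" "w = of_real x" by blast
    have "w - 2 = of_real (x - 2)" by (simp add: x)
    hence "cmod (w - 2) = \<bar>x - 2\<bar>" by (simp only: norm_of_real)
    thus "cmod (w - 2) \<le> 3/2 \<and> h w = 0" using W(2)[OF x(1)] hx[of x] x(2) by auto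
  qed (use h W opU in auto)
  moreover have "cmod (h 2) = \<bar>Re (\<omega> * zeta (Complex 2 v))\<bar>"
    using hx[of 2] by (simp only: of_real_numeral norm_of_real)
  moreover have "card (complex_of_real ` W) = card W" by (intro card_image) (auto simp: inj_on_def)
  ultimately show ?thesis by simp
qed

text \<open>
  Rotate \<open>\<zeta>\<close> so that it is positive at \<open>2 + iv\<close>. If its argument changes by \<open>(N + 1) \<pi>\<close> on the way to \<open>\<sigma> + iv\<close>, its real part
  has \<open>N\<close> zeros there, and their number is \<open>O(log v)\<close> by the zero count for the rotated real part.
\<close>

theorem arg_zeta_bound:
  assumes rh: "riemann_hypothesis"
  shows "\<exists>A>0. \<forall>v\<ge>4. \<forall>\<sigma>>1/2. \<bar>Im (log_zeta (Complex \<sigma> v))\<bar> \<le> A * ln v"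
proof -
  obtain C where C: "C > 0" "\<And>s. Re s \<ge> 1/4 \<Longrightarrow> Im s \<ge> 1 \<Longrightarrow> cmod (zeta s) \<le> C * (cmod s + 2) ^ 2"
    using norm_zeta_le by blast
  define B where "B = log_bound_2"
  have B: "B \<ge> 0" unfolding B_def by (rule log_bound_2_nonneg)
  define D where "D = \<bar>ln (9 * C)\<bar> + 2 + B"
  define A where "A = B + pi * (2 + D / ln (7/6))"
  have l76: "ln (7/6) > (0::real)" by simp
  have D: "D \<ge> 0" using B by (simp add: D_def)
  have A: "A > 0" unfolding A_def using B D l76 by (intro add_nonneg_pos mult_pos_pos add_pos_nonneg) auto
  show ?thesis
  proof (rule exI[of _ A], intro conjI allI impI A)
    fix v \<sigma> :: real assume v: "v \<ge> 4" and \<sigma>: "\<sigma> > 1/2"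
    have "exp 1 \<le> v" using exp_le v by linarith
    hence lnv: "ln v \<ge> 1" using v by (subst ln_ge_iff) auto
    have two: "\<bar>Im (log_zeta (Complex x v))\<bar> \<le> B" if "x \<ge> 2" for x
      using that abs_Im_le_cmod[of "log_zeta (Complex x v)"] norm_log_dir_le_2[of "Complex x v"]
        log_zeta_log_dir[OF rh, of "Complex x v"] by (simp add: B_def)
    have BA: "B \<le> A * ln v"
    proof -
      have "B \<le> A" unfolding A_def using D l76 by simp
      also have "A * 1 \<le> A * ln v" using lnv A by (intro mult_left_mono) auto
      finally show ?thesis by simp
    qed
    show "\<bar>Im (log_zeta (Complex \<sigma> v))\<bar> \<le> A * ln v"
    proof (cases "\<sigma> \<ge> 2")
      case True
      thus ?thesis using two[of \<sigma>] BA by linarith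
    next
      case False
      define \<phi> where "\<phi> = Im (log_zeta (Complex 2 v))"
      define \<theta> where "\<theta> = (\<lambda>x. Im (log_zeta (Complex x v)) - \<phi>)"
      define \<omega> where "\<omega> = cis (- \<phi>)"
      have wz: "\<omega> * zeta (Complex x v) = of_real (exp (Re (log_zeta (Complex x v)))) * cis (\<theta> x)" if "x > 1/2" for x
      proof -
        have "zeta (Complex x v) = exp (log_zeta (Complex x v))"
          using exp_log_zeta[OF rh, of "Complex x v"] that v by (simp add: complex_eq_iff)
        also have "\<dots> = of_real (exp (Re (log_zeta (Complex x v)))) * cis (Im (log_zeta (Complex x v)))"
          by (rule exp_eq_polar)
        also have "\<omega> * \<dots> = of_real (exp (Re (log_zeta (Complex x v)))) * (cis (- \<phi>) * cis (Im (log_zeta (Complex x v))))"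
          by (simp add: \<omega>_def mult_ac)
        also have "cis (- \<phi>) * cis (Im (log_zeta (Complex x v))) = cis (\<theta> x)" by (simp add: cis_mult \<theta>_def)
        finally show ?thesis .
      qed
      have cont: "continuous_on {\<sigma>..2} \<theta>"
      proof -
        have "continuous_on ((\<lambda>x. Complex x v) ` {\<sigma>..2}) log_zeta"
          by (intro holomorphic_on_imp_continuous_on holomorphic_log_zeta'[OF rh]) (use \<sigma> v in auto)
        hence "continuous_on {\<sigma>..2} (\<lambda>x. log_zeta (Complex x v))"
          by (rule continuous_on_compose2) (auto simp: Complex_eq intro!: continuous_intros)
        thus ?thesis unfolding \<theta>_def by (intro continuous_intros)
      qed
      define x where "x = \<bar>\<theta> 2 - \<theta> \<sigma>\<bar> / pi"
      have Nb: "real N \<le> D / ln (7/6) * ln v" if N: "real N + 1 \<le> x" for N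
      proof -
        have "\<bar>\<theta> 2 - \<theta> \<sigma>\<bar> \<ge> (real N + 1) * pi" using N unfolding x_def by (simp add: field_simps)
        then obtain W where W: "finite W" "card W = N" "W \<subseteq> {\<sigma>..2}" "\<And>x. x \<in> W \<Longrightarrow> cos (\<theta> x) = 0"
          using cos_zeros_of_angle[OF cont, of N] False by auto
        have c1: "(7/6) ^ card W * \<bar>Re (\<omega> * zeta (Complex 2 v))\<bar> \<le> C * (3 * v) ^ 2"
        proof (rule re_rotated_zeta_zeros[OF C v _ W(1)])
          show "cmod \<omega> = 1" by (simp add: \<omega>_def)
          fix y assume y: "y \<in> W"
          hence yb: "y \<in> {\<sigma>..2}" using W(3) by blast
          hence "\<omega> * zeta (Complex y v) = of_real (exp (Re (log_zeta (Complex y v)))) * cis (\<theta> y)"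
            using \<sigma> by (intro wz) auto
          hence "Re (\<omega> * zeta (Complex y v)) = 0" using W(4)[OF y] by simp
          thus "y \<in> {1/2..2} \<and> Re (\<omega> * zeta (Complex y v)) = 0" using yb \<sigma> by auto
        qed
        have c2: "Re (\<omega> * zeta (Complex 2 v)) = exp (Re (log_zeta (Complex 2 v)))"
          by (subst wz) (auto simp: \<theta>_def \<phi>_def)
        have c3: "exp (- B) \<le> exp (Re (log_zeta (Complex 2 v)))"
        proof -
          have "\<bar>Re (log_zeta (Complex 2 v))\<bar> \<le> B"
            using abs_Re_le_cmod[of "log_zeta (Complex 2 v)"] norm_log_dir_le_2[of "Complex 2 v"]
              log_zeta_log_dir[OF rh, of "Complex 2 v"] by (simp add: B_def)
          thus ?thesis by simp
        qed
        have "(7/6) ^ N * exp (- B) \<le> (7/6) ^ N * exp (Re (log_zeta (Complex 2 v)))"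
          by (intro mult_left_mono c3) auto
        also have "\<dots> \<le> C * (3 * v) ^ 2" using c1 unfolding c2 W(2) by simp
        finally have "(7/6) ^ N * exp (- B) \<le> C * (3 * v) ^ 2" .
        hence "ln ((7/6) ^ N * exp (- B)) \<le> ln (C * (3 * v) ^ 2)"
          using C v by (subst ln_le_cancel_iff) auto
        also have "C * (3 * v) ^ 2 = (9 * C) * v ^ 2" by (simp add: power_mult_distrib)
        also have "ln ((9 * C) * v ^ 2) = ln (9 * C) + 2 * ln v"
          using C v by (subst ln_mult) (auto simp: ln_realpow)
        also have "ln ((7/6) ^ N * exp (- B)) = real N * ln (7/6) - B"
          by (subst ln_mult) (auto simp: ln_realpow)
        finally have "real N * ln (7/6) \<le> (\<bar>ln (9 * C)\<bar> + B) * 1 + 2 * ln v" by simp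
        also have "\<dots> \<le> (\<bar>ln (9 * C)\<bar> + B) * ln v + 2 * ln v"
          using lnv B by (intro add_mono mult_left_mono) auto
        also have "\<dots> = D * ln v" by (simp add: D_def algebra_simps)
        finally show ?thesis using l76 by (simp add: field_simps)
      qed
      have xb: "x \<le> 2 + D / ln (7/6) * ln v"
      proof (cases "x \<ge> 1")
        case True
        define N where "N = nat (\<lfloor>x\<rfloor> - 1)"
        have "real N + 1 \<le> x" "x \<le> real N + 2" using True unfolding N_def by linarith+
        thus ?thesis using Nb[of N] by linarith
      next
        case False
        have "D / ln (7/6) * ln v \<ge> 0" using D l76 lnv by auto
        thus ?thesis using False by linarith
      qed
      have "\<bar>\<theta> 2 - \<theta> \<sigma>\<bar> = pi * x" by (simp add: x_def)
      also have "\<dots> \<le> pi * (2 * ln v + D / ln (7/6) * ln v)" using xb lnv by (intro mult_left_mono) auto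
      also have "\<dots> = pi * (2 + D / ln (7/6)) * ln v" by (simp add: algebra_simps)
      finally have 1: "\<bar>\<theta> 2 - \<theta> \<sigma>\<bar> \<le> pi * (2 + D / ln (7/6)) * ln v" .
      have "B * 1 \<le> B * ln v" using B lnv by (intro mult_left_mono) auto
      moreover have "\<bar>Im (log_zeta (Complex \<sigma> v))\<bar> \<le> B + \<bar>\<theta> 2 - \<theta> \<sigma>\<bar>"
        using two[of 2] by (simp add: \<theta>_def)
      ultimately have "\<bar>Im (log_zeta (Complex \<sigma> v))\<bar> \<le> B * ln v + pi * (2 + D / ln (7/6)) * ln v" using 1 by linarith
      thus ?thesis by (simp add: A_def algebra_simps)
    qed
  qed
qed

text \<open>
  A function with imaginary part in \<open>[-B, B]\<close> is mapped by \<open>exp (\<cdot> / B)\<close> into the right half plane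
  and by a Cayley transform into the unit disc, where Cauchy's inequality applies.
\<close>

lemma deriv_bound_of_Im_bound:
  assumes f: "f holomorphic_on U" "open U" "cball z r \<subseteq> U" and r: "r > 0" and B: "B > 0"
    and Im: "\<And>w. w \<in> cball z r \<Longrightarrow> \<bar>Im (f w)\<bar> \<le> B"
  shows "cmod (deriv f z) \<le> 2 * B / r"
proof -
  define E where "E = (\<lambda>w. exp (f w / of_real B))"
  have zU: "z \<in> U" using f r by auto
  have ReE: "Re (E w) > 0" if "w \<in> cball z r" for w
  proof -
    have "\<bar>Im (f w) / B\<bar> \<le> 1" using Im[OF that] B by simp
    hence "\<bar>Im (f w) / B\<bar> < pi / 2" using pi_gt3 by linarith
    hence "- (pi / 2) < Im (f w) / B" "Im (f w) / B < pi / 2" unfolding abs_less_iff by linarith+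
    hence "cos (Im (f w) / B) > 0" by (intro cos_gt_zero_pi)
    thus ?thesis by (simp add: E_def Re_exp)
  qed
  \<comment> \<open>the Cayley transform that sends \<open>E z\<close> to \<open>0\<close>\<close>
  define h where "h = (\<lambda>w. (E w - E z) / (E w + cnj (E z)))"
  have Rez: "Re (E z) > 0" using ReE[of z] r by simp
  have nz: "E w + cnj (E z) \<noteq> 0" if "w \<in> cball z r" for w
    using ReE[OF that] Rez by (auto simp: complex_eq_iff)
  have holE: "E holomorphic_on U" unfolding E_def using B by (intro holomorphic_intros f) auto
  have holh: "h holomorphic_on cball z r"
    unfolding h_def by (intro holomorphic_intros holomorphic_on_subset[OF holE] f nz)
  have hb: "cmod (h w) \<le> 1" if "w \<in> cball z r" for w
  proof -
    have "cmod (E w - E z) \<le> cmod (E w + cnj (E z))"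
    proof (rule power2_le_imp_le)
      have "0 \<le> Re (E w) * Re (E z)" using ReE[OF that] Rez by simp
      thus "(cmod (E w - E z))\<^sup>2 \<le> (cmod (E w + cnj (E z)))\<^sup>2"
        unfolding cmod_power2 by (simp add: power2_eq_square algebra_simps)
    qed simp
    thus ?thesis unfolding h_def norm_divide using nz[OF that] by (simp add: divide_le_eq_1)
  qed
  have "cmod ((deriv ^^ 1) h z) \<le> fact 1 * 1 / r ^ 1"
  proof (rule Cauchy_inequality)
    show "h holomorphic_on ball z r" using holh ball_subset_cball holomorphic_on_subset by blast
    show "continuous_on (cball z r) h" using holh by (rule holomorphic_on_imp_continuous_on)
    show "cmod (h x) \<le> 1" if "cmod (z - x) = r" for x using hb[of x] that by (simp add: dist_norm)
  qed fact
  hence hd: "cmod (deriv h z) \<le> 1 / r" by simp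
  have df: "(f has_field_derivative deriv f z) (at z)" by (rule holomorphic_derivI[OF f(1,2) zU])
  have dE: "(E has_field_derivative (deriv f z / of_real B * E z)) (at z)"
    unfolding E_def using B by (auto intro!: derivative_eq_intros df)
  have "E z + cnj (E z) = of_real (2 * Re (E z))" by (simp add: complex_eq_iff)
  hence "(h has_field_derivative (deriv f z / of_real B * E z / of_real (2 * Re (E z)))) (at z)"
    unfolding h_def using Rez by (auto intro!: derivative_eq_intros dE simp: power2_eq_square mult_ac)
  hence "deriv h z = deriv f z / of_real B * E z / of_real (2 * Re (E z))" by (rule DERIV_imp_deriv)
  hence "cmod (deriv f z) / B * cmod (E z) / (2 * Re (E z)) \<le> 1 / r"
    using hd B Rez by (simp add: norm_divide norm_mult)
  moreover have "cmod (deriv f z) / B * Re (E z) / (2 * Re (E z)) \<le> cmod (deriv f z) / B * cmod (E z) / (2 * Re (E z))"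
    using B Rez complex_Re_le_cmod[of "E z"] by (intro divide_right_mono mult_left_mono) auto
  ultimately have "cmod (deriv f z) / B / 2 \<le> 1 / r" using Rez by simp
  thus ?thesis using B r by (simp add: field_simps)
qed

text \<open>
  In a disc of radius comparable to the distance from the critical line, the bound for the argument gives a bound for the
  derivative of \<open>log \<zeta>\<close>, which is integrated from \<open>Re s = 2\<close>. This would give a logarithmic singularity at the critical line;
  the power \<open>-1/2\<close> is a cruder majorant that is still integrable.
\<close>

theorem log_zeta_bound:
  assumes rh: "riemann_hypothesis"
  shows "\<exists>K>0. \<forall>v\<ge>6. \<forall>\<sigma>. 1/2 < \<sigma> \<and> \<sigma> \<le> 2 \<longrightarrow> cmod (log_zeta (Complex \<sigma> v)) \<le> K * ln v * (\<sigma> - 1/2) powr (-1/2)"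
proof -
  obtain A where A: "A > 0" "\<And>v \<sigma>. v \<ge> 4 \<Longrightarrow> \<sigma> > 1/2 \<Longrightarrow> \<bar>Im (log_zeta (Complex \<sigma> v))\<bar> \<le> A * ln v"
    using arg_zeta_bound[OF rh] by blast
  define B where "B = log_bound_2"
  have B: "B \<ge> 0" unfolding B_def by (rule log_bound_2_nonneg)
  define K where "K = 2 * B + 32 * A"
  have K: "K > 0" using A B by (simp add: K_def)
  show ?thesis
  proof (rule exI[of _ K], intro conjI allI impI K)
    fix v \<sigma> :: real assume v: "v \<ge> 6" and \<sigma>: "1/2 < \<sigma> \<and> \<sigma> \<le> 2"
    have "exp 1 \<le> v" using exp_le v by linarith
    hence lnv: "ln v \<ge> 1" using v by (subst ln_ge_iff) auto
    have pos: "(\<sigma> - 1/2) powr (-1/2) \<ge> 1/2"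
    proof -
      have "(1/2::real) = 4 powr (-1/2)" by (simp add: powr_minus_divide powr_half_sqrt real_sqrt_unique)
      also have "\<dots> \<le> (\<sigma> - 1/2) powr (-1/2)" using \<sigma> by (intro powr_mono2') auto
      finally show ?thesis .
    qed
    define lv where "lv = ln v"
    define f where "f = (\<lambda>x. log_zeta (Complex x v))"
    define \<psi> where "\<psi> = (\<lambda>x. - (32 * A * lv) * (x - 1/2) powr (-1/2))"
    have hol: "log_zeta holomorphic_on {s. Re s > 1/2 \<and> Im s > 0}"
      by (rule holomorphic_log_zeta'[OF rh]) auto
    have opn: "open {s. Re s > 1/2 \<and> Im s > 0}"
      by (intro open_Collect_conj open_halfspace_Re_gt open_halfspace_Im_gt)
    have der: "(log_zeta has_field_derivative deriv log_zeta (Complex x v)) (at (Complex x v))" if "x > 1/2" for x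
      by (rule holomorphic_derivI[OF hol opn]) (use that v in auto)
    have f': "(f has_vector_derivative deriv log_zeta (Complex x v)) (at x)" if "x > 1/2" for x
    proof -
      have "((\<lambda>x. Complex x v) has_vector_derivative 1) (at x)"
        unfolding Complex_eq by (auto intro!: derivative_eq_intros)
      from field_vector_diff_chain_at[OF this der[OF that]] show ?thesis by (simp add: f_def o_def)
    qed
    have \<psi>': "(\<psi> has_vector_derivative (16 * A * lv) * (x - 1/2) powr (-3/2)) (at x)" if "x > 1/2" for x
      unfolding \<psi>_def has_real_derivative_iff_has_vector_derivative[symmetric]
      using that by (auto intro!: derivative_eq_intros)
    have db: "cmod (deriv log_zeta (Complex x v)) \<le> (16 * A * lv) * (x - 1/2) powr (-3/2)" if x: "1/2 < x" "x \<le> 2" for x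
    proof -
      define r where "r = (x - 1/2) / 2"
      have r: "r > 0" "r \<le> 1" using x by (auto simp: r_def)
      have cb: "Re w \<ge> x - r \<and> \<bar>Im w - v\<bar> \<le> 1" if "w \<in> cball (Complex x v) r" for w
      proof -
        have "cmod (w - Complex x v) \<le> r" using that by (simp add: dist_norm norm_minus_commute)
        thus ?thesis using abs_Re_le_cmod[of "w - Complex x v"] abs_Im_le_cmod[of "w - Complex x v"] r by auto
      qed
      have xr: "x - r > 1/2" using x unfolding r_def by (simp add: field_simps)
      have "cmod (deriv log_zeta (Complex x v)) \<le> 2 * (2 * A * lv) / r"
      proof (rule deriv_bound_of_Im_bound[OF hol opn])
        show "cball (Complex x v) r \<subseteq> {s. Re s > 1/2 \<and> Im s > 0}"
          using cb xr v by fastforce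
        show "2 * A * lv > 0" using A lnv by (simp add: lv_def)
        fix w assume w: "w \<in> cball (Complex x v) r"
        have "\<bar>Im (log_zeta (Complex (Re w) (Im w)))\<bar> \<le> A * ln (Im w)"
          by (rule A(2)) (use cb[OF w] xr v in auto)
        also have "\<dots> \<le> A * (2 * lv)"
        proof (rule mult_left_mono)
          have "ln (Im w) \<le> ln (v ^ 2)"
          proof (rule ln_mono)
            have "v + 1 \<le> v * v" using v mult_mono[of 6 v 1 v] mult_right_mono[of 6 v v] by linarith
            thus "Im w \<le> v ^ 2" using cb[OF w] unfolding power2_eq_square by linarith
            show "0 < Im w" using cb[OF w] v by auto
          qed
          also have "ln (v ^ 2) = 2 * lv" using v by (simp add: ln_realpow lv_def)
          finally show "ln (Im w) \<le> 2 * lv" .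
        qed (use A in auto)
        finally show "\<bar>Im (log_zeta w)\<bar> \<le> 2 * A * lv" by (simp add: mult_ac)
      qed fact
      also have "\<dots> = (8 * A * lv) * (x - 1/2) powr (-1)" using x by (simp add: r_def powr_minus_divide)
      also have "\<dots> \<le> (8 * A * lv) * (2 * (x - 1/2) powr (-3/2))"
      proof (rule mult_left_mono)
        have "(x - 1/2) powr (-1/2) \<ge> 1/2"
        proof -
          have "(1/2::real) = 4 powr (-1/2)" by (simp add: powr_minus_divide powr_half_sqrt real_sqrt_unique)
          also have "\<dots> \<le> (x - 1/2) powr (-1/2)" using x by (intro powr_mono2') auto
          finally show ?thesis .
        qed
        hence "(x - 1/2) powr (-1) * 1 \<le> (x - 1/2) powr (-1) * (2 * (x - 1/2) powr (-1/2))"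
          by (intro mult_left_mono) auto
        also have "\<dots> = 2 * ((x - 1/2) powr (-1) * (x - 1/2) powr (-1/2))" by (simp only: mult_ac)
        also have "(x - 1/2) powr (-1) * (x - 1/2) powr (-1/2) = (x - 1/2) powr (-3/2)"
          by (subst powr_add[symmetric]) simp
        finally show "(x - 1/2) powr (-1) \<le> 2 * (x - 1/2) powr (-3/2)" by (simp only: mult_1_right)
      qed (use A lnv in \<open>auto simp: lv_def\<close>)
      finally show ?thesis by simp
    qed
    have diff: "cmod (f 2 - f \<sigma>) \<le> \<psi> 2 - \<psi> \<sigma>"
    proof (cases "\<sigma> = 2")
      case False
      show ?thesis
      proof (rule differentiable_bound_general[where f' = "\<lambda>x. deriv log_zeta (Complex x v)" and \<phi>' = "\<lambda>x. (16 * A * lv) * (x - 1/2) powr (-3/2)"])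
        show "\<sigma> < 2" using False \<sigma> by simp
        show "continuous_on {\<sigma>..2} f"
          using \<sigma> by (intro continuous_at_imp_continuous_on ballI has_vector_derivative_continuous[OF f']) auto
        show "continuous_on {\<sigma>..2} \<psi>"
          using \<sigma> by (intro continuous_at_imp_continuous_on ballI has_vector_derivative_continuous[OF \<psi>']) auto
      qed (use f' \<psi>' db \<sigma> in auto)
    qed simp
    have "\<psi> 2 - \<psi> \<sigma> \<le> 32 * A * lv * (\<sigma> - 1/2) powr (-1/2)"
      using A lnv by (simp add: \<psi>_def lv_def)
    moreover have "cmod (f \<sigma>) \<le> cmod (f 2) + cmod (f 2 - f \<sigma>)"
      using norm_triangle_ineq[of "f 2" "f \<sigma> - f 2"] by (simp add: norm_minus_commute)
    moreover have "cmod (f 2) \<le> B"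
      using norm_log_dir_le_2[of "Complex 2 v"] log_zeta_log_dir[OF rh, of "Complex 2 v"] by (simp add: f_def B_def)
    moreover have "B \<le> 2 * B * lv * (\<sigma> - 1/2) powr (-1/2)"
    proof -
      have "B * 1 \<le> B * (2 * (\<sigma> - 1/2) powr (-1/2))" using B pos by (intro mult_left_mono) auto
      also have "\<dots> = B * (2 * (\<sigma> - 1/2) powr (-1/2)) * 1" by simp
      also have "\<dots> \<le> B * (2 * (\<sigma> - 1/2) powr (-1/2)) * lv"
        using B lnv by (intro mult_left_mono mult_nonneg_nonneg) (auto simp: lv_def)
      finally show ?thesis by (simp add: mult_ac)
    qed
    ultimately have "cmod (f \<sigma>) \<le> 2 * B * lv * (\<sigma> - 1/2) powr (-1/2) + 32 * A * lv * (\<sigma> - 1/2) powr (-1/2)"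
      using diff by linarith
    thus "cmod (log_zeta (Complex \<sigma> v)) \<le> K * ln v * (\<sigma> - 1/2) powr (-1/2)"
      by (simp add: K_def f_def lv_def algebra_simps)
  qed
qed

section \<open>Contour integrals over rectangles\<close>

lemma contour_integral_linepath_same_Im:
  assumes "a < b"
  shows "contour_integral (linepath (Complex a c) (Complex b c)) F = integral {a..b} (\<lambda>x. F (Complex x c))"
proof -
  have lp: "linepath (Complex a c) (Complex b c) x = linepath (of_real a) (of_real b) x + \<i> * of_real c" for x
    by (simp add: linepath_def complex_eq_iff algebra_simps)
  have "contour_integral (linepath (Complex a c) (Complex b c)) F =
      contour_integral (linepath (of_real a) (of_real b)) (\<lambda>w. F (w + \<i> * of_real c))"
  proof -
    have "Complex b c - Complex a c = of_real b - of_real a" by (simp add: complex_eq_iff)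
    thus ?thesis unfolding contour_integral_integral vector_derivative_linepath_at by (simp only: lp vector_derivative_linepath_within)
  qed
  also have "\<dots> = integral {a..b} (\<lambda>x. F (of_real x + \<i> * of_real c))"
    using contour_integral_linepath_Reals_eq[of "of_real a" "of_real b" "\<lambda>w. F (w + \<i> * of_real c)"] assms by simp
  also have "(\<lambda>x. of_real x + \<i> * of_real c) = (\<lambda>x. Complex x c)" by (auto simp: complex_eq_iff)
  hence "(\<lambda>x. F (of_real x + \<i> * of_real c)) = (\<lambda>x. F (Complex x c))" by metis
  finally show ?thesis .
qed

lemma rectpath_contour_integral:
  assumes ab: "a < b" "T > (0::real)"
    and F: "continuous_on (path_image (rectpath (Complex a (-T)) (Complex b T))) F"
    and I: "(F has_contour_integral J) (rectpath (Complex a (-T)) (Complex b T))"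
  shows "J = \<i> * integral {-T..T} (\<lambda>u. F (Complex b u)) - \<i> * integral {-T..T} (\<lambda>u. F (Complex a u))
           + integral {a..b} (\<lambda>x. F (Complex x (-T))) - integral {a..b} (\<lambda>x. F (Complex x T))"
proof -
  define z1 where "z1 = Complex a (-T)"
  define z2 where "z2 = Complex b (-T)"
  define z3 where "z3 = Complex b T"
  define z4 where "z4 = Complex a T"
  have rp: "rectpath (Complex a (-T)) (Complex b T) = linepath z1 z2 +++ linepath z2 z3 +++ linepath z3 z4 +++ linepath z4 z1"
    by (simp add: rectpath_def z1_def z2_def z3_def z4_def Let_def)
  have pi: "path_image (rectpath (Complex a (-T)) (Complex b T)) =
     closed_segment z1 z2 \<union> closed_segment z2 z3 \<union> closed_segment z3 z4 \<union> closed_segment z4 z1"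
    unfolding rp by (simp add: path_image_join Un_assoc)
  have c: "continuous_on (closed_segment z1 z2) F" "continuous_on (closed_segment z2 z3) F"
    "continuous_on (closed_segment z3 z4) F" "continuous_on (closed_segment z4 z1) F"
    using F unfolding pi by (auto intro: continuous_on_subset)
  have ci: "F contour_integrable_on linepath z1 z2" "F contour_integrable_on linepath z2 z3"
    "F contour_integrable_on linepath z3 z4" "F contour_integrable_on linepath z4 z1"
    by (intro contour_integrable_continuous_linepath c)+
  have "J = contour_integral (linepath z1 z2) F + (contour_integral (linepath z2 z3) F +
      (contour_integral (linepath z3 z4) F + contour_integral (linepath z4 z1) F))"
    using contour_integral_unique[OF I] ci unfolding rp
    by (simp add: contour_integrable_joinI)
  also have "contour_integral (linepath z3 z4) F = - contour_integral (linepath z4 z3) F"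
    by (rule contour_integral_reverse_linepath[OF c(3)])
  also have "contour_integral (linepath z4 z1) F = - contour_integral (linepath z1 z4) F"
    by (rule contour_integral_reverse_linepath[OF c(4)])
  also have "contour_integral (linepath z1 z2) F = integral {a..b} (\<lambda>x. F (Complex x (-T)))"
    unfolding z1_def z2_def by (rule contour_integral_linepath_same_Im[OF ab(1)])
  also have "contour_integral (linepath z4 z3) F = integral {a..b} (\<lambda>x. F (Complex x T))"
    unfolding z4_def z3_def by (rule contour_integral_linepath_same_Im[OF ab(1)])
  also have "contour_integral (linepath z2 z3) F = \<i> * integral {-T..T} (\<lambda>u. F (Complex b u))"
    by (rule contour_integral_linepath_same_Re) (use ab in \<open>auto simp: z2_def z3_def\<close>)
  also have "contour_integral (linepath z1 z4) F = \<i> * integral {-T..T} (\<lambda>u. F (Complex a u))"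
    by (rule contour_integral_linepath_same_Re) (use ab in \<open>auto simp: z1_def z4_def\<close>)
  finally show ?thesis by simp
qed

lemma rect_image_subset:
  assumes "a < b" "T > (0::real)"
  shows "path_image (rectpath (Complex a (-T)) (Complex b T)) \<subseteq> {w. a \<le> Re w \<and> Re w \<le> b \<and> \<bar>Im w\<bar> \<le> T}"
    and "w \<in> path_image (rectpath (Complex a (-T)) (Complex b T)) \<Longrightarrow> Re w = a \<or> Re w = b \<or> \<bar>Im w\<bar> = T"
  using assms by (auto simp: path_image_rectpath)

lemma rect_cauchy:
  assumes ab: "a < b" "T > (0::real)"
    and F: "F holomorphic_on A" "convex A" "{w. a \<le> Re w \<and> Re w \<le> b \<and> \<bar>Im w\<bar> \<le> T} \<subseteq> A"
  shows "\<i> * integral {-T..T} (\<lambda>u. F (Complex b u)) - \<i> * integral {-T..T} (\<lambda>u. F (Complex a u))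
           = integral {a..b} (\<lambda>x. F (Complex x T)) - integral {a..b} (\<lambda>x. F (Complex x (-T)))"
proof -
  have sub: "path_image (rectpath (Complex a (-T)) (Complex b T)) \<subseteq> A"
    using rect_image_subset(1)[OF ab] F(3) by blast
  have "(F has_contour_integral 0) (rectpath (Complex a (-T)) (Complex b T))"
    by (rule Cauchy_theorem_convex_simple[OF F(1,2) _ sub]) auto
  from rectpath_contour_integral[OF ab _ this] show ?thesis
    using continuous_on_subset[OF holomorphic_on_imp_continuous_on[OF F(1)] sub]
    by (simp add: algebra_simps)
qed

lemma rect_cauchy_pole:
  assumes ab: "a < 0" "0 < b" "T > (0::real)"
    and F: "F holomorphic_on A" "convex A" "open A" "{w. a \<le> Re w \<and> Re w \<le> b \<and> \<bar>Im w\<bar> \<le> T} \<subseteq> A"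
  shows "\<i> * integral {-T..T} (\<lambda>u. F (Complex b u) / Complex b u) - \<i> * integral {-T..T} (\<lambda>u. F (Complex a u) / Complex a u)
           = 2 * pi * \<i> * F 0 + integral {a..b} (\<lambda>x. F (Complex x T) / Complex x T) - integral {a..b} (\<lambda>x. F (Complex x (-T)) / Complex x (-T))"
proof -
  have ab': "a < b" using ab by simp
  have sub: "path_image (rectpath (Complex a (-T)) (Complex b T)) \<subseteq> A - {0}"
    using rect_image_subset[OF ab' ab(3)] F(4) ab by force
  have 0: "0 \<in> box (Complex a (-T)) (Complex b T)" using ab by (auto simp: in_box_complex_iff)
  have "0 \<in> A" using F(4) ab by auto
  hence "((\<lambda>w. F w / (w - 0)) has_contour_integral (2 * pi * \<i> * winding_number (rectpath (Complex a (-T)) (Complex b T)) 0 * F 0))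
      (rectpath (Complex a (-T)) (Complex b T))"
    using F(3) by (intro Cauchy_integral_formula_convex_simple[OF F(2,1) _ _ sub]) (auto simp: interior_open)
  hence I: "((\<lambda>w. F w / w) has_contour_integral (2 * pi * \<i> * F 0)) (rectpath (Complex a (-T)) (Complex b T))"
    using winding_number_rectpath[OF 0] by simp
  have "continuous_on (path_image (rectpath (Complex a (-T)) (Complex b T))) (\<lambda>w. F w / w)"
    using sub by (intro continuous_intros continuous_on_subset[OF holomorphic_on_imp_continuous_on[OF F(1)]]) auto
  from rectpath_contour_integral[OF ab' ab(3) this I] show ?thesis
    by (simp add: algebra_simps)
qed

section \<open>The smoothing kernel\<close>

text \<open>
  Perron's kernel \<open>exp (y w) / w\<close>, which cuts a Dirichlet series off at \<open>n = exp y\<close>, with a factor that makes it decay like a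
  Gaussian on vertical lines.
\<close>

definition ker :: "real \<Rightarrow> complex \<Rightarrow> complex" where
  "ker y w = exp (of_real y * w + w\<^sup>2) / w"

lemma norm_ker: "cmod (ker y (Complex c u)) = exp (y * c + c\<^sup>2 - u\<^sup>2) / cmod (Complex c u)"
  by (simp add: ker_def norm_divide power2_eq_square)

lemma norm_ker_le:
  assumes "0 < d" "d \<le> cmod (Complex c u)"
  shows "cmod (ker y (Complex c u)) \<le> exp (y * c + c\<^sup>2) / d * exp (- (u\<^sup>2))"
proof -
  have "cmod (ker y (Complex c u)) \<le> exp (y * c + c\<^sup>2 - u\<^sup>2) / d"
    unfolding norm_ker using assms by (intro divide_left_mono mult_pos_pos) auto
  also have "\<dots> = exp (y * c + c\<^sup>2) / d * exp (- (u\<^sup>2))" by (simp add: exp_diff exp_minus field_simps)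
  finally show ?thesis .
qed

lemma norm_ker_le_Re:
  assumes "c \<noteq> 0"
  shows "cmod (ker y (Complex c u)) \<le> exp (y * c + c\<^sup>2) / \<bar>c\<bar> * exp (- (u\<^sup>2))"
  by (rule norm_ker_le) (use assms abs_Re_le_cmod[of "Complex c u"] in auto)

lemma has_integral_gauss: "has_bochner_integral lborel (\<lambda>u::real. exp (- (u\<^sup>2))) (sqrt pi)"
  using has_bochner_integral_even_function[OF gaussian_moment_even_pos[where k = 0]] by simp

lemma integrable_gauss: "integrable lborel (\<lambda>u::real. exp (- (u\<^sup>2)))"
  using has_integral_gauss by (rule integrable.intros)

lemma integral_gauss: "(LINT u|lborel. exp (- ((u::real)\<^sup>2))) = sqrt pi"
  using has_integral_gauss by (rule has_bochner_integral_integral_eq)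

lemma continuous_on_Complex_const [continuous_intros]: "continuous_on A (\<lambda>u. Complex c u)"
  by (auto simp: Complex_eq intro!: continuous_intros)

lemma continuous_on_Complex_const' [continuous_intros]: "continuous_on A (\<lambda>x. Complex x c)"
  by (auto simp: Complex_eq intro!: continuous_intros)

lemma continuous_on_ker: "c \<noteq> 0 \<Longrightarrow> continuous_on A (\<lambda>u. ker y (Complex c u))"
  unfolding ker_def by (intro continuous_intros) (auto simp: complex_eq_iff)

lemma integrable_ker:
  assumes "c \<noteq> 0"
  shows "integrable lborel (\<lambda>u. ker y (Complex c u))"
proof (rule Bochner_Integration.integrable_bound)
  show "integrable lborel (\<lambda>u::real. exp (y * c + c\<^sup>2) / \<bar>c\<bar> * exp (- (u\<^sup>2)))"
    by (intro integrable_mult_right integrable_gauss)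
  show "(\<lambda>u. ker y (Complex c u)) \<in> borel_measurable lborel"
    using borel_measurable_continuous_onI[OF continuous_on_ker[OF assms, of UNIV y]] by simp
  show "AE u in lborel. cmod (ker y (Complex c u)) \<le> norm (exp (y * c + c\<^sup>2) / \<bar>c\<bar> * exp (- (u\<^sup>2)))"
    using norm_ker_le_Re[OF assms, of y] by (intro AE_I2) simp
qed

lemma norm_integral_ker:
  assumes "c \<noteq> 0"
  shows "cmod (LINT u|lborel. ker y (Complex c u)) \<le> exp (y * c + c\<^sup>2) / \<bar>c\<bar> * sqrt pi"
proof -
  have "cmod (LINT u|lborel. ker y (Complex c u)) \<le> (LINT u|lborel. exp (y * c + c\<^sup>2) / \<bar>c\<bar> * exp (- (u\<^sup>2)))"
    using norm_ker_le_Re[OF assms, of y]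
    by (intro Bochner_Integration.integral_norm_bound_integral integrable_ker assms integrable_mult_right integrable_gauss) auto
  thus ?thesis by (simp add: integral_gauss)
qed

lemma integral_symmetric_tendsto:
  fixes f :: "real \<Rightarrow> complex"
  assumes f: "integrable lborel f"
  shows "(\<lambda>n. integral {-real n..real n} f) \<longlonglongrightarrow> (LINT u|lborel. f u)"
proof -
  have m[measurable]: "f \<in> borel_measurable lborel" using f by auto
  have "(\<lambda>n. LINT u|lborel. indicator {-real n..real n} u *\<^sub>R f u) \<longlonglongrightarrow> (LINT u|lborel. f u)"
  proof (rule integral_dominated_convergence[where w = "\<lambda>u. norm (f u)"])
    show "AE u in lborel. (\<lambda>n. indicator {-real n..real n} u *\<^sub>R f u) \<longlonglongrightarrow> f u"
    proof (rule AE_I2)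
      fix u :: real
      have "eventually (\<lambda>n. indicator {-real n..real n} u *\<^sub>R f u = f u) sequentially"
        using eventually_ge_at_top[of "nat \<lceil>\<bar>u\<bar>\<rceil>"]
      proof eventually_elim
        case (elim n)
        hence "u \<in> {-real n..real n}" by (auto simp: nat_le_iff ceiling_le_iff abs_le_iff)
        thus ?case by simp
      qed
      thus "(\<lambda>n. indicator {-real n..real n} u *\<^sub>R f u) \<longlonglongrightarrow> f u" by (rule tendsto_eventually)
    qed
    show "AE u in lborel. norm (indicator {-real n..real n} u *\<^sub>R f u) \<le> norm (f u)" for n
      by (intro AE_I2) (auto simp: indicator_def)
  qed (use f in auto)
  moreover have "(LINT u|lborel. indicator {-real n..real n} u *\<^sub>R f u) = integral {-real n..real n} f" for n
    using set_borel_integral_eq_integral(2)[of "{-real n..real n}" f] integrable_mult_indicator[OF _ f, of "{-real n..real n}"]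
    unfolding set_integrable_def set_lebesgue_integral_def by simp
  ultimately show ?thesis by simp
qed

lemma ker_horizontal_tendsto:
  assumes ab: "a < b"
  shows "(\<lambda>n. integral {a..b} (\<lambda>x. ker y (Complex x (real n)))) \<longlonglongrightarrow> 0"
    and "(\<lambda>n. integral {a..b} (\<lambda>x. ker y (Complex x (- real n)))) \<longlonglongrightarrow> 0"
proof -
  define M where "M = \<bar>a\<bar> + \<bar>b\<bar>"
  have bound: "cmod (ker y (Complex x v)) \<le> exp (\<bar>y\<bar> * M + M\<^sup>2) * exp (- (v\<^sup>2))" if x: "x \<in> {a..b}" and v: "\<bar>v\<bar> \<ge> 1" for x v
  proof -
    have xM: "\<bar>x\<bar> \<le> M" using x by (auto simp: M_def)
    have "cmod (ker y (Complex x v)) \<le> exp (y * x + x\<^sup>2) / 1 * exp (- (v\<^sup>2))"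
      by (rule norm_ker_le) (use abs_Im_le_cmod[of "Complex x v"] v in auto)
    also have "y * x + x\<^sup>2 \<le> \<bar>y\<bar> * M + M\<^sup>2"
    proof (rule add_mono)
      have "y * x \<le> \<bar>y\<bar> * \<bar>x\<bar>" by (simp add: abs_mult[symmetric])
      also have "\<dots> \<le> \<bar>y\<bar> * M" using xM by (intro mult_left_mono) auto
      finally show "y * x \<le> \<bar>y\<bar> * M" .
      show "x\<^sup>2 \<le> M\<^sup>2" using xM by (simp add: abs_le_square_iff[symmetric] M_def)
    qed
    hence "exp (y * x + x\<^sup>2) / 1 * exp (- (v\<^sup>2)) \<le> exp (\<bar>y\<bar> * M + M\<^sup>2) * exp (- (v\<^sup>2))" by (intro mult_right_mono) auto
    finally show ?thesis .
  qed
  have c: "continuous_on {a..b} (\<lambda>x. ker y (Complex x v))" if "v \<noteq> 0" for v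
    unfolding ker_def using that by (intro continuous_intros) (auto simp: complex_eq_iff)
  have lim: "(\<lambda>n. exp (\<bar>y\<bar> * M + M\<^sup>2) * exp (- ((real n)\<^sup>2)) * (b - a)) \<longlonglongrightarrow> 0"
  proof -
    have "(\<lambda>n. exp (- ((real n)\<^sup>2))) \<longlonglongrightarrow> 0" by real_asymp
    from tendsto_mult_left[OF tendsto_mult_right[OF this], of "b - a" "exp (\<bar>y\<bar> * M + M\<^sup>2)"] show ?thesis
      by (simp add: mult_ac)
  qed
  show "(\<lambda>n. integral {a..b} (\<lambda>x. ker y (Complex x (real n)))) \<longlonglongrightarrow> 0"
  proof (rule Lim_null_comparison[OF eventually_sequentiallyI[of 1] lim])
    fix n :: nat assume "n \<ge> 1"
    thus "cmod (integral {a..b} (\<lambda>x. ker y (Complex x (real n)))) \<le> exp (\<bar>y\<bar> * M + M\<^sup>2) * exp (- ((real n)\<^sup>2)) * (b - a)"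
      using ab bound[of _ "real n"] by (intro integral_bound c) auto
  qed
  show "(\<lambda>n. integral {a..b} (\<lambda>x. ker y (Complex x (- real n)))) \<longlonglongrightarrow> 0"
  proof (rule Lim_null_comparison[OF eventually_sequentiallyI[of 1] lim])
    fix n :: nat assume "n \<ge> 1"
    thus "cmod (integral {a..b} (\<lambda>x. ker y (Complex x (- real n)))) \<le> exp (\<bar>y\<bar> * M + M\<^sup>2) * exp (- ((real n)\<^sup>2)) * (b - a)"
      using ab bound[of _ "- real n"] by (intro integral_bound c) auto
  qed
qed

lemma ker_shift_right:
  assumes ab: "0 < a" "a < b"
  shows "(LINT u|lborel. ker y (Complex b u)) = (LINT u|lborel. ker y (Complex a u))"
proof -
  have ne: "a \<noteq> 0" "b \<noteq> 0" using ab by auto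
  have hol: "ker y holomorphic_on {w. Re w > 0}"
    unfolding ker_def by (intro holomorphic_intros) auto
  have conv: "convex {w. Re w > (0::real)}" using convex_halfspace_Re_gt[of 0] by simp
  have l1: "(\<lambda>n. \<i> * integral {-real n..real n} (\<lambda>u. ker y (Complex b u)) - \<i> * integral {-real n..real n} (\<lambda>u. ker y (Complex a u)))
      \<longlonglongrightarrow> \<i> * (LINT u|lborel. ker y (Complex b u)) - \<i> * (LINT u|lborel. ker y (Complex a u))"
    by (intro tendsto_intros integral_symmetric_tendsto integrable_ker ne)
  have l2: "(\<lambda>n. integral {a..b} (\<lambda>x. ker y (Complex x (real n))) - integral {a..b} (\<lambda>x. ker y (Complex x (- real n)))) \<longlonglongrightarrow> 0 - 0"
    by (intro tendsto_diff ker_horizontal_tendsto ab)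
  have l3: "eventually (\<lambda>n. integral {a..b} (\<lambda>x. ker y (Complex x (real n))) - integral {a..b} (\<lambda>x. ker y (Complex x (- real n)))
     = \<i> * integral {-real n..real n} (\<lambda>u. ker y (Complex b u)) - \<i> * integral {-real n..real n} (\<lambda>u. ker y (Complex a u))) sequentially"
  proof (rule eventually_sequentiallyI[of 1])
    fix n :: nat assume "n \<ge> 1"
    thus "integral {a..b} (\<lambda>x. ker y (Complex x (real n))) - integral {a..b} (\<lambda>x. ker y (Complex x (- real n)))
     = \<i> * integral {-real n..real n} (\<lambda>u. ker y (Complex b u)) - \<i> * integral {-real n..real n} (\<lambda>u. ker y (Complex a u))"
      by (intro rect_cauchy[OF ab(2) _ hol conv, symmetric]) (use ab in auto)
  qed
  have "\<i> * (LINT u|lborel. ker y (Complex b u)) - \<i> * (LINT u|lborel. ker y (Complex a u)) = 0 - 0"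
    by (rule LIMSEQ_unique[OF l1 Lim_transform_eventually[OF l2 l3]])
  thus ?thesis by (simp flip: right_diff_distrib)
qed

lemma ker_shift_pole:
  assumes ab: "a < 0" "0 < b"
  shows "(LINT u|lborel. ker y (Complex b u)) - (LINT u|lborel. ker y (Complex a u)) = 2 * pi"
proof -
  have ne: "a \<noteq> 0" "b \<noteq> 0" "a < b" using ab by auto
  define F :: "complex \<Rightarrow> complex" where "F = (\<lambda>w. exp (of_real y * w + w\<^sup>2))"
  have kF: "ker y w = F w / w" for w by (simp add: ker_def F_def)
  have F: "F holomorphic_on UNIV" unfolding F_def by (intro holomorphic_intros)
  have l1: "(\<lambda>n. \<i> * integral {-real n..real n} (\<lambda>u. ker y (Complex b u)) - \<i> * integral {-real n..real n} (\<lambda>u. ker y (Complex a u)))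
      \<longlonglongrightarrow> \<i> * (LINT u|lborel. ker y (Complex b u)) - \<i> * (LINT u|lborel. ker y (Complex a u))"
    by (intro tendsto_intros integral_symmetric_tendsto integrable_ker ne)
  have l2: "(\<lambda>n. 2 * pi * \<i> * F 0 + integral {a..b} (\<lambda>x. ker y (Complex x (real n))) - integral {a..b} (\<lambda>x. ker y (Complex x (- real n)))) \<longlonglongrightarrow> 2 * pi * \<i> * F 0 + 0 - 0"
    by (intro tendsto_diff tendsto_add tendsto_const ker_horizontal_tendsto ne)
  have l3: "eventually (\<lambda>n. 2 * pi * \<i> * F 0 + integral {a..b} (\<lambda>x. ker y (Complex x (real n))) - integral {a..b} (\<lambda>x. ker y (Complex x (- real n)))
     = \<i> * integral {-real n..real n} (\<lambda>u. ker y (Complex b u)) - \<i> * integral {-real n..real n} (\<lambda>u. ker y (Complex a u))) sequentially"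
  proof (rule eventually_sequentiallyI[of 1])
    fix n :: nat assume "n \<ge> 1"
    thus "2 * pi * \<i> * F 0 + integral {a..b} (\<lambda>x. ker y (Complex x (real n))) - integral {a..b} (\<lambda>x. ker y (Complex x (- real n)))
     = \<i> * integral {-real n..real n} (\<lambda>u. ker y (Complex b u)) - \<i> * integral {-real n..real n} (\<lambda>u. ker y (Complex a u))"
      unfolding kF by (intro rect_cauchy_pole[OF ab _ F, symmetric]) auto
  qed
  have "\<i> * (LINT u|lborel. ker y (Complex b u)) - \<i> * (LINT u|lborel. ker y (Complex a u)) = 2 * pi * \<i> * F 0 + 0 - 0"
    by (rule LIMSEQ_unique[OF l1 Lim_transform_eventually[OF l2 l3]])
  hence "\<i> * ((LINT u|lborel. ker y (Complex b u)) - (LINT u|lborel. ker y (Complex a u))) = \<i> * (2 * pi)"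
    by (simp add: F_def algebra_simps)
  thus ?thesis by simp
qed

text \<open>
  A smooth substitute for the indicator function of \<open>y > 0\<close>. Its distance from it is \<open>O(exp (- \<bar>y\<bar>))\<close>, as one sees by
  integrating on \<open>Re w = 1\<close> for \<open>y < 0\<close> and on \<open>Re w = -1\<close> for \<open>y > 0\<close>; the residue at \<open>0\<close> between the
  two lines is \<open>1\<close>.
\<close>

definition cutoff :: "real \<Rightarrow> complex" where
  "cutoff y = (LINT u|lborel. ker y (Complex 1 u)) / (2 * pi)"

lemma cutoff_eq: "c > 0 \<Longrightarrow> cutoff y = (LINT u|lborel. ker y (Complex c u)) / (2 * pi)"
  using ker_shift_right[of c 1 y] ker_shift_right[of 1 c y] unfolding cutoff_def
  by (cases c "1::real" rule: linorder_cases) auto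

lemma exp_1_sqrt_pi_le: "exp 1 * sqrt pi / (2 * pi) \<le> 3"
proof -
  have "sqrt pi \<le> pi" using pi_gt3 by (intro real_le_lsqrt) (auto simp: power2_eq_square)
  hence "sqrt pi \<le> 2 * pi" using pi_gt_zero by linarith
  hence "exp 1 * sqrt pi \<le> 3 * (2 * pi)" using exp_le by (intro mult_mono) auto
  thus ?thesis by (simp add: field_simps)
qed

lemma norm_cutoff_le: "cmod (cutoff y) \<le> 3 * exp y"
proof -
  have "cmod (cutoff y) \<le> exp (y * 1 + 1\<^sup>2) / \<bar>1\<bar> * sqrt pi / (2 * pi)"
    unfolding cutoff_def norm_divide using norm_integral_ker[of 1 y] by (intro divide_mono) (auto simp: norm_mult)
  also have "\<dots> = exp y * (exp 1 * sqrt pi / (2 * pi))" by (simp add: exp_add)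
  also have "\<dots> \<le> exp y * 3" by (intro mult_left_mono exp_1_sqrt_pi_le) auto
  finally show ?thesis by simp
qed

lemma norm_cutoff_minus_1_le: "cmod (cutoff y - 1) \<le> 3 * exp (- y)"
proof -
  have "(LINT u|lborel. ker y (Complex 1 u)) = 2 * pi + (LINT u|lborel. ker y (Complex (-1) u))"
    using ker_shift_pole[of "-1" 1 y] by (simp add: algebra_simps)
  hence "cutoff y - 1 = (LINT u|lborel. ker y (Complex (-1) u)) / (2 * pi)"
    by (simp add: cutoff_def add_divide_distrib)
  hence "cmod (cutoff y - 1) = cmod (LINT u|lborel. ker y (Complex (-1) u)) / (2 * pi)"
    by (simp add: norm_divide norm_mult)
  also have "\<dots> \<le> exp (y * (-1) + (-1)\<^sup>2) / \<bar>-1\<bar> * sqrt pi / (2 * pi)"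
    by (intro divide_right_mono norm_integral_ker) auto
  also have "\<dots> = exp (- y) * (exp 1 * sqrt pi / (2 * pi))" by (simp add: exp_diff exp_minus field_simps)
  also have "\<dots> \<le> exp (- y) * 3" by (intro mult_left_mono exp_1_sqrt_pi_le) auto
  finally show ?thesis by simp
qed

lemma log_term_shift:
  "log_term (s + w) n * ker y w = log_term s n * ker (y - ln (real n)) w"
proof (cases "n = 0")
  case False
  have "of_nat n powr (s + w) = of_nat n powr s * exp (w * of_real (ln (real n)))"
    using False by (simp add: powr_def exp_add algebra_simps)
  moreover have "exp (of_real (y - ln (real n)) * w + w\<^sup>2) = exp (of_real y * w + w\<^sup>2) / exp (w * of_real (ln (real n)))"
    by (simp add: exp_diff[symmetric] algebra_simps)
  ultimately show ?thesis by (simp add: log_term_def ker_def)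
qed (simp add: log_term_def)

text \<open>
  The factor \<open>n\<close> to the power \<open>- w\<close> only shifts the parameter of the kernel by \<open>ln n\<close>, so termwise integration
  multiplies the term \<open>n\<close> by a cutoff. Sum and integral commute by absolute convergence on \<open>Re s = 1 + \<eta>\<close>.
\<close>

theorem smoothed_log_dir:
  assumes \<eta>: "\<eta> > 0"
  shows "(\<lambda>n. log_term (Complex 1 t) n * cutoff (y - ln (real n))) sums
           ((LINT u|lborel. log_dir (Complex 1 t + Complex \<eta> u) * ker y (Complex \<eta> u)) / (2 * pi))"
    and "integrable lborel (\<lambda>u. log_dir (Complex 1 t + Complex \<eta> u) * ker y (Complex \<eta> u))"
proof -
  define f where "f = (\<lambda>n u. log_term (Complex 1 t) n * ker (y - ln (real n)) (Complex \<eta> u))"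
  have fi: "integrable lborel (f n)" for n
    unfolding f_def by (intro integrable_mult_right integrable_ker) (use \<eta> in auto)
  define C where "C = exp (y * \<eta> + \<eta>\<^sup>2) / \<eta>"
  have C: "C \<ge> 0" using \<eta> by (simp add: C_def)
  have feq: "f n u = log_term (Complex 1 t + Complex \<eta> u) n * ker y (Complex \<eta> u)" for n u
    unfolding f_def log_term_shift ..
  have fb: "cmod (f n u) \<le> C * real n powr (-(1 + \<eta>)) * exp (- (u\<^sup>2))" for n u
  proof -
    have "cmod (log_term (Complex 1 t + Complex \<eta> u) n) \<le> real n powr (-(1 + \<eta>))"
      using norm_log_term_le[of "Complex 1 t + Complex \<eta> u" n] by simp
    moreover have "cmod (ker y (Complex \<eta> u)) \<le> C * exp (- (u\<^sup>2))"
      using norm_ker_le_Re[of \<eta> y u] \<eta> by (simp add: C_def)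
    ultimately have "cmod (f n u) \<le> real n powr (-(1 + \<eta>)) * (C * exp (- (u\<^sup>2)))"
      unfolding feq norm_mult by (intro mult_mono) auto
    thus ?thesis by (simp add: mult_ac)
  qed
  have sm: "summable (\<lambda>n. real n powr (-(1 + \<eta>)))" by (rule summable_powr) (use \<eta> in auto)
  have s1: "AE u in lborel. summable (\<lambda>n. cmod (f n u))"
  proof (rule AE_I2)
    fix u
    show "summable (\<lambda>n. cmod (f n u))"
      by (rule summable_comparison_test'[OF summable_mult2[OF summable_mult[OF sm], of C "exp (- (u\<^sup>2))"], of 0]) (use fb in auto)
  qed
  have s2: "summable (\<lambda>n. LINT u|lborel. cmod (f n u))"
  proof (rule summable_comparison_test'[of "\<lambda>n. C * sqrt pi * real n powr (-(1 + \<eta>))" 0])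
    show "summable (\<lambda>n. C * sqrt pi * real n powr (-(1 + \<eta>)))" by (intro summable_mult sm)
    fix n
    have "(LINT u|lborel. cmod (f n u)) \<le> (LINT u|lborel. C * real n powr (-(1 + \<eta>)) * exp (- (u\<^sup>2)))"
      using fi fb by (intro integral_mono integrable_norm integrable_mult_right integrable_gauss) auto
    also have "\<dots> = C * sqrt pi * real n powr (-(1 + \<eta>))" by (simp add: integral_gauss)
    finally show "norm (LINT u|lborel. cmod (f n u)) \<le> C * sqrt pi * real n powr (-(1 + \<eta>))"
      by simp
  qed
  have sum: "(\<Sum>n. f n u) = log_dir (Complex 1 t + Complex \<eta> u) * ker y (Complex \<eta> u)" for u
  proof -
    have "(\<lambda>n. log_term (Complex 1 t + Complex \<eta> u) n * ker y (Complex \<eta> u)) sums (log_dir (Complex 1 t + Complex \<eta> u) * ker y (Complex \<eta> u))"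
      by (intro sums_mult2 log_dir_sums) (use \<eta> in auto)
    thus ?thesis unfolding feq by (simp add: sums_iff)
  qed
  have "(\<lambda>n. (LINT u|lborel. f n u) / (2 * pi)) sums ((LINT u|lborel. (\<Sum>n. f n u)) / (2 * pi))"
    by (intro sums_divide sums_integral fi s1 s2)
  moreover have "(LINT u|lborel. f n u) / (2 * pi) = log_term (Complex 1 t) n * cutoff (y - ln (real n))" for n
    unfolding f_def cutoff_eq[OF \<eta>] by simp
  ultimately show "(\<lambda>n. log_term (Complex 1 t) n * cutoff (y - ln (real n))) sums
           ((LINT u|lborel. log_dir (Complex 1 t + Complex \<eta> u) * ker y (Complex \<eta> u)) / (2 * pi))"
    unfolding sum by simp
  have "integrable lborel (\<lambda>u. \<Sum>n. f n u)" by (rule integrable_suminf[OF fi s1 s2])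
  thus "integrable lborel (\<lambda>u. log_dir (Complex 1 t + Complex \<eta> u) * ker y (Complex \<eta> u))" unfolding sum .
qed

section \<open>Cutting off the far part of the vertical line\<close>

text \<open>
  An integrable majorant for the logarithmic singularity that \<open>log \<zeta>\<close> has at its pole, as a function of the ordinate \<open>v\<close>.
\<close>

definition root_singularity :: "real \<Rightarrow> real" where
  "root_singularity v = indicator {-6..6} v * \<bar>v\<bar> powr (-1/2)"

lemma root_singularity_nonneg: "root_singularity v \<ge> 0"
  by (simp add: root_singularity_def)

lemma integrable_root_singularity: "integrable lborel root_singularity"
proof -
  define g where "g = (\<lambda>v::real. indicator {0..6} v * v powr (-1/2))"
  have m: "g \<in> borel_measurable borel" unfolding g_def by measurable
  have "(\<lambda>x::real. x powr (-1/2)) absolutely_integrable_on {0..6}"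
    by (intro nonnegative_absolutely_integrable_1 integrable_on_powr_from_0) auto
  hence "integrable lebesgue g" unfolding set_integrable_def g_def by simp
  hence g: "integrable lborel g" using m by (subst (asm) integrable_completion) auto
  have "integrable lborel (\<lambda>v. g v + g (0 + (-1) * v))"
    by (intro Bochner_Integration.integrable_add g lborel_integrable_real_affine) auto
  thus ?thesis
  proof (rule Bochner_Integration.integrable_bound)
    show "root_singularity \<in> borel_measurable lborel" unfolding root_singularity_def by measurable
    show "AE v in lborel. norm (root_singularity v) \<le> norm (g v + g (0 + (-1) * v))"
      by (intro AE_I2) (auto simp: root_singularity_def g_def indicator_def)
  qed
qed

lemma abs_ln_le:
  fixes r :: real
  assumes "r > 0"
  shows "\<bar>ln r\<bar> \<le> r + 2 * r powr (-1/2)"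
proof -
  have "ln r \<le> r" using ln_le_minus_one[OF assms] by simp
  moreover have "ln (r powr (-1/2)) \<le> r powr (-1/2)" using ln_le_minus_one[of "r powr (-1/2)"] assms by simp
  hence "- ln r \<le> 2 * r powr (-1/2)" using assms by (simp add: ln_powr)
  moreover have "r powr (-1/2) \<ge> 0" by simp
  ultimately show ?thesis using assms by linarith
qed

text \<open>
  The bound has to be uniform in \<open>\<eta>\<close>, as the line of integration will approach \<open>Re s = 1\<close>. Away from the real axis this is the
  bound under the Riemann hypothesis. Near it, \<open>log_Zeta1\<close> is bounded on a compact
  rectangle and only \<open>Ln (s - 1)\<close> becomes large.
\<close>

lemma log_dir_bound:
  assumes rh: "riemann_hypothesis"
  shows "\<exists>K>0. \<forall>\<eta> v. 0 < \<eta> \<and> \<eta> \<le> 1 \<and> v \<noteq> 0 \<longrightarrow>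
      cmod (log_dir (Complex (1 + \<eta>) v)) \<le> K * (1 + \<bar>v\<bar>) + 2 * root_singularity v"
proof -
  obtain K where K: "K > 0" "\<And>v \<sigma>. v \<ge> 6 \<Longrightarrow> 1/2 < \<sigma> \<Longrightarrow> \<sigma> \<le> 2 \<Longrightarrow>
      cmod (log_zeta (Complex \<sigma> v)) \<le> K * ln v * (\<sigma> - 1/2) powr (-1/2)"
    using log_zeta_bound[OF rh] by blast
  define Q where "Q = cbox (Complex 1 (-6)) (Complex 2 6)"
  have "continuous_on Q log_Zeta1"
    by (rule holomorphic_on_imp_continuous_on[OF holomorphic_on_subset[OF holomorphic_log_Zeta1[OF rh]]])
       (auto simp: Q_def in_cbox_complex_iff)
  hence "compact (log_Zeta1 ` Q)" by (intro compact_continuous_image) (auto simp: Q_def)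
  then obtain B where B: "\<And>s. s \<in> Q \<Longrightarrow> cmod (log_Zeta1 s) \<le> B"
    by (meson bounded_iff compact_imp_bounded imageI)
  have "1 \<in> Q" by (auto simp: Q_def in_cbox_complex_iff)
  hence B0: "B \<ge> 0" using order_trans[OF norm_ge_zero B] by blast
  define K' where "K' = 2 * K + B + 1 + pi"
  have pos: "cmod (log_dir (Complex (1 + \<eta>) v)) \<le> K' * (1 + \<bar>v\<bar>) + 2 * root_singularity v"
    if \<eta>: "0 < \<eta>" "\<eta> \<le> 1" and v: "v > 0" for \<eta> v
  proof (cases "v \<le> 6")
    case False
    have "cmod (log_dir (Complex (1 + \<eta>) v)) = cmod (log_zeta (Complex (1 + \<eta>) v))"
      using log_zeta_log_dir[OF rh, of "Complex (1 + \<eta>) v"] \<eta> by simp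
    also have "\<dots> \<le> K * ln v * ((1 + \<eta>) - 1/2) powr (-1/2)" by (intro K(2)) (use False \<eta> in auto)
    also have "\<dots> \<le> K * v * 2"
    proof (intro mult_mono)
      have "((1 + \<eta>) - 1/2) powr (-1/2) \<le> (1/4) powr (-1/2)" using \<eta> by (intro powr_mono2') auto
      also have "(1/4) powr (-1/2) = (2::real)" by (simp add: powr_minus_divide powr_half_sqrt real_sqrt_divide)
      finally show "((1 + \<eta>) - 1/2) powr (-1/2) \<le> 2" .
      show "ln v \<le> v" using ln_le_minus_one[OF v] by simp
    qed (use K v False in auto)
    also have "\<dots> \<le> K' * (1 + \<bar>v\<bar>)"
    proof -
      have "2 * K * v \<le> K' * (1 + v)" using B0 K v pi_gt_zero unfolding K'_def by (intro mult_mono) auto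
      thus ?thesis using v by simp
    qed
    finally show ?thesis using root_singularity_nonneg[of v] by linarith
  next
    case True
    define s where "s = Complex (1 + \<eta>) v"
    have s: "s \<in> Q" "Re s > 1" "s \<noteq> 1" using True v \<eta> by (auto simp: s_def Q_def in_cbox_complex_iff complex_eq_iff)
    define r where "r = cmod (s - 1)"
    have r: "v \<le> r" "r \<le> 1 + v"
    proof -
      have "s - 1 = Complex \<eta> v" by (simp add: s_def complex_eq_iff)
      thus "v \<le> r" "r \<le> 1 + v" using abs_Im_le_cmod[of "Complex \<eta> v"] cmod_le[of "Complex \<eta> v"] v \<eta> by (auto simp: r_def)
    qed
    have "cmod (log_dir s) = cmod (log_Zeta1 s - Ln (s - 1))"
      using log_Zeta1_log_dir[OF rh s(2)] by simp
    also have "\<dots> \<le> cmod (log_Zeta1 s) + cmod (Ln (s - 1))" by (rule norm_triangle_ineq4)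
    also have "cmod (Ln (s - 1)) \<le> \<bar>Re (Ln (s - 1))\<bar> + \<bar>Im (Ln (s - 1))\<bar>" by (rule cmod_le)
    also have "\<bar>Im (Ln (s - 1))\<bar> \<le> pi" using mpi_less_Im_Ln[of "s - 1"] Im_Ln_le_pi[of "s - 1"] s by auto
    also have "Re (Ln (s - 1)) = ln r" using s by (simp add: r_def)
    also have "\<bar>ln r\<bar> \<le> r + 2 * r powr (-1/2)" by (rule abs_ln_le) (use r v in auto)
    also have "r powr (-1/2) \<le> v powr (-1/2)" using r v by (intro powr_mono2') auto
    also have "v powr (-1/2) = root_singularity v" using v True by (simp add: root_singularity_def)
    finally have "cmod (log_dir s) \<le> B + (1 + v) + 2 * root_singularity v + pi" using B[OF s(1)] r by simp
    also have "B + (1 + v) + 2 * root_singularity v + pi \<le> K' * (1 + v) + 2 * root_singularity v"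
      using K B0 v pi_gt_zero unfolding K'_def by (simp add: algebra_simps)
    finally show ?thesis using v by (simp add: s_def)
  qed
  have "cmod (log_dir (Complex (1 + \<eta>) v)) \<le> K' * (1 + \<bar>v\<bar>) + 2 * root_singularity v"
    if \<eta>: "0 < \<eta>" "\<eta> \<le> 1" and v: "v \<noteq> 0" for \<eta> v
  proof (cases "v > 0")
    case False
    have "cnj (Complex (1 + \<eta>) v) = Complex (1 + \<eta>) (-v)" by (simp add: complex_eq_iff)
    hence "log_dir (Complex (1 + \<eta>) (-v)) = cnj (log_dir (Complex (1 + \<eta>) v))"
      using cnj_log_dir[of "Complex (1 + \<eta>) v"] \<eta> by simp
    hence "cmod (log_dir (Complex (1 + \<eta>) (-v))) = cmod (log_dir (Complex (1 + \<eta>) v))" by simp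
    moreover have "root_singularity (-v) = root_singularity v" by (auto simp: root_singularity_def indicator_def)
    ultimately show ?thesis using pos[OF \<eta>, of "-v"] False v by simp
  qed (use pos[OF \<eta>] in blast)
  moreover have "K' > 0" unfolding K'_def using K(1) B0 pi_gt_zero by linarith
  ultimately show ?thesis by blast
qed

text \<open>
  What is left of the Gaussian after a part of its decay has been used for the range \<open>\<bar>u\<bar> > t / 2\<close> or outside the window.
\<close>

definition wide_gauss :: real where
  "wide_gauss = (LINT u|lborel. exp (- ((u::real)\<^sup>2 / 4)))"

lemma integrable_wide_gauss: "integrable lborel (\<lambda>u::real. exp (- (u\<^sup>2 / 4)))"
  using lborel_integrable_real_affine[OF integrable_gauss, of "1/2" 0] by (simp add: power2_eq_square)

lemma wide_gauss_nonneg: "wide_gauss \<ge> 0"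
  unfolding wide_gauss_def by (intro integral_nonneg_AE) auto

text \<open>
  For \<open>\<bar>u\<bar> > t / 2\<close> the Gaussian factor is at most \<open>exp (- t\<^sup>2 / 8) exp (- u\<^sup>2 / 4)\<close> even after it has absorbed the linear
  growth of \<open>log_dir\<close>. The line passes the pole at \<open>u = - t\<close>, where the singularity is integrable.
\<close>

lemma far_part_bound:
  assumes rh: "riemann_hypothesis"
  shows "\<exists>E. (E \<longlongrightarrow> 0) at_top \<and> (\<forall>t\<ge>2. \<forall>\<eta> y. 0 < \<eta> \<and> \<eta> \<le> 1 \<and> 0 \<le> y \<and> y * \<eta> \<le> 1 \<longrightarrow>
    cmod ((LINT u|lborel. log_dir (Complex 1 t + Complex \<eta> u) * ker y (Complex \<eta> u)) -
          integral {-(t/2)..t/2} (\<lambda>u. log_dir (Complex 1 t + Complex \<eta> u) * ker y (Complex \<eta> u))) \<le> E t)"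
proof -
  obtain K where K: "K > 0" "\<And>\<eta> v. 0 < \<eta> \<Longrightarrow> \<eta> \<le> 1 \<Longrightarrow> v \<noteq> 0 \<Longrightarrow>
      cmod (log_dir (Complex (1 + \<eta>) v)) \<le> K * (1 + \<bar>v\<bar>) + 2 * root_singularity v"
    using log_dir_bound[OF rh] by blast
  define R where "R = (LINT v|lborel. root_singularity v)"
  define E where "E = (\<lambda>t. exp 2 * exp (- (t\<^sup>2 / 8)) * (K * (2 + t) * wide_gauss + 2 * R))"
  show ?thesis
  proof (rule exI[of _ E], intro conjI allI impI)
    have l1: "((\<lambda>t::real. exp (- (t\<^sup>2 / 8))) \<longlongrightarrow> 0) at_top" by real_asymp
    have l2: "((\<lambda>t::real. exp (- (t\<^sup>2 / 8)) * (2 + t)) \<longlongrightarrow> 0) at_top" by real_asymp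
    have "((\<lambda>t. exp 2 * (K * wide_gauss * (exp (- (t\<^sup>2 / 8)) * (2 + t)) + 2 * R * exp (- (t\<^sup>2 / 8)))) \<longlongrightarrow> exp 2 * (K * wide_gauss * 0 + 2 * R * 0)) at_top"
      by (intro tendsto_intros l1 l2)
    thus "(E \<longlongrightarrow> 0) at_top" by (simp add: E_def algebra_simps)
    fix t \<eta> y :: real assume t: "t \<ge> 2" and *: "0 < \<eta> \<and> \<eta> \<le> 1 \<and> 0 \<le> y \<and> y * \<eta> \<le> 1"
    define f where "f = (\<lambda>u. log_dir (Complex 1 t + Complex \<eta> u) * ker y (Complex \<eta> u))"
    define T where "T = t / 2"
    define I where "I = {-T..T}"
    define h where "h = (\<lambda>u. exp 2 * exp (- (t\<^sup>2 / 8)) * (K * (2 + t) * exp (- (u\<^sup>2 / 4)) + 2 * root_singularity (t + 1 * u)))"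
    have f: "integrable lborel f" unfolding f_def by (rule smoothed_log_dir(2)) (use * in auto)
    have fI: "integrable lborel (\<lambda>u. indicator I u *\<^sub>R f u)" unfolding I_def by (intro integrable_mult_indicator f) auto
    have "(LINT u|lborel. indicator I u *\<^sub>R f u) = integral I f"
      using set_borel_integral_eq_integral(2)[of I f] fI unfolding set_integrable_def set_lebesgue_integral_def by simp
    hence "cmod ((LINT u|lborel. f u) - integral I f) = cmod (LINT u|lborel. f u - indicator I u *\<^sub>R f u)"
      using f fI by simp
    also have "\<dots> \<le> (LINT u|lborel. cmod (f u - indicator I u *\<^sub>R f u))" by (rule integral_norm_bound)
    also have "\<dots> \<le> (LINT u|lborel. h u)"
    proof (rule integral_mono_AE)
      show "integrable lborel (\<lambda>u. cmod (f u - indicator I u *\<^sub>R f u))" using f fI by auto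
      show "integrable lborel h" unfolding h_def
        by (intro integrable_mult_right Bochner_Integration.integrable_add integrable_wide_gauss
              lborel_integrable_real_affine integrable_root_singularity) auto
      show "AE u in lborel. cmod (f u - indicator I u *\<^sub>R f u) \<le> h u"
        using AE_lborel_singleton[of "-t"]
      proof eventually_elim
        case (elim u)
        show ?case
        proof (cases "u \<in> I")
          case True
          thus ?thesis using K t root_singularity_nonneg by (simp add: h_def)
        next
          case False
          hence u: "\<bar>u\<bar> > T" by (auto simp: I_def)
          have uT: "T\<^sup>2 \<le> u\<^sup>2" using u t by (simp add: T_def abs_le_square_iff[symmetric])
          have b1: "cmod (log_dir (Complex 1 t + Complex \<eta> u)) \<le> K * (1 + \<bar>t + u\<bar>) + 2 * root_singularity (t + u)"
            using K(2)[of \<eta> "t + u"] * elim by (simp add: complex_add)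
          have "\<bar>u\<bar> \<le> exp (u\<^sup>2 / 4)"
          proof -
            have "0 \<le> (\<bar>u\<bar> / 2 - 1)\<^sup>2" by simp
            hence "\<bar>u\<bar> \<le> 1 + u\<^sup>2 / 4" by (simp add: power2_eq_square algebra_simps)
            also have "\<dots> \<le> exp (u\<^sup>2 / 4)" by (rule exp_ge_add_one_self)
            finally show ?thesis .
          qed
          hence "1 + \<bar>t + u\<bar> \<le> (1 + t) * 1 + 1 * exp (u\<^sup>2 / 4)" using abs_triangle_ineq[of t u] t by simp
          also have "\<dots> \<le> (1 + t) * exp (u\<^sup>2 / 4) + 1 * exp (u\<^sup>2 / 4)" using t by (intro add_mono mult_left_mono) auto
          finally have "1 + \<bar>t + u\<bar> \<le> (2 + t) * exp (u\<^sup>2 / 4)" by (simp add: algebra_simps)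
          hence "K * (1 + \<bar>t + u\<bar>) \<le> K * ((2 + t) * exp (u\<^sup>2 / 4))" using K by (intro mult_left_mono) auto
          with b1 have b1': "cmod (log_dir (Complex 1 t + Complex \<eta> u)) \<le> K * ((2 + t) * exp (u\<^sup>2 / 4)) + 2 * root_singularity (t + u)" by simp
          have b2: "cmod (ker y (Complex \<eta> u)) \<le> exp 2 * exp (- (u\<^sup>2))"
          proof -
            have "cmod (ker y (Complex \<eta> u)) \<le> exp (y * \<eta> + \<eta>\<^sup>2) / 1 * exp (- (u\<^sup>2))"
              by (rule norm_ker_le) (use abs_Im_le_cmod[of "Complex \<eta> u"] u t in \<open>auto simp: T_def\<close>)
            also have "\<eta>\<^sup>2 \<le> 1" using * by (simp add: power_le_one)
            hence "exp (y * \<eta> + \<eta>\<^sup>2) / 1 * exp (- (u\<^sup>2)) \<le> exp 2 * exp (- (u\<^sup>2))" using * by (intro mult_right_mono) auto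
            finally show ?thesis .
          qed
          have "cmod (f u) \<le> (K * ((2 + t) * exp (u\<^sup>2 / 4)) + 2 * root_singularity (t + u)) * (exp 2 * exp (- (u\<^sup>2)))"
            unfolding f_def norm_mult using K t root_singularity_nonneg[of "t + u"] by (intro mult_mono b1' b2) auto
          also have "\<dots> = exp 2 * (K * (2 + t) * (exp (u\<^sup>2 / 4) * exp (- (u\<^sup>2))) + 2 * root_singularity (t + u) * exp (- (u\<^sup>2)))"
            by (simp add: algebra_simps)
          also have "\<dots> \<le> exp 2 * (K * (2 + t) * (exp (- (t\<^sup>2 / 8)) * exp (- (u\<^sup>2 / 4))) + 2 * root_singularity (t + u) * exp (- (t\<^sup>2 / 8)))"
          proof (intro mult_left_mono add_mono)
            have q: "t\<^sup>2 / 4 \<le> u\<^sup>2" using uT by (simp add: T_def power2_eq_square)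
            have q8: "t\<^sup>2 / 8 \<le> u\<^sup>2" using q zero_le_power2[of t] by linarith
            show "exp (u\<^sup>2 / 4) * exp (- (u\<^sup>2)) \<le> exp (- (t\<^sup>2 / 8)) * exp (- (u\<^sup>2 / 4))"
              unfolding exp_add[symmetric] exp_le_cancel_iff using q by linarith
            show "exp (- (u\<^sup>2)) \<le> exp (- (t\<^sup>2 / 8))"
              unfolding exp_le_cancel_iff using q8 by linarith
          qed (use K t root_singularity_nonneg[of "t + u"] in auto)
          also have "\<dots> = h u" by (simp add: h_def algebra_simps)
          finally show ?thesis using False by simp
        qed
      qed
    qed
    also have "\<dots> = E t"
    proof -
      have "(LINT u|lborel. root_singularity (t + 1 * u)) = R"
        using lborel_integral_real_affine[of 1 root_singularity t] by (simp add: R_def)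
      moreover have "integrable lborel (\<lambda>u. root_singularity (t + 1 * u))"
        by (intro lborel_integrable_real_affine integrable_root_singularity) auto
      ultimately show ?thesis
        using integrable_wide_gauss by (simp add: h_def E_def wide_gauss_def)
    qed
    finally show "cmod ((LINT u|lborel. log_dir (Complex 1 t + Complex \<eta> u) * ker y (Complex \<eta> u)) -
          integral {-(t/2)..t/2} (\<lambda>u. log_dir (Complex 1 t + Complex \<eta> u) * ker y (Complex \<eta> u))) \<le> E t"
      unfolding f_def I_def T_def .
  qed
qed

section \<open>Moving the contour\<close>

text \<open>
  For the horizontal edges of the rectangles. In coordinates centred at \<open>1 + it\<close> the critical line is \<open>Re w = -1/2\<close>.
\<close>

lemma integral_le_root_singularity:
  fixes f :: "real \<Rightarrow> complex"
  assumes f: "continuous_on {p..q} f" and pq: "-1/2 < p" "p \<le> q" "q \<le> 1"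
    and b: "\<And>x. x \<in> {p..q} \<Longrightarrow> cmod (f x) \<le> B * (x + 1/2) powr (-1/2)" and B: "B \<ge> 0"
  shows "cmod (integral {p..q} f) \<le> 4 * B"
proof -
  define G where "G = (\<lambda>x::real. 2 * B * (x + 1/2) powr (1/2))"
  have gi: "((\<lambda>x. B * (x + 1/2) powr (-1/2)) has_integral (G q - G p)) {p..q}"
  proof (rule fundamental_theorem_of_calculus[OF pq(2)])
    fix x assume x: "x \<in> {p..q}"
    have "(G has_field_derivative B * (x + 1/2) powr (-1/2)) (at x)"
      unfolding G_def using x pq by (auto intro!: derivative_eq_intros)
    thus "(G has_vector_derivative B * (x + 1/2) powr (-1/2)) (at x within {p..q})"
      by (simp add: has_real_derivative_iff_has_vector_derivative has_vector_derivative_at_within)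
  qed
  have "cmod (integral {p..q} f) \<le> integral {p..q} (\<lambda>x. B * (x + 1/2) powr (-1/2))"
    by (rule Henstock_Kurzweil_Integration.integral_norm_bound_integral[OF integrable_continuous_interval[OF f] has_integral_integrable[OF gi] b])
  also have "\<dots> = G q - G p" using gi by (rule integral_unique)
  also have "\<dots> \<le> G q" using B by (simp add: G_def)
  also have "\<dots> \<le> 2 * B * 2"
  proof -
    have "(q + 1/2) powr (1/2) \<le> 4 powr (1/2)" using pq by (intro powr_mono2) auto
    also have "4 powr (1/2) = (2::real)" by (simp add: powr_half_sqrt real_sqrt_unique)
    finally show ?thesis unfolding G_def using B by (intro mult_left_mono) auto
  qed
  finally show ?thesis by simp
qed

lemma norm_ker_horizontal:
  assumes T: "T \<ge> 1" "\<bar>v\<bar> = T" and x: "x\<^sup>2 \<le> 3" "y * x \<le> 1"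
  shows "cmod (ker y (Complex x v)) \<le> exp 4 * exp (- (T\<^sup>2))"
proof -
  have "cmod (ker y (Complex x v)) \<le> exp (y * x + x\<^sup>2) / 1 * exp (- (v\<^sup>2))"
    by (rule norm_ker_le) (use abs_Im_le_cmod[of "Complex x v"] T in auto)
  also have "\<dots> \<le> exp 4 * exp (- (T\<^sup>2))"
    using x T(2) by (intro mult_mono) (auto simp: power2_eq_square abs_if split: if_splits)
  finally show ?thesis .
qed

lemma integral_gauss_Icc_le: "integral {-T..T} (\<lambda>u::real. exp (- (u\<^sup>2))) \<le> sqrt pi"
proof -
  have "((\<lambda>u::real. exp (- (u\<^sup>2))) has_integral sqrt pi) UNIV"
    using has_integral_integral_lborel[OF integrable_gauss] by (simp add: integral_gauss)
  thus ?thesis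
    by (intro integral_subset_le[of "{-T..T}" UNIV, THEN order_trans])
       (auto simp: has_integral_iff intro!: integrable_continuous_interval continuous_intros)
qed

text \<open>
  Write \<open>f(w) = log \<zeta>(1 + it + w)\<close>, with left edge at \<open>Re w = a\<close> for \<open>a = \<delta> - 1/2\<close>. The first rectangle has the pole of the
  kernel inside, with residue \<open>f(0)\<close>. On the left edge the conjugate of \<open>f\<close> coincides with
  \<open>g(w) = cnj (f (2a - cnj w))\<close>, the reflection in the edge, which is holomorphic to the left of it because \<open>f\<close> is
  holomorphic to the right. Cauchy's theorem in the second rectangle moves the integral of \<open>g\<close> from \<open>Re w = a\<close>
  to \<open>Re w = a - 1\<close>. There \<open>g\<close> takes values of \<open>\<zeta>\<close> on the line \<open>Re s = 3/2 + \<delta>\<close> and the kernel is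
  \<open>O(exp (- y))\<close>. Thus replacing \<open>f\<close> by \<open>f - cnj f\<close> on the left edge costs little, and only the argument of \<open>\<zeta>\<close> remains.
\<close>

theorem contour_estimate:
  assumes rh: "riemann_hypothesis"
  shows "\<exists>C>0. \<forall>t\<ge>12. \<forall>\<delta> \<eta> y. 0 < \<delta> \<and> \<delta> \<le> 1/4 \<and> 0 < \<eta> \<and> \<eta> \<le> 1 \<and> 0 \<le> y \<and> y * \<eta> \<le> 1 \<longrightarrow>
    cmod (integral {-(t/2)..t/2} (\<lambda>u. log_dir (Complex 1 t + Complex \<eta> u) * ker y (Complex \<eta> u)) - 2 * pi * log_zeta (Complex 1 t))
     \<le> C * (exp (y * (\<delta> - 1/2)) * integral {-(t/2)..t/2} (\<lambda>u. \<bar>Im (log_zeta (Complex (1/2 + \<delta>) (t + u)))\<bar> * exp (- (u\<^sup>2)))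
          + exp (- y) + ln (2 * t) * exp (- (t\<^sup>2 / 4)))"
proof -
  obtain K where K: "K > 0" "\<And>v \<sigma>. v \<ge> 6 \<Longrightarrow> 1/2 < \<sigma> \<Longrightarrow> \<sigma> \<le> 2 \<Longrightarrow>
      cmod (log_zeta (Complex \<sigma> v)) \<le> K * ln v * (\<sigma> - 1/2) powr (-1/2)"
    using log_zeta_bound[OF rh] by blast
  define N where "N = (\<Sum>n. real n powr (-(3/2)))"
  have N: "N \<ge> 0" unfolding N_def by (intro suminf_nonneg summable_powr) auto
  \<comment> \<open>left edge, far left edge, and four horizontal edges\<close>
  define C where "C = 8 * exp 1 + N * exp 3 * sqrt pi + 16 * K * exp 4"
  have C: "C > 0" unfolding C_def using N K by (intro add_nonneg_pos add_nonneg_nonneg mult_nonneg_nonneg) auto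
  show ?thesis
  proof (rule exI[of _ C], intro conjI allI impI C)
    fix t \<delta> \<eta> y :: real
    assume t: "t \<ge> 12" and *: "0 < \<delta> \<and> \<delta> \<le> 1/4 \<and> 0 < \<eta> \<and> \<eta> \<le> 1 \<and> 0 \<le> y \<and> y * \<eta> \<le> 1"
    define a where "a = \<delta> - 1/2"
    define T where "T = t / 2"
    have T: "T \<ge> 6" "t = 2 * T" using t by (auto simp: T_def)
    have a: "-1/2 < a" "a \<le> -1/4" using * by (auto simp: a_def)
    define f where "f = (\<lambda>w. log_zeta (Complex 1 t + w))"
    define Lt where "Lt = ln (2 * t)"
    have Lt: "Lt \<ge> 0" using t by (simp add: Lt_def)
    have hor: "cmod (log_zeta (Complex \<sigma> v)) \<le> K * Lt * (\<sigma> - 1/2) powr (-1/2)"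
      if "1/2 < \<sigma>" "\<sigma> \<le> 2" "v = t + T \<or> v = t - T" for \<sigma> v
    proof -
      have v: "v \<ge> 6" "v \<le> 2 * t" using that(3) T by auto
      have "cmod (log_zeta (Complex \<sigma> v)) \<le> K * ln v * (\<sigma> - 1/2) powr (-1/2)" using K(2) v that by auto
      also have "\<dots> \<le> K * Lt * (\<sigma> - 1/2) powr (-1/2)"
        using K v unfolding Lt_def by (intro mult_right_mono mult_left_mono ln_mono) auto
      finally show ?thesis .
    qed
    define B where "B = K * Lt * (exp 4 * exp (- (T\<^sup>2)))"
    have B: "B \<ge> 0" using K Lt by (simp add: B_def)
    \<comment> \<open>first rectangle: from the right of \<open>Re s = 1\<close> to the left edge \<open>Re s = 1/2 + \<delta>\<close>\<close>
    define F where "F = (\<lambda>w. f w * exp (of_real y * w + w\<^sup>2))"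
    have Fker: "F w / w = f w * ker y w" for w by (simp add: F_def ker_def)
    define A1 where "A1 = {w. Re w > -1/2} \<inter> {w. Im w > - t}"
    have A1: "convex A1" "open A1" unfolding A1_def
      by (intro convex_Int convex_halfspace_Re_gt convex_halfspace_Im_gt open_Int open_halfspace_Re_gt open_halfspace_Im_gt)+
    have f1: "f holomorphic_on A1"
    proof -
      have "log_zeta holomorphic_on ((\<lambda>w. Complex 1 t + w) ` A1)"
        by (rule holomorphic_log_zeta'[OF rh]) (auto simp: A1_def)
      hence "(log_zeta \<circ> (\<lambda>w. Complex 1 t + w)) holomorphic_on A1"
        by (intro holomorphic_on_compose holomorphic_intros)
      thus ?thesis by (simp add: f_def o_def)
    qed
    have "\<i> * integral {-T..T} (\<lambda>u. F (Complex \<eta> u) / Complex \<eta> u) - \<i> * integral {-T..T} (\<lambda>u. F (Complex a u) / Complex a u)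
        = 2 * pi * \<i> * F 0 + integral {a..\<eta>} (\<lambda>x. F (Complex x T) / Complex x T) - integral {a..\<eta>} (\<lambda>x. F (Complex x (-T)) / Complex x (-T))"
    proof (rule rect_cauchy_pole)
      show "F holomorphic_on A1" unfolding F_def by (intro holomorphic_intros f1)
      show "{w. a \<le> Re w \<and> Re w \<le> \<eta> \<and> \<bar>Im w\<bar> \<le> T} \<subseteq> A1" using a T by (auto simp: A1_def)
    qed (use a * T A1 in auto)
    moreover have "F 0 = f 0" by (simp add: F_def)
    ultimately have r1: "\<i> * integral {-T..T} (\<lambda>u. f (Complex \<eta> u) * ker y (Complex \<eta> u)) - \<i> * integral {-T..T} (\<lambda>u. f (Complex a u) * ker y (Complex a u))
        = 2 * pi * \<i> * f 0 + integral {a..\<eta>} (\<lambda>x. f (Complex x T) * ker y (Complex x T)) - integral {a..\<eta>} (\<lambda>x. f (Complex x (-T)) * ker y (Complex x (-T)))"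
      unfolding Fker by simp
    have h1: "cmod (integral {a..\<eta>} (\<lambda>x. f (Complex x v) * ker y (Complex x v))) \<le> 4 * B" if v: "v = T \<or> v = -T" for v
    proof (rule integral_le_root_singularity)
      have "continuous_on {a..\<eta>} (\<lambda>x. f (Complex x v))"
        by (rule continuous_on_compose2[OF holomorphic_on_imp_continuous_on[OF f1]]) (use a v T in \<open>auto simp: A1_def intro!: continuous_intros\<close>)
      moreover have "continuous_on {a..\<eta>} (\<lambda>x. ker y (Complex x v))"
        unfolding ker_def by (intro continuous_intros) (use v T in \<open>auto simp: complex_eq_iff\<close>)
      ultimately show "continuous_on {a..\<eta>} (\<lambda>x. f (Complex x v) * ker y (Complex x v))" by (intro continuous_intros)
      fix x assume x: "x \<in> {a..\<eta>}"
      have "cmod (f (Complex x v)) \<le> K * Lt * ((1 + x) - 1/2) powr (-1/2)"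
        unfolding f_def complex_add by (rule hor) (use x a * v in auto)
      moreover have "cmod (ker y (Complex x v)) \<le> exp 4 * exp (- (T\<^sup>2))"
      proof (rule norm_ker_horizontal)
        have "\<bar>x\<bar> \<le> 1" using x a * by auto
        hence "x\<^sup>2 \<le> 1" by (simp add: abs_square_le_1)
        thus "x\<^sup>2 \<le> 3" by simp
        have "y * x \<le> y * \<eta>" using x * by (intro mult_left_mono) auto
        thus "y * x \<le> 1" using * by simp
      qed (use v T in auto)
      ultimately have "cmod (f (Complex x v) * ker y (Complex x v)) \<le> (K * Lt * ((1 + x) - 1/2) powr (-1/2)) * (exp 4 * exp (- (T\<^sup>2)))"
        unfolding norm_mult using K Lt by (intro mult_mono) auto
      also have "\<dots> = B * (x + 1/2) powr (-1/2)" by (simp add: B_def mult_ac add_ac)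
      finally show "cmod (f (Complex x v) * ker y (Complex x v)) \<le> B * (x + 1/2) powr (-1/2)" .
    qed (use a * B in auto)
    \<comment> \<open>second rectangle: on the left edge the conjugate of \<open>f\<close> continues to the left\<close>
    define g where "g = (\<lambda>w. cnj (f (of_real (2 * a) - cnj w)))"
    define A2 where "A2 = {w. Re w < min 0 (2 * a + 1/2)} \<inter> {w. Im w > - t}"
    have A2: "convex A2" "open A2" unfolding A2_def
      by (intro convex_Int convex_halfspace_Re_lt convex_halfspace_Im_gt open_Int open_halfspace_Re_lt open_halfspace_Im_gt)+
    have g2: "g holomorphic_on A2"
    proof -
      have "log_zeta holomorphic_on ((\<lambda>z. Complex 1 t + (of_real (2 * a) - z)) ` (cnj ` A2))"
        by (rule holomorphic_log_zeta'[OF rh]) (auto simp: A2_def)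
      hence "(log_zeta \<circ> (\<lambda>z. Complex 1 t + (of_real (2 * a) - z))) holomorphic_on (cnj ` A2)"
        by (intro holomorphic_on_compose holomorphic_intros)
      from holomorphic_on_compose_cnj_cnj[OF this A2(2)] show ?thesis
        by (simp add: g_def f_def o_def)
    qed
    have gedge: "g (Complex a u) = cnj (f (Complex a u))" for u
    proof -
      have "of_real (2 * a) - cnj (Complex a u) = Complex a u" by (simp add: complex_eq_iff)
      thus ?thesis by (simp add: g_def)
    qed
    have greflect: "cmod (g (Complex x v)) = cmod (log_zeta (Complex (1 + (2 * a - x)) (t + v)))" for x v
    proof -
      have "Complex 1 t + (of_real (2 * a) - cnj (Complex x v)) = Complex (1 + (2 * a - x)) (t + v)" by (simp add: complex_eq_iff)
      thus ?thesis by (simp add: g_def f_def)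
    qed
    have kh: "ker y holomorphic_on A2" unfolding ker_def by (intro holomorphic_intros) (auto simp: A2_def)
    have subA2: "{w. a - 1 \<le> Re w \<and> Re w \<le> a \<and> \<bar>Im w\<bar> \<le> T} \<subseteq> A2" using a T by (auto simp: A2_def)
    have r2: "\<i> * integral {-T..T} (\<lambda>u. g (Complex a u) * ker y (Complex a u)) - \<i> * integral {-T..T} (\<lambda>u. g (Complex (a-1) u) * ker y (Complex (a-1) u))
        = integral {a-1..a} (\<lambda>x. g (Complex x T) * ker y (Complex x T)) - integral {a-1..a} (\<lambda>x. g (Complex x (-T)) * ker y (Complex x (-T)))"
      by (rule rect_cauchy[where F = "\<lambda>w. g w * ker y w" and A = A2])
         (use T A2 subA2 in \<open>auto intro!: holomorphic_intros g2 kh\<close>)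
    have h2: "cmod (integral {a-1..a} (\<lambda>x. g (Complex x v) * ker y (Complex x v))) \<le> 4 * B" if v: "v = T \<or> v = -T" for v
    proof -
      define k where "k = (\<lambda>x. g (Complex x v) * ker y (Complex x v))"
      have kc: "continuous_on {a-1..a} k"
      proof -
        have "continuous_on {a-1..a} (\<lambda>x. g (Complex x v))"
          by (rule continuous_on_compose2[OF holomorphic_on_imp_continuous_on[OF g2]]) (use subA2 v T in \<open>auto intro!: continuous_intros\<close>)
        moreover have "continuous_on {a-1..a} (\<lambda>x. ker y (Complex x v))"
          unfolding ker_def by (intro continuous_intros) (use v T in \<open>auto simp: complex_eq_iff\<close>)
        ultimately show ?thesis unfolding k_def by (intro continuous_intros)
      qed
      have "integral {a-1..a} k = integral {a..a+1} (\<lambda>x. k (2 * a - x))"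
      proof -
        have "integral {a..a+1} (\<lambda>x. k (2 * a - x)) = integral {-(a+1)..-a} (\<lambda>x. k (2 * a + x))"
          using Henstock_Kurzweil_Integration.integral_reflect_real[of "-a" "-(a+1)" "\<lambda>x. k (2 * a + x)"] by (simp del: minus_add_distrib)
        also have "\<dots> = integral {a-1..a} k"
          using integral_shift_real_ivl[of "a-1" "2 * a" a k] by (simp add: add_ac)
        finally show ?thesis by simp
      qed
      also have "cmod \<dots> \<le> 4 * B"
      proof (rule integral_le_root_singularity)
        show "continuous_on {a..a+1} (\<lambda>x. k (2 * a - x))"
          by (rule continuous_on_compose2[OF kc]) (auto intro!: continuous_intros)
        fix x assume x: "x \<in> {a..a+1}"
        have "cmod (g (Complex (2 * a - x) v)) \<le> K * Lt * ((1 + x) - 1/2) powr (-1/2)"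
          unfolding greflect using hor[of "1 + x" "t + v"] x a v by auto
        moreover have "cmod (ker y (Complex (2 * a - x) v)) \<le> exp 4 * exp (- (T\<^sup>2))"
        proof (rule norm_ker_horizontal)
          have "\<bar>2 * a - x\<bar> \<le> 3/2" using x a by auto
          hence "(2 * a - x)\<^sup>2 \<le> (3/2)\<^sup>2" using abs_le_square_iff[of "2 * a - x" "3/2"] by simp
          thus "(2 * a - x)\<^sup>2 \<le> 3" by (simp add: power2_eq_square)
          have "y * (2 * a - x) \<le> 0" using x a * by (intro mult_nonneg_nonpos) auto
          thus "y * (2 * a - x) \<le> 1" by simp
        qed (use v T in auto)
        ultimately have "cmod (k (2 * a - x)) \<le> (K * Lt * ((1 + x) - 1/2) powr (-1/2)) * (exp 4 * exp (- (T\<^sup>2)))"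
          unfolding k_def norm_mult using K Lt by (intro mult_mono) auto
        also have "\<dots> = B * (x + 1/2) powr (-1/2)" by (simp add: B_def mult_ac add_ac)
        finally show "cmod (k (2 * a - x)) \<le> B * (x + 1/2) powr (-1/2)" .
      qed (use a B in auto)
      finally show ?thesis unfolding k_def .
    qed
    \<comment> \<open>the far left edge, where the Dirichlet series is bounded and the kernel is small\<close>
    have fl: "cmod (integral {-T..T} (\<lambda>u. g (Complex (a-1) u) * ker y (Complex (a-1) u))) \<le> N * exp 3 * sqrt pi * exp (- y)"
    proof -
      have "cmod (integral {-T..T} (\<lambda>u. g (Complex (a-1) u) * ker y (Complex (a-1) u))) \<le> integral {-T..T} (\<lambda>u. N * exp 3 * exp (- y) * exp (- (u\<^sup>2)))"
      proof (rule Henstock_Kurzweil_Integration.integral_norm_bound_integral)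
        have "continuous_on {-T..T} (\<lambda>u. g (Complex (a-1) u))"
          by (rule continuous_on_compose2[OF holomorphic_on_imp_continuous_on[OF g2]]) (auto intro!: subsetD[OF subA2] continuous_intros)
        thus "(\<lambda>u. g (Complex (a-1) u) * ker y (Complex (a-1) u)) integrable_on {-T..T}"
          using a by (intro integrable_continuous_interval continuous_intros continuous_on_ker) auto
        show "(\<lambda>u. N * exp 3 * exp (- y) * exp (- (u\<^sup>2))) integrable_on {-T..T}" by (intro integrable_continuous_interval continuous_intros)
        fix u assume "u \<in> {-T..T}"
        have "Complex (1 + (2 * a - (a - 1))) (t + u) = Complex (2 + a) (t + u)" by simp
        moreover have "cmod (log_dir (Complex (2 + a) (t + u))) \<le> N"
          unfolding N_def by (rule norm_log_dir_le) (use a in auto)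
        moreover have "log_zeta (Complex (2 + a) (t + u)) = log_dir (Complex (2 + a) (t + u))"
          by (rule log_zeta_log_dir[OF rh]) (use a in auto)
        ultimately have 1: "cmod (g (Complex (a-1) u)) \<le> N" unfolding greflect by simp
        have "cmod (ker y (Complex (a-1) u)) \<le> exp (y * (a-1) + (a-1)\<^sup>2) / 1 * exp (- (u\<^sup>2))"
          by (rule norm_ker_le) (use a abs_Re_le_cmod[of "Complex (a-1) u"] in auto)
        also have "\<dots> \<le> exp (- y + 3) / 1 * exp (- (u\<^sup>2))"
        proof -
          have "\<bar>a - 1\<bar> \<le> 3/2" using a by auto
          hence "(a-1)\<^sup>2 \<le> (3/2)\<^sup>2" using abs_le_square_iff[of "a-1" "3/2"] by simp
          hence "(a-1)\<^sup>2 \<le> 3" by (simp add: power2_eq_square)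
          moreover have "y * (a - 1) \<le> y * (-1)" using a * by (intro mult_left_mono) auto
          ultimately show ?thesis by (intro mult_right_mono divide_right_mono) auto
        qed
        finally have "cmod (ker y (Complex (a-1) u)) \<le> exp 3 * exp (- y) * exp (- (u\<^sup>2))" by (simp add: exp_add exp_diff exp_minus field_simps)
        hence "cmod (g (Complex (a-1) u) * ker y (Complex (a-1) u)) \<le> N * (exp 3 * exp (- y) * exp (- (u\<^sup>2)))"
          unfolding norm_mult using 1 N by (intro mult_mono) auto
        thus "cmod (g (Complex (a-1) u) * ker y (Complex (a-1) u)) \<le> N * exp 3 * exp (- y) * exp (- (u\<^sup>2))" by (simp add: mult_ac)
      qed
      also have "\<dots> = N * exp 3 * exp (- y) * integral {-T..T} (\<lambda>u. exp (- (u\<^sup>2)))" by simp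
      also have "\<dots> \<le> N * exp 3 * exp (- y) * sqrt pi" using N by (intro mult_left_mono integral_gauss_Icc_le) auto
      finally show ?thesis by (simp add: mult_ac)
    qed
    \<comment> \<open>what remains on the left edge is twice the imaginary part\<close>
    define M where "M = integral {-T..T} (\<lambda>u. \<bar>Im (f (Complex a u))\<bar> * exp (- (u\<^sup>2)))"
    have fc: "continuous_on {-T..T} (\<lambda>u. f (Complex a u))"
      by (rule continuous_on_compose2[OF holomorphic_on_imp_continuous_on[OF f1]]) (use a T in \<open>auto simp: A1_def intro!: continuous_intros\<close>)
    have kc: "continuous_on {-T..T} (\<lambda>u. ker y (Complex a u))" using a by (intro continuous_on_ker) auto
    have gc: "continuous_on {-T..T} (\<lambda>u. g (Complex a u))" unfolding gedge by (intro continuous_intros fc)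
    have im: "cmod (integral {-T..T} (\<lambda>u. f (Complex a u) * ker y (Complex a u)) - integral {-T..T} (\<lambda>u. g (Complex a u) * ker y (Complex a u)))
        \<le> 8 * exp 1 * exp (y * a) * M"
    proof -
      have "integral {-T..T} (\<lambda>u. f (Complex a u) * ker y (Complex a u)) - integral {-T..T} (\<lambda>u. g (Complex a u) * ker y (Complex a u))
         = integral {-T..T} (\<lambda>u. f (Complex a u) * ker y (Complex a u) - g (Complex a u) * ker y (Complex a u))"
        by (intro integral_diff[symmetric] integrable_continuous_interval continuous_intros fc kc gc)
      also have "cmod \<dots> \<le> integral {-T..T} (\<lambda>u. 8 * exp 1 * exp (y * a) * (\<bar>Im (f (Complex a u))\<bar> * exp (- (u\<^sup>2))))"
      proof (rule Henstock_Kurzweil_Integration.integral_norm_bound_integral)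
        show "(\<lambda>u. f (Complex a u) * ker y (Complex a u) - g (Complex a u) * ker y (Complex a u)) integrable_on {-T..T}"
          by (intro integrable_continuous_interval continuous_intros fc kc gc)
        show "(\<lambda>u. 8 * exp 1 * exp (y * a) * (\<bar>Im (f (Complex a u))\<bar> * exp (- (u\<^sup>2)))) integrable_on {-T..T}"
          by (intro integrable_continuous_interval continuous_intros fc)
        fix u assume "u \<in> {-T..T}"
        have "f (Complex a u) * ker y (Complex a u) - g (Complex a u) * ker y (Complex a u) = (f (Complex a u) - cnj (f (Complex a u))) * ker y (Complex a u)"
          unfolding gedge by (simp add: algebra_simps)
        also have "f (Complex a u) - cnj (f (Complex a u)) = \<i> * of_real (2 * Im (f (Complex a u)))" by (simp add: complex_eq_iff)
        finally have "cmod (f (Complex a u) * ker y (Complex a u) - g (Complex a u) * ker y (Complex a u)) = 2 * \<bar>Im (f (Complex a u))\<bar> * cmod (ker y (Complex a u))"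
          by (simp add: norm_mult)
        also have "cmod (ker y (Complex a u)) \<le> exp (y * a + a\<^sup>2) / (1/4) * exp (- (u\<^sup>2))"
          by (rule norm_ker_le) (use a abs_Re_le_cmod[of "Complex a u"] in auto)
        also have "\<dots> \<le> exp (y * a + 1) / (1/4) * exp (- (u\<^sup>2))"
        proof -
          have "a\<^sup>2 \<le> 1" using a by (simp add: abs_square_le_1)
          thus ?thesis by (intro mult_right_mono divide_right_mono) auto
        qed
        also have "2 * \<bar>Im (f (Complex a u))\<bar> * (exp (y * a + 1) / (1/4) * exp (- (u\<^sup>2))) = 8 * exp 1 * exp (y * a) * (\<bar>Im (f (Complex a u))\<bar> * exp (- (u\<^sup>2)))"
          by (simp add: exp_add mult_ac)
        finally show "cmod (f (Complex a u) * ker y (Complex a u) - g (Complex a u) * ker y (Complex a u)) \<le> 8 * exp 1 * exp (y * a) * (\<bar>Im (f (Complex a u))\<bar> * exp (- (u\<^sup>2)))"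
          by (simp add: mult_left_mono)
      qed
      also have "\<dots> = 8 * exp 1 * exp (y * a) * M" unfolding M_def by (rule integral_mult_right)
      finally show ?thesis .
    qed
    define J1 where "J1 = integral {-T..T} (\<lambda>u. f (Complex \<eta> u) * ker y (Complex \<eta> u))"
    define J2 where "J2 = integral {-T..T} (\<lambda>u. f (Complex a u) * ker y (Complex a u))"
    define J3 where "J3 = integral {-T..T} (\<lambda>u. g (Complex a u) * ker y (Complex a u))"
    define J4 where "J4 = integral {-T..T} (\<lambda>u. g (Complex (a-1) u) * ker y (Complex (a-1) u))"
    define H1 where "H1 = integral {a..\<eta>} (\<lambda>x. f (Complex x T) * ker y (Complex x T))"
    define H2 where "H2 = integral {a..\<eta>} (\<lambda>x. f (Complex x (-T)) * ker y (Complex x (-T)))"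
    define H3 where "H3 = integral {a-1..a} (\<lambda>x. g (Complex x T) * ker y (Complex x T))"
    define H4 where "H4 = integral {a-1..a} (\<lambda>x. g (Complex x (-T)) * ker y (Complex x (-T)))"
    have e1: "\<i> * J1 - \<i> * J2 = 2 * pi * \<i> * f 0 + H1 - H2" using r1 unfolding J1_def J2_def H1_def H2_def .
    have e2: "\<i> * J3 - \<i> * J4 = H3 - H4" using r2 unfolding J3_def J4_def H3_def H4_def .
    have "\<i> * (J1 - 2 * pi * f 0) = \<i> * (J2 - J3) + \<i> * J4 + H1 - H2 + H3 - H4"
      using e1 e2 by (simp add: algebra_simps)
    hence "cmod (\<i> * (J1 - 2 * pi * f 0)) = cmod (\<i> * (J2 - J3) + \<i> * J4 + H1 - H2 + H3 - H4)" by simp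
    also have "\<dots> \<le> cmod (J2 - J3) + cmod J4 + cmod H1 + cmod H2 + cmod H3 + cmod H4"
    proof -
      have "cmod (\<i> * (J2 - J3) + \<i> * J4 + H1 - H2 + H3 - H4) \<le> cmod (\<i> * (J2 - J3)) + cmod (\<i> * J4) + cmod H1 + cmod H2 + cmod H3 + cmod H4"
        by (intro norm_triangle_mono norm_triangle_ineq[THEN order_trans] norm_triangle_ineq4[THEN order_trans] add_mono order_refl)
      thus ?thesis by (simp add: norm_mult)
    qed
    also have "\<dots> \<le> 8 * exp 1 * exp (y * a) * M + N * exp 3 * sqrt pi * exp (- y) + 16 * B"
      using im fl h1[of T] h1[of "-T"] h2[of T] h2[of "-T"]
      unfolding J2_def J3_def J4_def H1_def H2_def H3_def H4_def by simp
    finally have main: "cmod (J1 - 2 * pi * f 0) \<le> 8 * exp 1 * exp (y * a) * M + N * exp 3 * sqrt pi * exp (- y) + 16 * B"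
      by (simp add: norm_mult)
    have M0: "M \<ge> 0" unfolding M_def by (intro integral_nonneg integrable_continuous_interval continuous_intros fc) auto
    have "8 * exp 1 * exp (y * a) * M + N * exp 3 * sqrt pi * exp (- y) + 16 * B = 8 * exp 1 * (exp (y * a) * M) + N * exp 3 * sqrt pi * exp (- y) + 16 * K * exp 4 * (Lt * exp (- (T\<^sup>2)))"
      by (simp add: B_def mult_ac)
    also have "\<dots> \<le> C * (exp (y * a) * M) + C * exp (- y) + C * (Lt * exp (- (T\<^sup>2)))"
      using M0 N K Lt unfolding C_def by (intro add_mono mult_right_mono) auto
    also have "\<dots> = C * (exp (y * a) * M + exp (- y) + Lt * exp (- (T\<^sup>2)))" by (simp add: algebra_simps)
    finally have main': "cmod (J1 - 2 * pi * f 0) \<le> C * (exp (y * a) * M + exp (- y) + Lt * exp (- (T\<^sup>2)))" using main by linarith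
    have "f (Complex \<eta> u) = log_dir (Complex 1 t + Complex \<eta> u)" for u
      unfolding f_def by (rule log_zeta_log_dir[OF rh]) (use * in auto)
    moreover have "f 0 = log_zeta (Complex 1 t)" by (simp add: f_def)
    moreover have "f (Complex a u) = log_zeta (Complex (1/2 + \<delta>) (t + u))" for u
      by (simp add: f_def complex_add a_def)
    ultimately show "cmod (integral {-(t/2)..t/2} (\<lambda>u. log_dir (Complex 1 t + Complex \<eta> u) * ker y (Complex \<eta> u)) - 2 * pi * log_zeta (Complex 1 t))
     \<le> C * (exp (y * (\<delta> - 1/2)) * integral {-(t/2)..t/2} (\<lambda>u. \<bar>Im (log_zeta (Complex (1/2 + \<delta>) (t + u)))\<bar> * exp (- (u\<^sup>2)))
          + exp (- y) + ln (2 * t) * exp (- (t\<^sup>2 / 4)))"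
      using main' by (simp add: J1_def M_def T_def a_def Lt_def power_divide)
  qed
qed

section \<open>Local boundedness of \<open>S\<close>\<close>

text \<open>
  Under the Riemann hypothesis these are ordinates of zeros of an entire function on a compact segment.
\<close>

lemma finite_ordinates:
  assumes rh: "riemann_hypothesis"
  shows "finite {v\<in>{p..q}. v \<in> Im ` nontrivial_zeros}"
proof -
  define K where "K = cbox (Complex (1/2) p) (Complex (1/2) q)"
  have fin: "finite {z\<in>K. Zeta1 z = 0}"
  proof (cases "Zeta1 constant_on UNIV")
    case True
    hence "Zeta1 z = 1" for z unfolding constant_on_def using Zeta1_1 by (metis UNIV_I)
    thus ?thesis by simp
  next
    case False
    thus ?thesis by (intro holomorphic_compact_finite_zeros[OF holomorphic_Zeta1]) (auto simp: K_def)
  qed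
  have "{v\<in>{p..q}. v \<in> Im ` nontrivial_zeros} \<subseteq> Im ` {z\<in>K. Zeta1 z = 0}"
  proof
    fix v assume "v \<in> {v\<in>{p..q}. v \<in> Im ` nontrivial_zeros}"
    then obtain z where z: "z \<in> nontrivial_zeros" "v = Im z" "p \<le> v" "v \<le> q" by auto
    have "Re z = 1/2" using rh z by (auto simp: riemann_hypothesis_def)
    moreover have "z \<noteq> 1" using z by (auto simp: nontrivial_zeros_def)
    hence "Zeta1 z = 0" using z by (auto simp: nontrivial_zeros_def zeta_eq_Zeta1)
    ultimately show "v \<in> Im ` {z\<in>K. Zeta1 z = 0}"
      using z by (intro image_eqI[of _ _ z]) (auto simp: K_def in_cbox_complex_iff)
  qed
  thus ?thesis using fin by (meson finite_imageI finite_subset)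
qed

lemma S_log_bound:
  assumes rh: "riemann_hypothesis"
  shows "\<exists>A>0. \<forall>v\<ge>4. v \<notin> Im ` nontrivial_zeros \<longrightarrow> \<bar>S v\<bar> \<le> A * ln v"
proof -
  obtain A where A: "A > 0" "\<And>v \<sigma>. v \<ge> 4 \<Longrightarrow> \<sigma> > 1/2 \<Longrightarrow> \<bar>Im (log_zeta (Complex \<sigma> v))\<bar> \<le> A * ln v"
    using arg_zeta_bound[OF rh] by blast
  have "\<bar>S v\<bar> \<le> A * ln v" if v: "v \<ge> 4" "v \<notin> Im ` nontrivial_zeros" for v
  proof -
    have "((\<lambda>\<sigma>. \<bar>Im (log_zeta (Complex \<sigma> v))\<bar>) \<longlongrightarrow> \<bar>pi * S v\<bar>) (at_right (1/2))"
      using S_boundary_value[OF rh, of v] v by (intro tendsto_rabs) auto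
    moreover have "eventually (\<lambda>\<sigma>. \<bar>Im (log_zeta (Complex \<sigma> v))\<bar> \<le> A * ln v) (at_right (1/2))"
      using eventually_at_right_less[of "1/2"] by eventually_elim (use A v in auto)
    ultimately have "\<bar>pi * S v\<bar> \<le> A * ln v"
      by (rule tendsto_upperbound) simp
    moreover have "1 * \<bar>S v\<bar> \<le> pi * \<bar>S v\<bar>" using pi_gt3 by (intro mult_right_mono) auto
    ultimately show ?thesis by (simp add: abs_mult)
  qed
  thus ?thesis using A by blast
qed

text \<open>
  The supremum in \<open>L\<close> is over a bounded set: \<open>S\<close> is \<open>O(log)\<close> off the ordinates of zeros, and only finitely many ordinates lie
  in the window.
\<close>

lemma S_le_L:
  assumes rh: "riemann_hypothesis" and t: "t - C * ln (ln t) \<ge> 4" and u: "\<bar>u - t\<bar> \<le> C * ln (ln t)"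
  shows "\<bar>S u\<bar> \<le> L C t"
proof -
  obtain A where A: "A > 0" "\<And>v. v \<ge> 4 \<Longrightarrow> v \<notin> Im ` nontrivial_zeros \<Longrightarrow> \<bar>S v\<bar> \<le> A * ln v"
    using S_log_bound[OF rh] by blast
  define c where "c = C * ln (ln t)"
  define W where "W = {v. \<bar>v - t\<bar> \<le> c}"
  have W: "W = {t - c..t + c}" by (auto simp: W_def)
  define Z where "Z = {v\<in>W. v \<in> Im ` nontrivial_zeros}"
  have "finite Z" unfolding Z_def W by (rule finite_ordinates[OF rh])
  hence "bdd_above ((\<lambda>v. \<bar>S v\<bar>) ` Z)" by simp
  moreover have "bdd_above ((\<lambda>v. \<bar>S v\<bar>) ` (W - Z))"
  proof (rule bdd_aboveI2)
    fix v assume v: "v \<in> W - Z"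
    hence v': "v \<ge> 4" "v \<le> t + c" "v \<notin> Im ` nontrivial_zeros" using t by (auto simp: W Z_def c_def)
    have "\<bar>S v\<bar> \<le> A * ln v" using A v' by blast
    also have "\<dots> \<le> A * ln (t + c)" using A v' by (intro mult_left_mono ln_mono) auto
    finally show "\<bar>S v\<bar> \<le> A * ln (t + c)" .
  qed
  ultimately have "bdd_above ((\<lambda>v. \<bar>S v\<bar>) ` Z \<union> (\<lambda>v. \<bar>S v\<bar>) ` (W - Z))" by simp
  also have "(\<lambda>v. \<bar>S v\<bar>) ` Z \<union> (\<lambda>v. \<bar>S v\<bar>) ` (W - Z) = (\<lambda>v. \<bar>S v\<bar>) ` W" by (auto simp: Z_def)
  finally show ?thesis unfolding L_def using u by (intro cSUP_upper) (auto simp: W_def c_def)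
qed

section \<open>The left edge tends to the critical line\<close>

lemma integral_wide_gauss_Icc_le: "integral {-T..T} (\<lambda>u::real. exp (- (u\<^sup>2 / 4))) \<le> wide_gauss"
proof -
  have "((\<lambda>u::real. exp (- (u\<^sup>2 / 4))) has_integral wide_gauss) UNIV"
    using has_integral_integral_lborel[OF integrable_wide_gauss] by (simp add: wide_gauss_def)
  thus ?thesis
    by (intro integral_subset_le[of "{-T..T}" UNIV, THEN order_trans])
       (auto simp: has_integral_iff intro!: integrable_continuous_interval continuous_intros)
qed

text \<open>
  As the left edge tends to the critical line, the argument of \<open>\<zeta>\<close> tends to \<open>\<pi> S\<close> except at finitely many ordinates, and it is
  dominated by \<open>A ln (2t)\<close>. In the window \<open>\<bar>u\<bar> \<le> c\<close> the limit is at most \<open>\<pi> L C t\<close>; outside it the dominating bound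
  is multiplied by a Gaussian of size \<open>exp (- c\<^sup>2 / 2)\<close>.
\<close>

lemma left_edge_limit:
  assumes rh: "riemann_hypothesis" and A: "A > 0" "\<And>v \<sigma>. v \<ge> 4 \<Longrightarrow> \<sigma> > 1/2 \<Longrightarrow> \<bar>Im (log_zeta (Complex \<sigma> v))\<bar> \<le> A * ln v"
    and t: "t \<ge> 12" and T: "T = t / 2" and c: "0 \<le> c" "c \<le> T" "c = C * ln (ln t)"
  shows "\<exists>l. (\<lambda>n. integral {-T..T} (\<lambda>u. \<bar>Im (log_zeta (Complex (1/2 + 1 / real (n + 4)) (t + u)))\<bar> * exp (- (u\<^sup>2)))) \<longlonglongrightarrow> l \<and>
           l \<le> pi * L C t * sqrt pi + A * ln (2 * t) * exp (- (c\<^sup>2 / 2)) * wide_gauss"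
proof -
  define f where "f = (\<lambda>n u. \<bar>Im (log_zeta (Complex (1/2 + 1 / real (n + 4)) (t + u)))\<bar> * exp (- (u\<^sup>2)))"
  define Z where "Z = {u\<in>{-T..T}. t + u \<in> Im ` nontrivial_zeros}"
  have T6: "T \<ge> 6" "t = 2 * T" using t T by auto
  have "finite Z"
  proof -
    have "Z \<subseteq> (\<lambda>v. v - t) ` {v\<in>{t-T..t+T}. v \<in> Im ` nontrivial_zeros}"
      by (auto simp: Z_def intro!: image_eqI[of _ _ "t + _"])
    thus ?thesis using finite_ordinates[OF rh] by (meson finite_imageI finite_subset)
  qed
  hence negl: "negligible Z" by (rule negligible_finite)
  define f' where "f' = (\<lambda>n u. if u \<in> Z then 0 else f n u)"
  define g where "g = (\<lambda>u. if u \<in> Z then 0 else \<bar>pi * S (t + u)\<bar> * exp (- (u\<^sup>2)))"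
  have fi: "f n integrable_on {-T..T}" for n
  proof -
    have "continuous_on ((\<lambda>u. Complex (1/2 + 1 / real (n + 4)) (t + u)) ` {-T..T}) log_zeta"
      by (intro holomorphic_on_imp_continuous_on holomorphic_log_zeta'[OF rh]) (use T6 in auto)
    hence "continuous_on {-T..T} (\<lambda>u. log_zeta (Complex (1/2 + 1 / real (n + 4)) (t + u)))"
      by (rule continuous_on_compose2) (auto simp: Complex_eq intro!: continuous_intros)
    thus ?thesis unfolding f_def by (intro integrable_continuous_interval continuous_intros)
  qed
  have f'i: "f' n integrable_on {-T..T}" for n
    by (rule integrable_spike[OF fi negl]) (auto simp: f'_def)
  have feq: "integral {-T..T} (f' n) = integral {-T..T} (f n)" for n
    by (rule integral_spike[OF negl]) (auto simp: f'_def)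
  define B where "B = A * ln (2 * t)"
  have B: "B \<ge> 0" using A t by (simp add: B_def)
  have arg: "\<bar>Im (log_zeta (Complex (1/2 + 1 / real (n + 4)) (t + u)))\<bar> \<le> B" if "u \<in> {-T..T}" for n u
  proof -
    have "\<bar>Im (log_zeta (Complex (1/2 + 1 / real (n + 4)) (t + u)))\<bar> \<le> A * ln (t + u)"
      by (rule A(2)) (use that T6 in auto)
    also have "\<dots> \<le> B" unfolding B_def using that T6 A by (intro mult_left_mono ln_mono) auto
    finally show ?thesis .
  qed
  have lim: "(\<lambda>n. f' n u) \<longlonglongrightarrow> g u" if u: "u \<in> {-T..T}" for u
  proof (cases "u \<in> Z")
    case False
    have nz: "t + u > 0" "t + u \<notin> Im ` nontrivial_zeros" using False u T6 by (auto simp: Z_def)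
    have "filterlim (\<lambda>n. 1/2 + 1 / real (n + 4)) (at_right (1/2)) sequentially"
      by real_asymp
    from filterlim_compose[OF S_boundary_value[OF rh nz] this]
    show ?thesis using False unfolding f'_def g_def f_def by (auto intro!: tendsto_intros)
  qed (auto simp: f'_def g_def)
  have dom: "norm (f' n u) \<le> B * exp (- (u\<^sup>2))" if "u \<in> {-T..T}" for n u
    using arg[OF that, of n] B by (auto simp: f'_def f_def abs_mult)
  have Bi: "(\<lambda>u. B * exp (- (u\<^sup>2))) integrable_on {-T..T}" by (intro integrable_continuous_interval continuous_intros)
  have conv: "g integrable_on {-T..T}" "(\<lambda>n. integral {-T..T} (f' n)) \<longlonglongrightarrow> integral {-T..T} g"
    using dominated_convergence[OF f'i Bi dom lim] by auto
  define h where "h = (\<lambda>u. pi * L C t * exp (- (u\<^sup>2)) + B * exp (- (c\<^sup>2 / 2)) * exp (- (u\<^sup>2 / 4)))"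
  have hi: "h integrable_on {-T..T}" unfolding h_def by (intro integrable_continuous_interval continuous_intros) auto
  have win: "t - C * ln (ln t) \<ge> 4" using c T6 by simp
  have L0: "L C t \<ge> 0" using S_le_L[OF rh win, of t] c by simp
  have gh: "g u \<le> h u" if u: "u \<in> {-T..T}" for u
  proof (cases "u \<in> Z")
    case True
    thus ?thesis using L0 B by (simp add: g_def h_def)
  next
    case uZ: False
    show ?thesis
    proof (cases "\<bar>u\<bar> \<le> c")
      case True
      hence "\<bar>S (t + u)\<bar> \<le> L C t" by (intro S_le_L[OF rh win]) (use c in simp)
      hence "pi * \<bar>S (t + u)\<bar> * exp (- (u\<^sup>2)) \<le> pi * L C t * exp (- (u\<^sup>2))" by (intro mult_right_mono mult_left_mono) auto
      moreover have "B * exp (- (c\<^sup>2 / 2)) * exp (- (u\<^sup>2 / 4)) \<ge> 0" using B by simp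
      moreover have "g u = pi * \<bar>S (t + u)\<bar> * exp (- (u\<^sup>2))" using uZ by (simp add: g_def abs_mult)
      ultimately show ?thesis unfolding h_def by linarith
    next
      case False
      have "(\<lambda>n. f' n u) \<longlonglongrightarrow> g u" by (rule lim[OF u])
      hence "g u \<le> B * exp (- (u\<^sup>2))"
        by (rule LIMSEQ_le_const2) (use dom[OF u] in \<open>auto intro: order_trans[OF abs_ge_self]\<close>)
      also have "\<dots> \<le> B * (exp (- (c\<^sup>2 / 2)) * exp (- (u\<^sup>2 / 4)))"
      proof (rule mult_left_mono[OF _ B])
        have "c\<^sup>2 \<le> u\<^sup>2" using False c by (simp add: abs_le_square_iff[symmetric])
        thus "exp (- (u\<^sup>2)) \<le> exp (- (c\<^sup>2 / 2)) * exp (- (u\<^sup>2 / 4))"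
          unfolding exp_add[symmetric] exp_le_cancel_iff using zero_le_power2[of u] by linarith
      qed
      also have "\<dots> \<le> h u" unfolding h_def using L0 by (simp add: mult_ac)
      finally show ?thesis .
    qed
  qed
  have "integral {-T..T} g \<le> integral {-T..T} h" by (rule integral_le[OF conv(1) hi gh])
  also have "\<dots> = pi * L C t * integral {-T..T} (\<lambda>u. exp (- (u\<^sup>2))) + B * exp (- (c\<^sup>2 / 2)) * integral {-T..T} (\<lambda>u. exp (- (u\<^sup>2 / 4)))"
  proof -
    have "((\<lambda>u. exp (- (u\<^sup>2))) has_integral integral {-T..T} (\<lambda>u. exp (- (u\<^sup>2)))) {-T..T}"
      "((\<lambda>u. exp (- (u\<^sup>2 / 4))) has_integral integral {-T..T} (\<lambda>u. exp (- (u\<^sup>2 / 4)))) {-T..T}"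
      by (intro integrable_integral integrable_continuous_interval continuous_intros)+ simp_all
    hence "(h has_integral (pi * L C t * integral {-T..T} (\<lambda>u. exp (- (u\<^sup>2))) + B * exp (- (c\<^sup>2 / 2)) * integral {-T..T} (\<lambda>u. exp (- (u\<^sup>2 / 4))))) {-T..T}"
      unfolding h_def by (intro has_integral_add has_integral_mult_right)
    thus ?thesis by (rule integral_unique)
  qed
  also have "\<dots> \<le> pi * L C t * sqrt pi + B * exp (- (c\<^sup>2 / 2)) * wide_gauss"
    using L0 B by (intro add_mono mult_left_mono integral_gauss_Icc_le integral_wide_gauss_Icc_le) auto
  finally show ?thesis using conv(2) unfolding feq f_def B_def by blast
qed

text \<open>
  The line of integration \<open>Re w = 1 / y\<close> keeps \<open>exp (y w)\<close> bounded in the far part, and \<open>exp (- (C ln (ln t))\<^sup>2 / 2)\<close> is smaller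
  than every power of \<open>ln t\<close>, so the part outside the window tends to \<open>0\<close>.
\<close>

theorem smoothed_estimate:
  assumes rh: "riemann_hypothesis" and C: "C > 0"
  shows "\<exists>C1 E. C1 > 0 \<and> (E \<longlongrightarrow> 0) at_top \<and> eventually (\<lambda>t. 0 \<le> L C t \<and> (\<forall>y\<ge>1. \<exists>z.
     (\<lambda>n. log_term (Complex 1 t) n * cutoff (y - ln (real n))) sums z \<and>
     cmod (z - log_zeta (Complex 1 t)) \<le> C1 * exp (- (y / 2)) * (1 + L C t) + E t)) at_top"
proof -
  obtain A where A: "A > 0" "\<And>v \<sigma>. v \<ge> 4 \<Longrightarrow> \<sigma> > 1/2 \<Longrightarrow> \<bar>Im (log_zeta (Complex \<sigma> v))\<bar> \<le> A * ln v"
    using arg_zeta_bound[OF rh] by blast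
  obtain C0 where C0: "C0 > 0" "\<And>t \<delta> \<eta> y. t \<ge> 12 \<Longrightarrow> 0 < \<delta> \<and> \<delta> \<le> 1/4 \<and> 0 < \<eta> \<and> \<eta> \<le> 1 \<and> 0 \<le> y \<and> y * \<eta> \<le> 1 \<Longrightarrow>
    cmod (integral {-(t/2)..t/2} (\<lambda>u. log_dir (Complex 1 t + Complex \<eta> u) * ker y (Complex \<eta> u)) - 2 * pi * log_zeta (Complex 1 t))
     \<le> C0 * (exp (y * (\<delta> - 1/2)) * integral {-(t/2)..t/2} (\<lambda>u. \<bar>Im (log_zeta (Complex (1/2 + \<delta>) (t + u)))\<bar> * exp (- (u\<^sup>2)))
          + exp (- y) + ln (2 * t) * exp (- (t\<^sup>2 / 4)))"
    using contour_estimate[OF rh] by blast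
  obtain E0 where E0: "(E0 \<longlongrightarrow> 0) at_top" "\<And>t \<eta> y. t \<ge> 2 \<Longrightarrow> 0 < \<eta> \<and> \<eta> \<le> 1 \<and> 0 \<le> y \<and> y * \<eta> \<le> 1 \<Longrightarrow>
    cmod ((LINT u|lborel. log_dir (Complex 1 t + Complex \<eta> u) * ker y (Complex \<eta> u)) -
          integral {-(t/2)..t/2} (\<lambda>u. log_dir (Complex 1 t + Complex \<eta> u) * ker y (Complex \<eta> u))) \<le> E0 t"
    using far_part_bound[OF rh] by blast
  define C1 where "C1 = C0 * (pi * sqrt pi + 1)"
  have C1: "C1 > 0" unfolding C1_def using C0(1) by (intro mult_pos_pos add_nonneg_pos) auto
  define E where "E = (\<lambda>t. E0 t + C0 * A * wide_gauss * (ln (2 * t) * exp (- ((C * ln (ln t))\<^sup>2 / 2))) + C0 * (ln (2 * t) * exp (- (t\<^sup>2 / 4))))"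
  have Elim: "(E \<longlongrightarrow> 0) at_top"
  proof -
    have "((\<lambda>t. ln (2 * t) * exp (- ((C * ln (ln t))\<^sup>2 / 2))) \<longlongrightarrow> 0) at_top" using C by real_asymp
    moreover have "((\<lambda>t::real. ln (2 * t) * exp (- (t\<^sup>2 / 4))) \<longlongrightarrow> 0) at_top" by real_asymp
    ultimately have "(E \<longlongrightarrow> 0 + C0 * A * wide_gauss * 0 + C0 * 0) at_top"
      unfolding E_def by (intro tendsto_intros E0(1))
    thus ?thesis by simp
  qed
  have "eventually (\<lambda>t::real. C * ln (ln t) \<le> t / 2) at_top" by real_asymp
  moreover have "eventually (\<lambda>t::real. C * ln (ln t) \<ge> 0) at_top" using C by real_asymp
  ultimately have "eventually (\<lambda>t. 0 \<le> L C t \<and> (\<forall>y\<ge>1. \<exists>z.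
     (\<lambda>n. log_term (Complex 1 t) n * cutoff (y - ln (real n))) sums z \<and>
     cmod (z - log_zeta (Complex 1 t)) \<le> C1 * exp (- (y / 2)) * (1 + L C t) + E t)) at_top"
    using eventually_ge_at_top[of 12]
  proof eventually_elim
    case (elim t)
    define c where "c = C * ln (ln t)"
    have L0: "L C t \<ge> 0" using S_le_L[OF rh, of t C t] elim by simp
    have "\<exists>z. (\<lambda>n. log_term (Complex 1 t) n * cutoff (y - ln (real n))) sums z \<and>
       cmod (z - log_zeta (Complex 1 t)) \<le> C1 * exp (- (y / 2)) * (1 + L C t) + E t" if y: "y \<ge> 1" for y
    proof -
      define \<eta> where "\<eta> = 1 / y"
      have \<eta>: "0 < \<eta> \<and> \<eta> \<le> 1 \<and> 0 \<le> y \<and> y * \<eta> \<le> 1" using y by (simp add: \<eta>_def)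
      define I where "I = (LINT u|lborel. log_dir (Complex 1 t + Complex \<eta> u) * ker y (Complex \<eta> u))"
      define J where "J = integral {-(t/2)..t/2} (\<lambda>u. log_dir (Complex 1 t + Complex \<eta> u) * ker y (Complex \<eta> u))"
      define \<Phi> where "\<Phi> = (\<lambda>n. integral {-(t/2)..t/2} (\<lambda>u. \<bar>Im (log_zeta (Complex (1/2 + 1 / real (n + 4)) (t + u)))\<bar> * exp (- (u\<^sup>2))))"
      have IJ: "cmod (I - J) \<le> E0 t" unfolding I_def J_def by (rule E0(2)) (use elim \<eta> in auto)
      obtain l where l: "\<Phi> \<longlonglongrightarrow> l" "l \<le> pi * L C t * sqrt pi + A * ln (2 * t) * exp (- (c\<^sup>2 / 2)) * wide_gauss"
        using left_edge_limit[OF rh A elim(3) refl, of c C] elim unfolding \<Phi>_def c_def by blast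
      have Jn: "cmod (J - 2 * pi * log_zeta (Complex 1 t)) \<le> C0 * (exp (y * (1 / real (n + 4) - 1/2)) * \<Phi> n + exp (- y) + ln (2 * t) * exp (- (t\<^sup>2 / 4)))" for n
        unfolding J_def \<Phi>_def by (rule C0(2)[OF elim(3)]) (use \<eta> in \<open>auto simp: field_simps\<close>)
      have "(\<lambda>n. 1 / real (n + 4)) \<longlonglongrightarrow> 0" by real_asymp
      hence "(\<lambda>n. C0 * (exp (y * (1 / real (n + 4) - 1/2)) * \<Phi> n + exp (- y) + ln (2 * t) * exp (- (t\<^sup>2 / 4))))
         \<longlonglongrightarrow> C0 * (exp (y * (0 - 1/2)) * l + exp (- y) + ln (2 * t) * exp (- (t\<^sup>2 / 4)))"
        by (intro tendsto_intros l(1))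
      hence "cmod (J - 2 * pi * log_zeta (Complex 1 t)) \<le> C0 * (exp (y * (0 - 1/2)) * l + exp (- y) + ln (2 * t) * exp (- (t\<^sup>2 / 4)))"
        by (rule LIMSEQ_le_const) (use Jn in auto)
      also have "\<dots> \<le> C0 * ((exp (- (y / 2)) * (pi * L C t * sqrt pi) + 1 * (A * ln (2 * t) * exp (- (c\<^sup>2 / 2)) * wide_gauss)) + exp (- (y / 2)) + ln (2 * t) * exp (- (t\<^sup>2 / 4)))"
      proof (intro mult_left_mono add_mono)
        have "exp (y * (0 - 1/2)) * l \<le> exp (- (y / 2)) * (pi * L C t * sqrt pi + A * ln (2 * t) * exp (- (c\<^sup>2 / 2)) * wide_gauss)"
          using mult_left_mono[OF l(2), of "exp (- (y / 2))"] by simp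
        also have "\<dots> = exp (- (y / 2)) * (pi * L C t * sqrt pi) + exp (- (y / 2)) * (A * ln (2 * t) * exp (- (c\<^sup>2 / 2)) * wide_gauss)"
          by (simp add: algebra_simps)
        also have "\<dots> \<le> exp (- (y / 2)) * (pi * L C t * sqrt pi) + 1 * (A * ln (2 * t) * exp (- (c\<^sup>2 / 2)) * wide_gauss)"
          using A(1) elim(3) y wide_gauss_nonneg by (intro add_left_mono mult_right_mono) auto
        finally show "exp (y * (0 - 1/2)) * l \<le> exp (- (y / 2)) * (pi * L C t * sqrt pi) + 1 * (A * ln (2 * t) * exp (- (c\<^sup>2 / 2)) * wide_gauss)" .
      qed (use C0(1) y elim(3) in auto)
      also have "\<dots> = C0 * (pi * sqrt pi * L C t + 1) * exp (- (y / 2)) + (E t - E0 t)"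
        by (simp add: E_def c_def algebra_simps)
      also have "\<dots> \<le> C1 * (1 + L C t) * exp (- (y / 2)) + (E t - E0 t)"
      proof (intro add_right_mono mult_right_mono)
        have "C0 * (pi * sqrt pi * L C t + 1) \<le> C0 * ((pi * sqrt pi + 1) * (1 + L C t))"
          using C0(1) L0 by (intro mult_left_mono) (auto simp: algebra_simps)
        thus "C0 * (pi * sqrt pi * L C t + 1) \<le> C1 * (1 + L C t)" by (simp add: C1_def mult_ac)
      qed auto
      finally have Jb: "cmod (J - 2 * pi * log_zeta (Complex 1 t)) \<le> C1 * (1 + L C t) * exp (- (y / 2)) + (E t - E0 t)" .
      have "cmod (I - 2 * pi * log_zeta (Complex 1 t)) \<le> cmod (I - J) + cmod (J - 2 * pi * log_zeta (Complex 1 t))"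
        by (rule order_trans[OF _ norm_triangle_ineq]) simp
      hence Ib: "cmod (I - 2 * pi * log_zeta (Complex 1 t)) \<le> C1 * exp (- (y / 2)) * (1 + L C t) + E t"
        using IJ Jb by (simp add: mult_ac)
      have "I / (2 * pi) - log_zeta (Complex 1 t) = (I - 2 * pi * log_zeta (Complex 1 t)) / (2 * pi)"
        by (simp add: diff_divide_distrib)
      hence "cmod (I / (2 * pi) - log_zeta (Complex 1 t)) = cmod (I - 2 * pi * log_zeta (Complex 1 t)) / (2 * pi)"
        by (simp add: norm_divide norm_mult)
      also have "\<dots> \<le> cmod (I - 2 * pi * log_zeta (Complex 1 t)) / 1"
        using pi_gt3 by (intro divide_left_mono) auto
      finally have "cmod (I / (2 * pi) - log_zeta (Complex 1 t)) \<le> C1 * exp (- (y / 2)) * (1 + L C t) + E t" using Ib by simp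
      moreover have "(\<lambda>n. log_term (Complex 1 t) n * cutoff (y - ln (real n))) sums (I / (2 * pi))"
        unfolding I_def by (rule smoothed_log_dir(1)) (use \<eta> in auto)
      ultimately show ?thesis by blast
    qed
    thus ?case using L0 by blast
  qed
  thus ?thesis using C1 Elim by blast
qed

section \<open>Removing the smoothing\<close>

lemma norm_log_term_1: "cmod (log_term (Complex 1 t) n) = log_coeff n / real n"
  by (simp add: norm_log_term powr_minus_divide)

lemma sum_inverse_squares_tail: "N \<ge> 1 \<Longrightarrow> (\<Sum>n\<in>{N<..M}. 1 / (real n)\<^sup>2) \<le> 1 / real N"
proof -
  assume N: "N \<ge> 1"
  have "(\<Sum>n\<in>{N<..M}. 1 / (real n)\<^sup>2) \<le> 1 / real N - 1 / real (max M N)"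
  proof (induction M)
    case (Suc M)
    show ?case
    proof (cases "N \<le> M")
      case True
      have "{N<..Suc M} = insert (Suc M) {N<..M}" using True by auto
      hence "(\<Sum>n\<in>{N<..Suc M}. 1 / (real n)\<^sup>2) = 1 / (real (Suc M))\<^sup>2 + (\<Sum>n\<in>{N<..M}. 1 / (real n)\<^sup>2)" by simp
      also have "\<dots> \<le> 1 / (real (Suc M))\<^sup>2 + (1 / real N - 1 / real M)" using Suc True by (simp add: max_def)
      also have "1 / (real (Suc M))\<^sup>2 \<le> 1 / real M - 1 / real (Suc M)"
        proof -
          have "real M * real (Suc M) \<le> (real (Suc M))\<^sup>2" by (simp add: power2_eq_square)
          moreover have "real M * real (Suc M) > 0" using True N by simp
          ultimately have "1 / (real (Suc M))\<^sup>2 \<le> 1 / (real M * real (Suc M))" by (intro frac_le) auto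
          also have "\<dots> = 1 / real M - 1 / real (Suc M)" using True N by (simp add: field_simps)
          finally show ?thesis .
        qed
      finally show ?thesis using True by (simp add: max_def)
    next
      case False
      hence "{N<..Suc M} = {}" by auto
      thus ?thesis using False by (simp add: max_def)
    qed
  qed simp
  also have "\<dots> \<le> 1 / real N" by simp
  finally show ?thesis .
qed

text \<open>
  Mertens' theorem, since \<open>ln ln\<close> varies slowly.
\<close>

lemma log_sum_diff_tendsto:
  fixes Y :: real
  assumes "Y > 1"
  shows "((\<lambda>X. log_sum (nat \<lfloor>X * Y\<rfloor>) - log_sum (nat \<lfloor>X / Y\<rfloor>)) \<longlongrightarrow> 0) at_top"
proof -
  have Y: "Y > 0" using assms by simp
  have f1: "filterlim (\<lambda>X. X * Y) at_top at_top"
  proof -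
    have "filterlim (\<lambda>X. Y * X) at_top at_top"
      by (rule filterlim_tendsto_pos_mult_at_top[OF tendsto_const Y]) (rule filterlim_ident)
    thus ?thesis by (simp add: mult.commute)
  qed
  have f2: "filterlim (\<lambda>X. X / Y) at_top at_top"
  proof -
    have "filterlim (\<lambda>X. 1 / Y * X) at_top at_top"
      by (rule filterlim_tendsto_pos_mult_at_top[OF tendsto_const]) (use Y in \<open>auto intro: filterlim_ident\<close>)
    thus ?thesis by simp
  qed
  define b where "b = ln Y"
  have "b > 0" using assms by (simp add: b_def)
  hence "((\<lambda>X::real. ln (ln X + b) - ln (ln X - b)) \<longlongrightarrow> 0) at_top" by real_asymp
  moreover have "eventually (\<lambda>X. ln (ln X + b) - ln (ln X - b) = ln (ln (X * Y)) - ln (ln (X / Y))) at_top"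
    using eventually_gt_at_top[of 0] by eventually_elim (use Y in \<open>simp add: b_def ln_mult ln_div\<close>)
  ultimately have "((\<lambda>X. ln (ln (X * Y)) - ln (ln (X / Y))) \<longlongrightarrow> 0) at_top" by (rule Lim_transform_eventually)
  from tendsto_add[OF tendsto_diff[OF filterlim_compose[OF mertens_log_sum f1] filterlim_compose[OF mertens_log_sum f2]] this]
  show ?thesis by (simp add: algebra_simps)
qed

text \<open>
  The weight differs from the sharp cutoff by at most \<open>3 n / X\<close> for \<open>n \<le> X\<close> and by \<open>3 X / n\<close> for \<open>n > X\<close>. With coefficients bounded
  by \<open>1\<close>, the terms \<open>n \<le> X / Y\<close> contribute \<open>3 / Y\<close> and the terms \<open>n > X Y\<close> at most \<open>6 / Y\<close>. In between the weights differ
  by at most \<open>3\<close>.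
\<close>

lemma unsmoothing_bound:
  assumes Y: "Y > 1" and X: "X \<ge> Y" and z: "(\<lambda>n. log_term (Complex 1 t) n * cutoff (ln X - ln (real n))) sums z"
  shows "cmod (z - (\<Sum>n\<le>nat \<lfloor>X\<rfloor>. log_term (Complex 1 t) n)) \<le> 9 / Y + 3 * (log_sum (nat \<lfloor>X * Y\<rfloor>) - log_sum (nat \<lfloor>X / Y\<rfloor>))"
proof -
  define N where "N = nat \<lfloor>X\<rfloor>"
  define p where "p = nat \<lfloor>X / Y\<rfloor>"
  define q where "q = nat \<lfloor>X * Y\<rfloor>"
  have X0: "X > 1" using X Y by simp
  have nN: "n \<le> N \<longleftrightarrow> real n \<le> X" for n unfolding N_def using X0 by (simp add: le_nat_iff le_floor_iff)
  have np: "n \<le> p \<longleftrightarrow> real n \<le> X / Y" for n unfolding p_def using X0 Y by (simp add: le_nat_iff le_floor_iff)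
  have nq: "n \<le> q \<longleftrightarrow> real n \<le> X * Y" for n unfolding q_def using X0 Y by (simp add: le_nat_iff le_floor_iff)
  have XY: "X / Y \<le> X * Y" "X * Y > 1" "X / Y \<ge> 1"
  proof -
    have "1 * 1 \<le> Y * Y" using Y by (intro mult_mono) auto
    hence "X * 1 \<le> X * (Y * Y)" using X0 by (intro mult_left_mono) auto
    thus "X / Y \<le> X * Y" using Y by (simp add: field_simps)
    show "X * Y > 1" using X0 Y by (metis less_1_mult)
    show "X / Y \<ge> 1" using X Y by simp
  qed
  have pq: "p \<le> q" using np[of p] nq[of p] XY by simp
  have q1: "q \<ge> 1" unfolding q_def using XY by linarith
  moreover have "real q > X * Y - 1" unfolding q_def using XY by linarith
  ultimately have q2: "real q \<ge> X * Y / 2" by linarith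
  define d where "d = (\<lambda>n. log_term (Complex 1 t) n * cutoff (ln X - ln (real n)) - (if n \<in> {..N} then log_term (Complex 1 t) n else 0))"
  have "(\<lambda>n. if n \<in> {..N} then log_term (Complex 1 t) n else 0) sums (\<Sum>n\<in>{..N}. log_term (Complex 1 t) n)"
    by (rule sums_If_finite_set) simp
  hence ds: "d sums (z - (\<Sum>n\<le>N. log_term (Complex 1 t) n))" unfolding d_def by (intro sums_diff z)
  have d1: "cmod (d n) \<le> log_coeff n / real n * (3 * (real n / X))" if n: "n \<le> N" for n
  proof (cases "n = 0")
    case False
    have "d n = log_term (Complex 1 t) n * (cutoff (ln X - ln (real n)) - 1)" using n by (simp add: d_def algebra_simps)
    also have "cmod \<dots> = log_coeff n / real n * cmod (cutoff (ln X - ln (real n)) - 1)" by (simp add: norm_mult norm_log_term_1)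
    also have "\<dots> \<le> log_coeff n / real n * (3 * exp (- (ln X - ln (real n))))"
      by (intro mult_left_mono norm_cutoff_minus_1_le divide_nonneg_nonneg log_coeff_nonneg) auto
    also have "exp (- (ln X - ln (real n))) = real n / X" using False X0 by (simp add: exp_diff)
    finally show ?thesis .
  qed (simp add: d_def log_term_def)
  have d2: "cmod (d n) \<le> log_coeff n / real n * (3 * (X / real n))" if n: "n > N" for n
  proof -
    have n0: "n > 0" using n by simp
    have "d n = log_term (Complex 1 t) n * cutoff (ln X - ln (real n))" using n by (simp add: d_def)
    also have "cmod \<dots> = log_coeff n / real n * cmod (cutoff (ln X - ln (real n)))" by (simp add: norm_mult norm_log_term_1)
    also have "\<dots> \<le> log_coeff n / real n * (3 * exp (ln X - ln (real n)))"
      by (intro mult_left_mono norm_cutoff_le divide_nonneg_nonneg log_coeff_nonneg) auto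
    also have "exp (ln X - ln (real n)) = X / real n" using n0 X0 by (simp add: exp_diff)
    finally show ?thesis .
  qed
  have partial: "(\<Sum>n\<le>M. cmod (d n)) \<le> 9 / Y + 3 * (log_sum q - log_sum p)" for M
  proof -
    have "(\<Sum>n\<le>M. cmod (d n)) \<le> (\<Sum>n\<in>{..p} \<union> {p<..q} \<union> {q<..M}. cmod (d n))"
      by (rule sum_mono2) auto
    also have "\<dots> = (\<Sum>n\<le>p. cmod (d n)) + (\<Sum>n\<in>{p<..q}. cmod (d n)) + (\<Sum>n\<in>{q<..M}. cmod (d n))"
      using pq by (subst sum.union_disjoint; (subst sum.union_disjoint)?) auto
    also have "(\<Sum>n\<le>p. cmod (d n)) \<le> 3 / Y"
    proof -
      have "(\<Sum>n\<le>p. cmod (d n)) = (\<Sum>n\<in>{1..p}. cmod (d n))"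
        by (rule sum.mono_neutral_right) (auto simp: d_def log_term_def not_less_eq_eq)
      also have "\<dots> \<le> (\<Sum>n\<in>{1..p}. 3 / X)"
      proof (rule sum_mono)
        fix n assume n: "n \<in> {1..p}"
        hence "n \<le> N" using np[of n] nN[of n] X0 Y by (simp add: divide_le_eq mult_left_le order_trans[of "real n" "X / Y" X])
        hence "cmod (d n) \<le> log_coeff n / real n * (3 * (real n / X))" by (rule d1)
        also have "\<dots> = log_coeff n * (3 / X)" using n by simp
        also have "\<dots> \<le> 1 * (3 / X)" using X0 by (intro mult_right_mono log_coeff_le_1) auto
        finally show "cmod (d n) \<le> 3 / X" by simp
      qed
      also have "\<dots> = real p * (3 / X)" by simp
      also have "\<dots> \<le> X / Y * (3 / X)" using np[of p] X0 by (intro mult_right_mono) auto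
      also have "\<dots> = 3 / Y" using X0 by simp
      finally show ?thesis .
    qed
    also have "(\<Sum>n\<in>{p<..q}. cmod (d n)) \<le> 3 * (log_sum q - log_sum p)"
    proof -
      have "(\<Sum>n\<in>{p<..q}. cmod (d n)) \<le> (\<Sum>n\<in>{p<..q}. 3 * (log_coeff n / real n))"
      proof (rule sum_mono)
        fix n assume n: "n \<in> {p<..q}"
        have lc: "log_coeff n / real n \<ge> 0" by (simp add: log_coeff_nonneg)
        show "cmod (d n) \<le> 3 * (log_coeff n / real n)"
        proof (cases "n \<le> N")
          case True
          hence "real n / X \<le> 1" using nN[of n] X0 by simp
          hence "3 * (real n / X) \<le> 3" by linarith
          hence "log_coeff n / real n * (3 * (real n / X)) \<le> log_coeff n / real n * 3" using lc by (intro mult_left_mono)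
          hence "cmod (d n) \<le> log_coeff n / real n * 3" by (rule order_trans[OF d1[OF True]])
          thus ?thesis by (simp only: mult.commute)
        next
          case False
          hence "X / real n \<le> 1" using nN[of n] X0 by (simp add: divide_le_eq_1)
          hence "3 * (X / real n) \<le> 3" by linarith
          hence "log_coeff n / real n * (3 * (X / real n)) \<le> log_coeff n / real n * 3" using lc by (intro mult_left_mono)
          hence "cmod (d n) \<le> log_coeff n / real n * 3" by (rule order_trans[OF d2, rotated]) (use False in simp)
          thus ?thesis by (simp only: mult.commute)
        qed
      qed
      also have "\<dots> = 3 * (log_sum q - log_sum p)"
      proof -
        have "{..q} = {..p} \<union> {p<..q}" using pq by auto
        hence "log_sum q = log_sum p + (\<Sum>n\<in>{p<..q}. log_coeff n / real n)"
          unfolding log_sum_def by (simp only:) (subst sum.union_disjoint, auto)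
        thus ?thesis by (simp add: sum_distrib_left)
      qed
      finally show ?thesis .
    qed
    also have "(\<Sum>n\<in>{q<..M}. cmod (d n)) \<le> 6 / Y"
    proof -
      have "(\<Sum>n\<in>{q<..M}. cmod (d n)) \<le> (\<Sum>n\<in>{q<..M}. 3 * X * (1 / (real n)\<^sup>2))"
      proof (rule sum_mono)
        fix n assume n: "n \<in> {q<..M}"
        have "X * 1 \<le> X * Y" using X0 Y by (intro mult_left_mono) auto
        moreover have "real N \<le> X" using nN[of N] by simp
        ultimately have "N \<le> q" unfolding nq by linarith
        hence "cmod (d n) \<le> log_coeff n / real n * (3 * (X / real n))" using n by (intro d2) auto
        also have "\<dots> \<le> 1 / real n * (3 * (X / real n))"
          using X0 by (intro mult_right_mono divide_right_mono log_coeff_le_1) auto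
        finally show "cmod (d n) \<le> 3 * X * (1 / (real n)\<^sup>2)" by (simp add: power2_eq_square)
      qed
      also have "\<dots> = 3 * X * (\<Sum>n\<in>{q<..M}. 1 / (real n)\<^sup>2)" by (rule sum_distrib_left[symmetric])
      also have "\<dots> \<le> 3 * X * (1 / real q)"
        using X0 by (intro mult_left_mono sum_inverse_squares_tail q1) auto
      also have "\<dots> \<le> 3 * X * (1 / (X * Y / 2))"
        using X0 XY q1 q2 by (intro mult_left_mono divide_left_mono mult_pos_pos) auto
      also have "\<dots> = 6 / Y" using X0 Y by simp
      finally show ?thesis .
    qed
    finally show ?thesis by simp
  qed
  have "(\<lambda>M. cmod (\<Sum>n\<le>M. d n)) \<longlonglongrightarrow> cmod (z - (\<Sum>n\<le>N. log_term (Complex 1 t) n))"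
    using ds unfolding sums_def_le by (rule tendsto_norm)
  moreover have "cmod (\<Sum>n\<le>M. d n) \<le> 9 / Y + 3 * (log_sum q - log_sum p)" for M
    by (rule order_trans[OF norm_sum partial])
  ultimately have "cmod (z - (\<Sum>n\<le>N. log_term (Complex 1 t) n)) \<le> 9 / Y + 3 * (log_sum q - log_sum p)"
    by (intro LIMSEQ_le_const2) auto
  thus ?thesis unfolding N_def p_def q_def .
qed

lemma unsmoothing:
  assumes e: "\<epsilon> > 0"
  shows "\<exists>X0. \<forall>X\<ge>X0. \<forall>t z. (\<lambda>n. log_term (Complex 1 t) n * cutoff (ln X - ln (real n))) sums z \<longrightarrow>
     cmod (z - (\<Sum>n\<le>nat \<lfloor>X\<rfloor>. log_term (Complex 1 t) n)) \<le> \<epsilon>"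
proof -
  \<comment> \<open>makes \<open>9 / Y\<close> at most \<open>\<epsilon> / 2\<close>\<close>
  define Y where "Y = 18 / \<epsilon> + 2"
  have Y: "Y > 1" "9 / Y \<le> \<epsilon> / 2" using e by (auto simp: Y_def field_simps)
  have "eventually (\<lambda>X. log_sum (nat \<lfloor>X * Y\<rfloor>) - log_sum (nat \<lfloor>X / Y\<rfloor>) < \<epsilon> / 6) at_top"
    by (rule order_tendstoD(2)[OF log_sum_diff_tendsto[OF Y(1)]]) (use e in simp)
  then obtain X1 where X1: "\<And>X. X \<ge> X1 \<Longrightarrow> log_sum (nat \<lfloor>X * Y\<rfloor>) - log_sum (nat \<lfloor>X / Y\<rfloor>) < \<epsilon> / 6"
    by (auto simp: eventually_at_top_linorder)
  show ?thesis
  proof (intro exI[of _ "max X1 Y"] allI impI)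
    fix X t z assume X: "X \<ge> max X1 Y" and z: "(\<lambda>n. log_term (Complex 1 t) n * cutoff (ln X - ln (real n))) sums z"
    have "cmod (z - (\<Sum>n\<le>nat \<lfloor>X\<rfloor>. log_term (Complex 1 t) n)) \<le> 9 / Y + 3 * (log_sum (nat \<lfloor>X * Y\<rfloor>) - log_sum (nat \<lfloor>X / Y\<rfloor>))"
      by (rule unsmoothing_bound[OF Y(1) _ z]) (use X in simp)
    thus "cmod (z - (\<Sum>n\<le>nat \<lfloor>X\<rfloor>. log_term (Complex 1 t) n)) \<le> \<epsilon>" using X1[of X] X Y(2) by simp
  qed
qed

text \<open>
  The smoothed estimate at \<open>y = ln X\<close>, with the weights removed. The main error \<open>L / \<surd>X\<close> makes \<open>L\<^sup>2\<close> the
  threshold for \<open>X\<close>.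
\<close>

theorem log_zeta_approximation:
  assumes rh: "riemann_hypothesis" and C: "C > 0"
  shows "\<exists>C1>0. \<forall>\<epsilon>>0. \<exists>X0\<ge>3. eventually (\<lambda>t. 0 \<le> L C t \<and> (\<forall>X\<ge>X0.
     cmod (log_zeta (Complex 1 t) - (\<Sum>n\<le>nat \<lfloor>X\<rfloor>. log_term (Complex 1 t) n)) \<le> C1 * ((1 + L C t) / sqrt X) + \<epsilon>)) at_top"
proof -
  obtain C1 E where C1: "C1 > 0" and E: "(E \<longlongrightarrow> 0) at_top" and ev: "eventually (\<lambda>t. 0 \<le> L C t \<and> (\<forall>y\<ge>1. \<exists>z.
     (\<lambda>n. log_term (Complex 1 t) n * cutoff (y - ln (real n))) sums z \<and>
     cmod (z - log_zeta (Complex 1 t)) \<le> C1 * exp (- (y / 2)) * (1 + L C t) + E t)) at_top"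
    using smoothed_estimate[OF rh C] by blast
  show ?thesis
  proof (rule exI[of _ C1], intro conjI allI impI C1)
    fix \<epsilon> :: real assume e: "\<epsilon> > 0"
    obtain X1 where X1: "\<And>X t z. X \<ge> X1 \<Longrightarrow> (\<lambda>n. log_term (Complex 1 t) n * cutoff (ln X - ln (real n))) sums z \<Longrightarrow>
     cmod (z - (\<Sum>n\<le>nat \<lfloor>X\<rfloor>. log_term (Complex 1 t) n)) \<le> \<epsilon> / 2"
      using unsmoothing[of "\<epsilon> / 2"] e by auto
    have "eventually (\<lambda>t. E t < \<epsilon> / 2) at_top" by (rule order_tendstoD(2)[OF E]) (use e in simp)
    with ev have "eventually (\<lambda>t. 0 \<le> L C t \<and> (\<forall>X\<ge>max X1 3.
     cmod (log_zeta (Complex 1 t) - (\<Sum>n\<le>nat \<lfloor>X\<rfloor>. log_term (Complex 1 t) n)) \<le> C1 * ((1 + L C t) / sqrt X) + \<epsilon>)) at_top"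
    proof eventually_elim
      case (elim t)
      have "cmod (log_zeta (Complex 1 t) - (\<Sum>n\<le>nat \<lfloor>X\<rfloor>. log_term (Complex 1 t) n)) \<le> C1 * ((1 + L C t) / sqrt X) + \<epsilon>" if X: "X \<ge> max X1 3" for X
      proof -
        have "exp 1 \<le> X" using X exp_le by simp
        hence y: "ln X \<ge> 1" using X by (subst ln_ge_iff) auto
        then obtain z where z: "(\<lambda>n. log_term (Complex 1 t) n * cutoff (ln X - ln (real n))) sums z"
          "cmod (z - log_zeta (Complex 1 t)) \<le> C1 * exp (- (ln X / 2)) * (1 + L C t) + E t"
          using elim by blast
        have "exp (- (ln X / 2)) = 1 / sqrt X"
          using X by (simp add: exp_minus inverse_eq_divide ln_sqrt[symmetric])
        hence "cmod (log_zeta (Complex 1 t) - z) \<le> C1 * ((1 + L C t) / sqrt X) + E t" using z(2) by (simp add: norm_minus_commute)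
        moreover have "cmod (z - (\<Sum>n\<le>nat \<lfloor>X\<rfloor>. log_term (Complex 1 t) n)) \<le> \<epsilon> / 2" using X1[OF _ z(1)] X by simp
        moreover have "cmod (log_zeta (Complex 1 t) - (\<Sum>n\<le>nat \<lfloor>X\<rfloor>. log_term (Complex 1 t) n)) \<le>
            cmod (log_zeta (Complex 1 t) - z) + cmod (z - (\<Sum>n\<le>nat \<lfloor>X\<rfloor>. log_term (Complex 1 t) n))"
          by (rule order_trans[OF _ norm_triangle_ineq]) simp
        ultimately show ?thesis using elim by simp
      qed
      thus ?case using elim by blast
    qed
    thus "\<exists>X0\<ge>3. eventually (\<lambda>t. 0 \<le> L C t \<and> (\<forall>X\<ge>X0.
     cmod (log_zeta (Complex 1 t) - (\<Sum>n\<le>nat \<lfloor>X\<rfloor>. log_term (Complex 1 t) n)) \<le> C1 * ((1 + L C t) / sqrt X) + \<epsilon>)) at_top"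
      by (intro exI[of _ "max X1 3"] conjI) auto
  qed
qed

section \<open>Approximation of zeta by the Euler product\<close>

lemma eventually_L_nonneg:
  assumes "riemann_hypothesis" "C > 0"
  shows "eventually (\<lambda>t. 0 \<le> L C t) at_top"
proof -
  obtain C1 :: real where "\<forall>\<epsilon>>0. \<exists>X0\<ge>3. eventually (\<lambda>t. 0 \<le> L C t \<and> (\<forall>X\<ge>X0.
     cmod (log_zeta (Complex 1 t) - (\<Sum>n\<le>nat \<lfloor>X\<rfloor>. log_term (Complex 1 t) n)) \<le> C1 * ((1 + L C t) / sqrt X) + \<epsilon>)) at_top"
    using log_zeta_approximation[OF assms] by blast
  hence "\<exists>X0\<ge>(3::real). eventually (\<lambda>t. 0 \<le> L C t \<and> (\<forall>X\<ge>X0.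
     cmod (log_zeta (Complex 1 t) - (\<Sum>n\<le>nat \<lfloor>X\<rfloor>. log_term (Complex 1 t) n)) \<le> C1 * ((1 + L C t) / sqrt X) + 1)) at_top"
    by (rule allE[of _ 1]) simp
  thus ?thesis by (auto elim: eventually_mono)
qed

lemma log_zeta_sum_tendsto:
  assumes rh: "riemann_hypothesis" and C: "C > 0"
    and X: "filterlim X at_top at_top" and LX: "((\<lambda>t. (1 + L C t) / sqrt (X t)) \<longlongrightarrow> 0) at_top"
  shows "((\<lambda>t. log_zeta (Complex 1 t) - (\<Sum>n\<le>nat \<lfloor>X t\<rfloor>. log_term (Complex 1 t) n)) \<longlongrightarrow> 0) at_top"
proof (rule tendstoI)
  fix e :: real assume e: "e > 0"
  obtain C1 where C1: "C1 > 0" "\<And>\<epsilon>. \<epsilon> > 0 \<Longrightarrow> \<exists>X0\<ge>3. eventually (\<lambda>t. 0 \<le> L C t \<and> (\<forall>X\<ge>X0.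
     cmod (log_zeta (Complex 1 t) - (\<Sum>n\<le>nat \<lfloor>X\<rfloor>. log_term (Complex 1 t) n)) \<le> C1 * ((1 + L C t) / sqrt X) + \<epsilon>)) at_top"
    using log_zeta_approximation[OF rh C] by blast
  obtain X0 where X0: "eventually (\<lambda>t. 0 \<le> L C t \<and> (\<forall>X\<ge>X0.
     cmod (log_zeta (Complex 1 t) - (\<Sum>n\<le>nat \<lfloor>X\<rfloor>. log_term (Complex 1 t) n)) \<le> C1 * ((1 + L C t) / sqrt X) + e / 2)) at_top"
    using C1(2)[of "e / 2"] e by auto
  have "((\<lambda>t. C1 * ((1 + L C t) / sqrt (X t))) \<longlongrightarrow> C1 * 0) at_top" by (intro tendsto_mult_left LX)
  hence "eventually (\<lambda>t. C1 * ((1 + L C t) / sqrt (X t)) < e / 2) at_top"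
    by (rule order_tendstoD(2)) (use e in simp)
  moreover have "eventually (\<lambda>t. X t \<ge> X0) at_top" using X by (simp add: filterlim_at_top)
  ultimately show "eventually (\<lambda>t. dist (log_zeta (Complex 1 t) - (\<Sum>n\<le>nat \<lfloor>X t\<rfloor>. log_term (Complex 1 t) n)) 0 < e) at_top"
    using X0
  proof eventually_elim
    case (elim t)
    have "cmod (log_zeta (Complex 1 t) - (\<Sum>n\<le>nat \<lfloor>X t\<rfloor>. log_term (Complex 1 t) n)) \<le> C1 * ((1 + L C t) / sqrt (X t)) + e / 2"
      using elim by blast
    also have "\<dots> < e" using elim(1) by linarith
    finally show ?case by (simp add: dist_norm)
  qed
qed

lemma zeta_eq_exp_log_zeta:
  assumes "riemann_hypothesis" "t \<noteq> 0"
  shows "zeta (Complex 1 t) = exp (log_zeta (Complex 1 t))"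
  using exp_log_zeta[OF assms(1), of "Complex 1 t"] assms(2) by (simp add: complex_eq_iff)

lemma growth_conditions:
  assumes rh: "riemann_hypothesis" and C: "C > 0" and X0: "eventually (\<lambda>t. X t > 0) at_top"
    and o: "(\<lambda>t. max ((L C t)\<^sup>2) (ln t)) \<in> o[at_top](X)"
  shows "filterlim X at_top at_top" and "((\<lambda>t. (1 + L C t) / sqrt (X t)) \<longlongrightarrow> 0) at_top"
proof -
  have small: "eventually (\<lambda>t. (L C t)\<^sup>2 \<le> c * X t \<and> ln t \<le> c * X t) at_top" if c: "c > 0" for c
    using landau_o.smallD[OF o c] X0
  proof eventually_elim
    case (elim t)
    have "max ((L C t)\<^sup>2) (ln t) \<le> norm (max ((L C t)\<^sup>2) (ln t))"
      unfolding real_norm_def by (rule abs_ge_self)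
    also have "\<dots> \<le> c * norm (X t)" by (rule elim(1))
    finally have "max ((L C t)\<^sup>2) (ln t) \<le> c * X t" using elim(2) by simp
    thus ?case unfolding max.bounded_iff .
  qed
  have "eventually (\<lambda>t. ln t \<le> X t) at_top" using small[of 1] by (auto elim: eventually_mono)
  thus "filterlim X at_top at_top" by (rule filterlim_at_top_mono[OF ln_at_top])
  show "((\<lambda>t. (1 + L C t) / sqrt (X t)) \<longlongrightarrow> 0) at_top"
  proof (rule tendstoI)
    fix e :: real assume e: "e > 0"
    define c where "c = e\<^sup>2 / 8"
    have c: "c > 0" using e by (simp add: c_def)
    have "eventually (\<lambda>t::real. ln t \<ge> 1) at_top" by real_asymp
    with small[OF c] X0 eventually_L_nonneg[OF rh C]
    show "eventually (\<lambda>t. dist ((1 + L C t) / sqrt (X t)) 0 < e) at_top"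
    proof eventually_elim
      case (elim t)
      have "0 \<le> (1 - L C t)\<^sup>2" by simp
      hence "(1 + L C t)\<^sup>2 \<le> 2 * (1 + (L C t)\<^sup>2)" by (simp add: power2_eq_square algebra_simps)
      also have "\<dots> \<le> 4 * (c * X t)" using elim by simp
      also have "\<dots> < e\<^sup>2 * X t" using e elim by (simp add: c_def)
      finally have "(1 + L C t)\<^sup>2 < (e * sqrt (X t))\<^sup>2" using elim by (simp add: power_mult_distrib)
      hence "1 + L C t < e * sqrt (X t)" by (rule power2_less_imp_less) (use e elim in auto)
      thus ?case using elim by (simp add: dist_norm field_simps)
    qed
  qed
qed

text \<open>
  Both sides are exponentials, and the exponents differ from the same Dirichlet polynomial by \<open>o(1)\<close>.
\<close>

theorem zeta_asymp_euler_prod: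
  assumes rh: "riemann_hypothesis" and C: "C > 0" and X0: "eventually (\<lambda>t. X t > 0) at_top"
    and o: "(\<lambda>t. max ((L C t)\<^sup>2) (ln t)) \<in> o[at_top](X)"
  shows "(\<lambda>t. zeta (Complex 1 t)) \<sim>[at_top] (\<lambda>t. euler_prod (X t) (Complex 1 t))"
proof (rule asymp_equivI')
  note X = growth_conditions[OF assms]
  obtain \<tau> where \<tau>: "(\<tau> \<longlongrightarrow> 0) at_top" "\<And>X t. X \<ge> 0 \<Longrightarrow>
     \<exists>G. euler_prod X (Complex 1 t) = exp G \<and> cmod (G - (\<Sum>n\<le>nat \<lfloor>X\<rfloor>. log_term (Complex 1 t) n)) \<le> \<tau> X"
    using euler_prod_log_approx by blast
  define G where "G = (\<lambda>t. SOME G. euler_prod (X t) (Complex 1 t) = exp G \<and> cmod (G - (\<Sum>n\<le>nat \<lfloor>X t\<rfloor>. log_term (Complex 1 t) n)) \<le> \<tau> (X t))"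
  have G: "euler_prod (X t) (Complex 1 t) = exp (G t) \<and> cmod (G t - (\<Sum>n\<le>nat \<lfloor>X t\<rfloor>. log_term (Complex 1 t) n)) \<le> \<tau> (X t)" if "X t > 0" for t
    unfolding G_def by (rule someI_ex, rule \<tau>(2)) (use that in simp)
  have "((\<lambda>t. G t - (\<Sum>n\<le>nat \<lfloor>X t\<rfloor>. log_term (Complex 1 t) n)) \<longlongrightarrow> 0) at_top"
    by (rule Lim_null_comparison[OF _ filterlim_compose[OF \<tau>(1) X(1)]])
       (use X0 G in \<open>auto elim: eventually_mono\<close>)
  from tendsto_diff[OF log_zeta_sum_tendsto[OF rh C X] this]
  have "((\<lambda>t. exp (log_zeta (Complex 1 t) - G t)) \<longlongrightarrow> exp 0) at_top"
    by (intro tendsto_exp) simp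
  hence lim: "((\<lambda>t. exp (log_zeta (Complex 1 t) - G t)) \<longlongrightarrow> 1) at_top" by simp
  show "((\<lambda>t. zeta (Complex 1 t) / euler_prod (X t) (Complex 1 t)) \<longlongrightarrow> 1) at_top"
  proof (rule Lim_transform_eventually[OF lim])
    show "eventually (\<lambda>t. exp (log_zeta (Complex 1 t) - G t) = zeta (Complex 1 t) / euler_prod (X t) (Complex 1 t)) at_top"
      using X0 eventually_gt_at_top[of 0]
      by eventually_elim (use G zeta_eq_exp_log_zeta[OF rh] in \<open>simp add: exp_diff\<close>)
  qed
qed

section \<open>The upper bound\<close>

lemma Re_sum_log_term_le: "Re (\<Sum>n\<le>N. log_term (Complex 1 t) n) \<le> log_sum N"
  unfolding log_sum_def Re_sum
  by (intro sum_mono order_trans[OF complex_Re_le_cmod]) (simp add: norm_log_term_1)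

text \<open>
  The choice \<open>X = M ln M\<close> with \<open>M = L\<^sup>2 + ln t\<close> is beyond the threshold, yet \<open>ln ln X - ln ln M\<close> tends to \<open>0\<close>. Every term is
  bounded by its absolute value, and Mertens' theorem gives the sum.
\<close>

theorem zeta_upper_bound:
  assumes rh: "riemann_hypothesis" and C: "C > 0"
  shows "\<exists>\<epsilon>::real \<Rightarrow> real. (\<epsilon> \<longlongrightarrow> 0) at_top \<and>
     (\<forall>\<^sub>F t in at_top. cmod (zeta (Complex 1 t)) \<le> exp euler_mascheroni * (1 + \<epsilon> t) * ln ((L C t)\<^sup>2 + ln t))"
proof -
  define M where "M = (\<lambda>t. (L C t)\<^sup>2 + ln t)"
  have M: "filterlim M at_top at_top"
    by (rule filterlim_at_top_mono[OF ln_at_top]) (simp add: M_def)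
  define X where "X = (\<lambda>t. M t * ln (M t))"
  have X: "filterlim X at_top at_top"
  proof -
    have "filterlim (\<lambda>m::real. m * ln m) at_top at_top" by real_asymp
    from filterlim_compose[OF this M] show ?thesis by (simp add: X_def)
  qed
  have LX: "((\<lambda>t. (1 + L C t) / sqrt (X t)) \<longlongrightarrow> 0) at_top"
  proof (rule Lim_null_comparison)
    have "((\<lambda>m::real. 2 / sqrt (ln m)) \<longlongrightarrow> 0) at_top" by real_asymp
    from filterlim_compose[OF this M] show "((\<lambda>t. 2 / sqrt (ln (M t))) \<longlongrightarrow> 0) at_top" .
    have "eventually (\<lambda>t::real. ln t \<ge> 1) at_top" by real_asymp
    moreover have "eventually (\<lambda>t. M t > 1) at_top" using M by (simp add: filterlim_at_top_dense)
    ultimately show "eventually (\<lambda>t. norm ((1 + L C t) / sqrt (X t)) \<le> 2 / sqrt (ln (M t))) at_top"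
      using eventually_L_nonneg[OF rh C]
    proof eventually_elim
      case (elim t)
      have "0 \<le> (1 - L C t)\<^sup>2" by simp
      hence "(1 + L C t)\<^sup>2 \<le> 2 * (1 + (L C t)\<^sup>2)" by (simp add: power2_eq_square algebra_simps)
      also have "\<dots> \<le> (2 * sqrt (M t))\<^sup>2" using elim by (simp add: power_mult_distrib M_def)
      finally have "1 + L C t \<le> 2 * sqrt (M t)" by (rule power2_le_imp_le) (use elim in auto)
      hence "(1 + L C t) / sqrt (X t) \<le> 2 * sqrt (M t) / sqrt (X t)" by (intro divide_right_mono) (use elim in \<open>auto simp: X_def\<close>)
      also have "\<dots> = 2 / sqrt (ln (M t))" using elim by (simp add: X_def real_sqrt_mult)
      finally show ?case using elim by (simp add: X_def)
    qed
  qed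
  define D where "D = (\<lambda>t. log_zeta (Complex 1 t) - (\<Sum>n\<le>nat \<lfloor>X t\<rfloor>. log_term (Complex 1 t) n))"
  have D: "(D \<longlongrightarrow> 0) at_top" unfolding D_def by (rule log_zeta_sum_tendsto[OF rh C X LX])
  define r where "r = (\<lambda>t. cmod (D t) + (log_sum (nat \<lfloor>X t\<rfloor>) - ln (ln (X t)) - euler_mascheroni) + (ln (ln (X t)) - ln (ln (M t))))"
  have "((\<lambda>m::real. ln (ln (m * ln m)) - ln (ln m)) \<longlongrightarrow> 0) at_top" by real_asymp
  from filterlim_compose[OF this M] have l3: "((\<lambda>t. ln (ln (X t)) - ln (ln (M t))) \<longlongrightarrow> 0) at_top" by (simp add: X_def)
  have l2: "((\<lambda>t. log_sum (nat \<lfloor>X t\<rfloor>) - ln (ln (X t)) - euler_mascheroni) \<longlongrightarrow> euler_mascheroni - euler_mascheroni) at_top"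
    by (intro tendsto_diff tendsto_const filterlim_compose[OF mertens_log_sum X])
  have "(r \<longlongrightarrow> 0 + (euler_mascheroni - euler_mascheroni) + 0) at_top"
    unfolding r_def by (intro tendsto_add l2 l3 tendsto_norm_zero D)
  hence "((\<lambda>t. exp (r t) - 1) \<longlongrightarrow> exp 0 - 1) at_top" by (intro tendsto_intros) simp
  hence e: "((\<lambda>t. exp (r t) - 1) \<longlongrightarrow> 0) at_top" by simp
  have "eventually (\<lambda>t. M t > 1) at_top" using M by (simp add: filterlim_at_top_dense)
  hence "eventually (\<lambda>t. cmod (zeta (Complex 1 t)) \<le> exp euler_mascheroni * (1 + (exp (r t) - 1)) * ln (M t)) at_top"
    using eventually_gt_at_top[of 0]
  proof eventually_elim
    case (elim t)
    have "Re (log_zeta (Complex 1 t)) = Re (D t) + Re (\<Sum>n\<le>nat \<lfloor>X t\<rfloor>. log_term (Complex 1 t) n)" by (simp add: D_def)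
    also have "\<dots> \<le> cmod (D t) + log_sum (nat \<lfloor>X t\<rfloor>)" by (intro add_mono complex_Re_le_cmod Re_sum_log_term_le)
    also have "\<dots> = euler_mascheroni + r t + ln (ln (M t))" by (simp add: r_def)
    finally have "exp (Re (log_zeta (Complex 1 t))) \<le> exp (euler_mascheroni + r t + ln (ln (M t)))" by simp
    also have "\<dots> = exp euler_mascheroni * exp (r t) * ln (M t)" using elim by (simp add: exp_add)
    finally show ?case using zeta_eq_exp_log_zeta[OF rh, of t] elim by simp
  qed
  with e show ?thesis unfolding M_def by blast
qed

section \<open>The consequence of the growth hypothesis on \<open>S\<close>\<close>

lemma S_growth:
  assumes "Limsup at_top S_exponent = ereal (1/2)" and e: "e > 0"
  shows "eventually (\<lambda>u. \<bar>S u\<bar> \<le> ln u powr (1/2 + e)) at_top"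
proof -
  have "eventually (\<lambda>u. S_exponent u < ereal (1/2 + e)) at_top"
    by (rule Limsup_lessD) (use assms in simp)
  moreover have "eventually (\<lambda>u::real. ln (ln u) > 0) at_top" by real_asymp
  moreover have "eventually (\<lambda>u::real. ln u > 0) at_top" by real_asymp
  ultimately show ?thesis
  proof eventually_elim
    case (elim u)
    show ?case
    proof (cases "S u = 0")
      case False
      hence "ln \<bar>S u\<bar> / ln (ln u) < 1/2 + e" using elim by (simp add: S_exponent_def)
      hence "ln \<bar>S u\<bar> < (1/2 + e) * ln (ln u)" using elim by (simp add: divide_less_eq)
      hence "exp (ln \<bar>S u\<bar>) < exp ((1/2 + e) * ln (ln u))" by simp
      thus ?thesis using False elim by (simp add: powr_def)
    qed simp
  qed
qed

lemma L_growth: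
  assumes lim: "Limsup at_top S_exponent = ereal (1/2)" and e: "e > 0"
  shows "eventually (\<lambda>t. L 1 t \<le> ln (2 * t) powr (1/2 + e)) at_top"
proof -
  obtain u0 where u0: "\<And>u. u \<ge> u0 \<Longrightarrow> \<bar>S u\<bar> \<le> ln u powr (1/2 + e)"
    using S_growth[OF assms] by (auto simp: eventually_at_top_linorder)
  have "eventually (\<lambda>t::real. ln (ln t) \<ge> 0) at_top" by real_asymp
  moreover have "eventually (\<lambda>t::real. t - ln (ln t) \<ge> max u0 1) at_top" by real_asymp
  moreover have "eventually (\<lambda>t::real. t + ln (ln t) \<le> 2 * t) at_top" by real_asymp
  ultimately show ?thesis
  proof eventually_elim
    case (elim t)
    show ?case unfolding L_def
    proof (rule cSUP_least)
      show "{u. \<bar>u - t\<bar> \<le> 1 * ln (ln t)} \<noteq> {}" using elim by (auto intro!: exI[of _ t])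
      fix u assume "u \<in> {u. \<bar>u - t\<bar> \<le> 1 * ln (ln t)}"
      hence u: "u \<ge> u0" "u \<ge> 1" "u \<le> 2 * t" using elim by (auto simp: abs_le_iff)
      have "\<bar>S u\<bar> \<le> ln u powr (1/2 + e)" by (rule u0[OF u(1)])
      also have "\<dots> \<le> ln (2 * t) powr (1/2 + e)" using u e by (intro powr_mono2 ln_mono) auto
      finally show "\<bar>S u\<bar> \<le> ln (2 * t) powr (1/2 + e)" .
    qed
  qed
qed

lemma zeta_line_upper:
  assumes rh: "riemann_hypothesis" and lim: "Limsup at_top S_exponent = ereal (1/2)" and d: "d > 0"
  shows "eventually (\<lambda>t. cmod (zeta (Complex 1 t)) \<le> exp euler_mascheroni * (1 + d) * ln (ln t)) at_top"
proof -
  obtain \<epsilon> where \<epsilon>: "(\<epsilon> \<longlongrightarrow> 0) at_top"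
    "\<forall>\<^sub>F t in at_top. cmod (zeta (Complex 1 t)) \<le> exp euler_mascheroni * (1 + \<epsilon> t) * ln ((L 1 t)\<^sup>2 + ln t)"
    using zeta_upper_bound[OF rh, of 1] by auto
  define e where "e = min 1 d / 8"
  have e: "e > 0" "4 * e \<le> d / 2" "4 * e \<le> 1 / 2" using d by (auto simp: e_def)
  have "eventually (\<lambda>t. \<epsilon> t < e) at_top" by (rule order_tendstoD(2)[OF \<epsilon>(1) e(1)])
  moreover have "eventually (\<lambda>t. \<epsilon> t > -1) at_top" by (rule order_tendstoD(1)[OF \<epsilon>(1)]) simp
  moreover have "eventually (\<lambda>t::real. ln 2 + (1 + 2 * e) * ln (ln (2 * t)) \<le> (1 + 3 * e) * ln (ln t)) at_top"
  proof -
    have "((\<lambda>t::real. (ln 2 + (1 + 2 * e) * ln (ln (2 * t))) / ln (ln t)) \<longlongrightarrow> 1 + 2 * e) at_top" by real_asymp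
    hence "eventually (\<lambda>t::real. (ln 2 + (1 + 2 * e) * ln (ln (2 * t))) / ln (ln t) < 1 + 3 * e) at_top"
      by (rule order_tendstoD(2)) (use e in simp)
    moreover have "eventually (\<lambda>t::real. ln (ln t) > 0) at_top" by real_asymp
    ultimately show ?thesis by eventually_elim (simp add: divide_less_eq)
  qed
  moreover have "eventually (\<lambda>t::real. ln t \<ge> 1) at_top" by real_asymp
  ultimately show ?thesis
    using \<epsilon>(2) L_growth[OF lim e(1)] eventually_L_nonneg[OF rh zero_less_one] eventually_gt_at_top[of 0]
  proof eventually_elim
    case (elim t)
    have l2: "ln (2 * t) \<ge> 1" "ln t \<le> ln (2 * t)"
    proof -
      show "ln t \<le> ln (2 * t)" using elim(8) by (intro ln_mono) auto
      thus "ln (2 * t) \<ge> 1" using elim(4) by linarith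
    qed
    have "(L 1 t)\<^sup>2 \<le> (ln (2 * t) powr (1/2 + e))\<^sup>2" using elim by (intro power_mono) auto
    also have "\<dots> = ln (2 * t) powr (1 + 2 * e)" by (simp add: power2_eq_square powr_add[symmetric])
    finally have 1: "(L 1 t)\<^sup>2 \<le> ln (2 * t) powr (1 + 2 * e)" .
    have "ln t \<le> ln (2 * t) powr 1" using l2 by simp
    also have "\<dots> \<le> ln (2 * t) powr (1 + 2 * e)" using l2 e by (intro powr_mono) auto
    finally have "(L 1 t)\<^sup>2 + ln t \<le> 2 * ln (2 * t) powr (1 + 2 * e)" using 1 by simp
    hence "ln ((L 1 t)\<^sup>2 + ln t) \<le> ln (2 * ln (2 * t) powr (1 + 2 * e))" using elim(4) by (intro ln_mono add_nonneg_pos) auto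
    also have "\<dots> = ln 2 + (1 + 2 * e) * ln (ln (2 * t))" using l2 by (subst ln_mult) (auto simp: ln_powr)
    also have "\<dots> \<le> (1 + 3 * e) * ln (ln t)" by (rule elim(3))
    finally have 2: "ln ((L 1 t)\<^sup>2 + ln t) \<le> (1 + 3 * e) * ln (ln t)" .
    have ll: "ln (ln t) \<ge> 0" using elim(4) by simp
    have "exp euler_mascheroni * (1 + \<epsilon> t) * ln ((L 1 t)\<^sup>2 + ln t) \<le> exp euler_mascheroni * (1 + \<epsilon> t) * ((1 + 3 * e) * ln (ln t))"
      using elim by (intro mult_left_mono 2) auto
    also have "\<dots> \<le> exp euler_mascheroni * (1 + e) * ((1 + 3 * e) * ln (ln t))"
      using elim e ll by (intro mult_right_mono mult_left_mono) auto
    also have "\<dots> = exp euler_mascheroni * ((1 + e) * (1 + 3 * e)) * ln (ln t)" by simp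
    also have "\<dots> \<le> exp euler_mascheroni * (1 + d) * ln (ln t)"
    proof (intro mult_right_mono mult_left_mono ll)
      have "(1 + e) * (1 + 3 * e) = 1 + 4 * e + 3 * (e * e)" by (simp add: algebra_simps)
      also have "e * e \<le> e * (1/8)" using e by (intro mult_left_mono) auto
      finally show "(1 + e) * (1 + 3 * e) \<le> 1 + d" using e by simp
    qed auto
    finally show ?case using elim(5) by linarith
  qed
qed

lemma one_minus_cos_le: "1 - cos x \<le> \<bar>x\<bar>" for x :: real
proof -
  have "1 - cos x = 2 * (sin (x / 2))\<^sup>2" using cos_double_sin[of "x / 2"] by simp
  also have "(sin (x / 2))\<^sup>2 = \<bar>sin (x / 2)\<bar> * \<bar>sin (x / 2)\<bar>" by (simp add: power2_eq_square)
  also have "\<dots> \<le> 1 * \<bar>x / 2\<bar>" by (intro mult_mono abs_sin_x_le_abs_x) auto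
  finally show ?thesis by simp
qed

lemma log_sum_mono: "N \<le> M \<Longrightarrow> log_sum N \<le> log_sum M"
  unfolding log_sum_def by (intro sum_mono2) (auto simp: log_coeff_nonneg)

lemma log_sum_nonneg: "log_sum N \<ge> 0"
  unfolding log_sum_def by (intro sum_nonneg) (auto simp: log_coeff_nonneg)

text \<open>
  Dirichlet's theorem on simultaneous approximation, applied to the numbers \<open>R ln n / (2\<pi>)\<close>, gives a multiple \<open>t = q R\<close> with
  \<open>q \<le> R\<close> for which all \<open>n\<^sup>i\<^sup>t\<close> with \<open>n \<le> n0\<close> are close to \<open>1\<close>. The remaining terms are bounded by their absolute values.
\<close>

lemma dirichlet_large_sum:
  assumes N: "N > 0" and R: "R > 0" "real (N ^ n0) \<le> R"
  shows "\<exists>t. R \<le> t \<and> t \<le> R * R \<and> (\<forall>K\<ge>n0. Re (\<Sum>n\<le>K. log_term (Complex 1 t) n) \<ge> log_sum n0 * (2 - 2 * pi / real N) - log_sum K)"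
proof -
  obtain q p where q: "0 < q" "q \<le> int (N ^ n0)"
    and qp: "\<And>i. i < n0 \<Longrightarrow> \<bar>of_int q * (R * ln (real (Suc i)) / (2 * pi)) - of_int (p i)\<bar> < 1 / N"
    using Dirichlet_approx_simult[OF N, of n0 "\<lambda>i. R * ln (real (Suc i)) / (2 * pi)"] by blast
  define t where "t = of_int q * R"
  have q1: "1 \<le> real_of_int q" using q by simp
  have q2: "real_of_int q \<le> R"
  proof -
    have "real_of_int q \<le> real_of_int (int (N ^ n0))" using q(2) by (simp only: of_int_le_iff)
    also have "\<dots> = real (N ^ n0)" by (rule of_int_of_nat_eq)
    finally show ?thesis using R by linarith
  qed
  have t: "R \<le> t" "t \<le> R * R" unfolding t_def using q1 q2 R mult_right_mono[of 1 "real_of_int q" R] by (auto intro: mult_right_mono)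
  have cosn: "cos (t * ln (real n)) \<ge> 1 - 2 * pi / N" if n: "n \<ge> 1" "n \<le> n0" for n
  proof -
    obtain i where i: "n = Suc i" "i < n0" using n by (cases n) auto
    define x where "x = 2 * pi * (of_int q * (R * ln (real (Suc i)) / (2 * pi)) - of_int (p i))"
    have "t * ln (real n) = x + 2 * pi * of_int (p i)" by (simp add: x_def t_def i algebra_simps)
    hence "cos (t * ln (real n)) = cos x"
      by (simp add: cos_add cos_int_2pin sin_int_2pin)
    moreover have "\<bar>x\<bar> \<le> 2 * pi * (1 / N)"
      unfolding x_def abs_mult using qp[OF i(2)] by (intro mult_mono) auto
    ultimately show ?thesis using one_minus_cos_le[of x] by simp
  qed
  have Re1: "Re (log_term (Complex 1 t) n) = log_coeff n / real n * cos (t * ln (real n))" for n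
    unfolding Re_log_term by (simp add: powr_minus_divide)
  have "Re (\<Sum>n\<le>K. log_term (Complex 1 t) n) \<ge> log_sum n0 * (2 - 2 * pi / N) - log_sum K" if K: "K \<ge> n0" for K
  proof -
    have split: "{..K} = {..n0} \<union> {n0<..K}" using K by auto
    have sK: "log_sum K = log_sum n0 + (\<Sum>n\<in>{n0<..K}. log_coeff n / real n)"
      unfolding log_sum_def split by (rule sum.union_disjoint) auto
    have "Re (\<Sum>n\<le>K. log_term (Complex 1 t) n) = (\<Sum>n\<le>n0. Re (log_term (Complex 1 t) n)) + (\<Sum>n\<in>{n0<..K}. Re (log_term (Complex 1 t) n))"
      unfolding Re_sum split by (rule sum.union_disjoint) auto
    also have "\<dots> \<ge> (\<Sum>n\<le>n0. log_coeff n / real n * (1 - 2 * pi / N)) + (\<Sum>n\<in>{n0<..K}. - (log_coeff n / real n))"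
    proof (intro add_mono sum_mono)
      fix n assume n: "n \<in> {..n0}"
      show "log_coeff n / real n * (1 - 2 * pi / N) \<le> Re (log_term (Complex 1 t) n)"
      proof (cases "n = 0")
        case False
        show ?thesis unfolding Re1
          by (intro mult_left_mono cosn divide_nonneg_nonneg log_coeff_nonneg) (use n False in auto)
      qed (simp add: log_term_def)
    next
      fix n
      have "log_coeff n / real n * (-1) \<le> log_coeff n / real n * cos (t * ln (real n))"
        by (intro mult_left_mono divide_nonneg_nonneg log_coeff_nonneg) auto
      thus "- (log_coeff n / real n) \<le> Re (log_term (Complex 1 t) n)" unfolding Re1 by simp
    qed
    also have "(\<Sum>n\<le>n0. log_coeff n / real n * (1 - 2 * pi / N)) = log_sum n0 * (1 - 2 * pi / N)"
      unfolding log_sum_def by (rule sum_distrib_right[symmetric])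
    also have "(\<Sum>n\<in>{n0<..K}. - (log_coeff n / real n)) = log_sum n0 - log_sum K"
      unfolding sK by (simp add: sum_negf)
    finally show ?thesis by (simp add: algebra_simps)
  qed
  thus ?thesis using t by blast
qed

text \<open>
  Up to \<open>x0\<close>, a range for which Dirichlet's theorem still finds some \<open>t \<le> T\<close>, the terms are close to their absolute values. The
  approximation of \<open>log \<zeta>\<close> needs the terms up to \<open>X t\<close>, a slightly larger power of \<open>ln t\<close>. As
  \<open>ln ln (X T) - ln ln (x0 T)\<close> tends to \<open>ln (1 + 4e)\<close>, the terms in between lose only that much.
\<close>

lemma zeta_line_lower:
  assumes rh: "riemann_hypothesis" and lim: "Limsup at_top S_exponent = ereal (1/2)" and d: "d > 0"
  shows "eventually (\<lambda>T. \<exists>t. 1 \<le> t \<and> t \<le> T \<and> cmod (zeta (Complex 1 t)) \<ge> exp (euler_mascheroni - d) * ln (ln T)) at_top"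
proof -
  \<comment> \<open>so that \<open>ln (1 + 4 * e) = d / 4\<close>\<close>
  define e where "e = (exp (d / 4) - 1) / 4"
  have e: "e > 0" using d by (simp add: e_def)
  define X where "X = (\<lambda>t::real. ln t powr (1 + 4 * e))"
  have X: "filterlim X at_top at_top" unfolding X_def using e by real_asymp
  have LX: "((\<lambda>t. (1 + L 1 t) / sqrt (X t)) \<longlongrightarrow> 0) at_top"
  proof (rule Lim_null_comparison)
    have l1: "((\<lambda>t::real. (ln (2 * t) / ln t) powr (1/2 + e)) \<longlongrightarrow> 1 powr (1/2 + e)) at_top"
    proof -
      have "((\<lambda>t::real. ln (2 * t) / ln t) \<longlongrightarrow> 1) at_top" by real_asymp
      thus ?thesis by (intro tendsto_intros) auto
    qed
    have l2: "((\<lambda>t::real. ln t powr (- e)) \<longlongrightarrow> 0) at_top" using e by real_asymp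
    have l3: "((\<lambda>t::real. ln t powr (- (1/2 + 2 * e))) \<longlongrightarrow> 0) at_top" using e by real_asymp
    have "((\<lambda>t::real. ln t powr (- (1/2 + 2 * e)) + (ln (2 * t) / ln t) powr (1/2 + e) * ln t powr (- e)) \<longlongrightarrow> 0 + 1 powr (1/2 + e) * 0) at_top"
      by (intro tendsto_intros l1 l2 l3)
    thus "((\<lambda>t::real. ln t powr (- (1/2 + 2 * e)) + (ln (2 * t) / ln t) powr (1/2 + e) * ln t powr (- e)) \<longlongrightarrow> 0) at_top" by simp
    have "eventually (\<lambda>t::real. ln t \<ge> 1) at_top" by real_asymp
    thus "eventually (\<lambda>t. norm ((1 + L 1 t) / sqrt (X t)) \<le> ln t powr (- (1/2 + 2 * e)) + (ln (2 * t) / ln t) powr (1/2 + e) * ln t powr (- e)) at_top"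
      using L_growth[OF lim e] eventually_L_nonneg[OF rh zero_less_one] eventually_gt_at_top[of 1]
    proof eventually_elim
      case (elim t)
      have sq: "sqrt (X t) = ln t powr (1/2 + 2 * e)"
        using elim by (simp add: X_def powr_half_sqrt[symmetric] powr_powr field_simps)
      have "norm ((1 + L 1 t) / sqrt (X t)) = (1 + L 1 t) / sqrt (X t)" using elim by (simp add: X_def)
      also have "\<dots> \<le> (1 + ln (2 * t) powr (1/2 + e)) / sqrt (X t)" using elim by (intro divide_right_mono) (auto simp: X_def)
      also have "\<dots> = ln t powr (- (1/2 + 2 * e)) + ln (2 * t) powr (1/2 + e) * ln t powr (- (1/2 + 2 * e))"
        unfolding sq powr_minus_divide by (simp add: add_divide_distrib)
      also have "ln (2 * t) powr (1/2 + e) * ln t powr (- (1/2 + 2 * e)) = (ln (2 * t) / ln t) powr (1/2 + e) * ln t powr (- e)"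
      proof -
        have "- (1/2 + 2 * e) = - (1/2 + e) + - e" by simp
        hence "ln t powr (- (1/2 + 2 * e)) = ln t powr (- (1/2 + e)) * ln t powr (- e)"
          by (simp only: powr_add)
        moreover have "(ln (2 * t) / ln t) powr (1/2 + e) = ln (2 * t) powr (1/2 + e) * ln t powr (- (1/2 + e))"
          unfolding powr_minus_divide using elim by (subst powr_divide) auto
        ultimately show ?thesis by (simp only: mult.assoc)
      qed
      finally show ?case .
    qed
  qed
  define D where "D = (\<lambda>t. log_zeta (Complex 1 t) - (\<Sum>n\<le>nat \<lfloor>X t\<rfloor>. log_term (Complex 1 t) n))"
  have D: "(D \<longlongrightarrow> 0) at_top" unfolding D_def by (rule log_zeta_sum_tendsto[OF rh zero_less_one X LX])
  have "eventually (\<lambda>t. cmod (D t) < d / 4) at_top"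
    using tendstoD[OF D, of "d / 4"] d by (simp add: dist_norm)
  then obtain t0 where t0: "\<And>t. t \<ge> t0 \<Longrightarrow> cmod (D t) < d / 4" by (auto simp: eventually_at_top_linorder)
  \<comment> \<open>so that \<open>N ^ x0 \<le> sqrt T\<close> for \<open>N\<close> close to \<open>ln (ln T)\<close>\<close>
  define x0 where "x0 = (\<lambda>T::real. ln T / (2 * ln (ln (ln T) + 3)))"
  have x0: "filterlim x0 at_top at_top" unfolding x0_def by real_asymp
  define m where "m = (\<lambda>T. log_sum (nat \<lfloor>x0 T\<rfloor>) * (2 - 2 * pi / ln (ln T)) - log_sum (nat \<lfloor>X T\<rfloor>) - ln (ln (ln T)))"
  have mlim: "(m \<longlongrightarrow> euler_mascheroni - ln (1 + 4 * e)) at_top"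
  proof -
    have a1: "((\<lambda>T. log_sum (nat \<lfloor>x0 T\<rfloor>) - ln (ln (x0 T))) \<longlongrightarrow> euler_mascheroni) at_top"
      by (rule filterlim_compose[OF mertens_log_sum x0])
    have a2: "((\<lambda>T. log_sum (nat \<lfloor>X T\<rfloor>) - ln (ln (X T))) \<longlongrightarrow> euler_mascheroni) at_top"
      by (rule filterlim_compose[OF mertens_log_sum X])
    have a3: "((\<lambda>T. 2 - 2 * pi / ln (ln T)) \<longlongrightarrow> 2) at_top" by real_asymp
    have a4: "((\<lambda>T. ln (ln (x0 T)) * (2 * pi / ln (ln T))) \<longlongrightarrow> 0) at_top" unfolding x0_def by real_asymp
    have a5: "((\<lambda>T. ln (ln (x0 T)) - ln (ln (ln T))) \<longlongrightarrow> 0) at_top" unfolding x0_def by real_asymp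
    have a6: "((\<lambda>T. ln (ln (X T)) - ln (ln (ln T))) \<longlongrightarrow> ln (1 + 4 * e)) at_top"
    proof (rule tendsto_eventually)
      have "eventually (\<lambda>T::real. ln (ln T) > 0) at_top" by real_asymp
      moreover have "eventually (\<lambda>T::real. ln T > 0) at_top" by real_asymp
      ultimately show "eventually (\<lambda>T. ln (ln (X T)) - ln (ln (ln T)) = ln (1 + 4 * e)) at_top"
      proof eventually_elim
        case (elim T)
        have "ln (ln (X T)) = ln ((1 + 4 * e) * ln (ln T))" using elim by (simp add: X_def ln_powr)
        also have "\<dots> = ln (1 + 4 * e) + ln (ln (ln T))" using elim e by (intro ln_mult_pos) auto
        finally show ?case by simp
      qed
    qed
    have "((\<lambda>T. (log_sum (nat \<lfloor>x0 T\<rfloor>) - ln (ln (x0 T))) * (2 - 2 * pi / ln (ln T)) + 2 * (ln (ln (x0 T)) - ln (ln (ln T)))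
       - ln (ln (x0 T)) * (2 * pi / ln (ln T)) - (log_sum (nat \<lfloor>X T\<rfloor>) - ln (ln (X T))) - (ln (ln (X T)) - ln (ln (ln T))))
       \<longlongrightarrow> euler_mascheroni * 2 + 2 * 0 - 0 - euler_mascheroni - ln (1 + 4 * e)) at_top"
      by (intro tendsto_intros a1 a2 a3 a4 a5 a6)
    also have "(\<lambda>T. (log_sum (nat \<lfloor>x0 T\<rfloor>) - ln (ln (x0 T))) * (2 - 2 * pi / ln (ln T)) + 2 * (ln (ln (x0 T)) - ln (ln (ln T)))
       - ln (ln (x0 T)) * (2 * pi / ln (ln T)) - (log_sum (nat \<lfloor>X T\<rfloor>) - ln (ln (X T))) - (ln (ln (X T)) - ln (ln (ln T)))) = m"
      by (rule ext) (simp add: m_def algebra_simps)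
    finally show ?thesis by simp
  qed
  have "1 + 4 * e = exp (d / 4)" unfolding e_def by argo
  hence "ln (1 + 4 * e) = d / 4" by simp
  hence "eventually (\<lambda>T. m T > euler_mascheroni - d / 2) at_top"
    by (intro order_tendstoD(1)[OF mlim]) (use d in simp)
  moreover have "eventually (\<lambda>T. sqrt T \<ge> max t0 (exp 1)) at_top" by real_asymp
  moreover have "eventually (\<lambda>T::real. ln (ln T) \<ge> 1) at_top" by real_asymp
  moreover have "eventually (\<lambda>T::real. x0 T \<le> (ln T / 2) powr 1) at_top" unfolding x0_def by real_asymp
  ultimately show ?thesis using eventually_gt_at_top[of 1]
  proof eventually_elim
    case (elim T)
    define N where "N = nat \<lceil>ln (ln T)\<rceil>"
    define n0 where "n0 = nat \<lfloor>x0 T\<rfloor>"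
    define R where "R = sqrt T"
    have N: "N > 0" "real N \<ge> ln (ln T)" "real N \<le> ln (ln T) + 3" unfolding N_def using elim(3) by linarith+
    have R: "R > 0" "R * R = T" using elim by (auto simp: R_def)
    have lnT: "ln T > 0" using elim by simp
    have x0pos: "x0 T \<ge> 0" unfolding x0_def using elim lnT by (intro divide_nonneg_nonneg) auto
    have n0: "real n0 \<le> x0 T" unfolding n0_def using x0pos by linarith
    have "real (N ^ n0) = real N powr real n0" using N by (simp add: powr_realpow)
    also have "\<dots> \<le> (ln (ln T) + 3) powr x0 T"
    proof -
      have "real N powr real n0 \<le> (ln (ln T) + 3) powr real n0" using N by (intro powr_mono2) auto
      also have "\<dots> \<le> (ln (ln T) + 3) powr x0 T" using n0 elim(3) by (intro powr_mono) auto
      finally show ?thesis .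
    qed
    also have "\<dots> = exp (ln T / 2)" using elim(3) by (simp add: powr_def x0_def)
    also have "\<dots> = R" unfolding R_def using elim by (simp add: ln_sqrt[symmetric])
    finally have NR: "real (N ^ n0) \<le> R" .
    obtain t where t: "R \<le> t" "t \<le> R * R" and big: "\<And>K. K \<ge> n0 \<Longrightarrow>
        Re (\<Sum>n\<le>K. log_term (Complex 1 t) n) \<ge> log_sum n0 * (2 - 2 * pi / real N) - log_sum K"
      using dirichlet_large_sum[OF N(1) R(1) NR] by blast
    have tR: "t \<ge> t0" "t \<ge> exp 1" "t \<le> T" using t elim(2) R by (auto simp: R_def)
    have t1: "t \<ge> 1" using tR(2) exp_ge_add_one_self[of 1] by linarith
    have lnt: "ln t \<ge> 1" using tR(2) t1 by (subst ln_ge_iff) auto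
    have lnt2: "ln T / 2 \<le> ln t"
    proof -
      have "ln T / 2 = ln R" unfolding R_def using elim by (simp add: ln_sqrt)
      also have "\<dots> \<le> ln t" using t R by (intro ln_mono) auto
      finally show ?thesis .
    qed
    have "x0 T \<le> ln T / 2" using elim(4) lnT by simp
    also have "\<dots> \<le> ln t powr 1" using lnt lnt2 by simp
    also have "\<dots> \<le> X t" unfolding X_def using lnt e by (intro powr_mono) auto
    finally have Xn0: "nat \<lfloor>X t\<rfloor> \<ge> n0" unfolding n0_def by (intro nat_mono floor_mono)
    have "X t \<le> X T" unfolding X_def using lnt t1 tR e by (intro powr_mono2 ln_mono) auto
    hence XX: "log_sum (nat \<lfloor>X t\<rfloor>) \<le> log_sum (nat \<lfloor>X T\<rfloor>)" by (intro log_sum_mono nat_mono floor_mono)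
    have "2 * pi / real N \<le> 2 * pi / ln (ln T)" using N elim(3) by (intro divide_left_mono) auto
    hence "log_sum n0 * (2 - 2 * pi / ln (ln T)) \<le> log_sum n0 * (2 - 2 * pi / real N)"
      by (intro mult_left_mono log_sum_nonneg) auto
    with big[OF Xn0] XX have "m T + ln (ln (ln T)) \<le> Re (\<Sum>n\<le>nat \<lfloor>X t\<rfloor>. log_term (Complex 1 t) n)"
      unfolding m_def n0_def by linarith
    also have "\<dots> = Re (log_zeta (Complex 1 t)) - Re (D t)" by (simp add: D_def)
    also have "\<dots> \<le> Re (log_zeta (Complex 1 t)) + d / 4"
      using abs_Re_le_cmod[of "D t"] t0[OF tR(1)] by linarith
    finally have "euler_mascheroni - d + ln (ln (ln T)) \<le> Re (log_zeta (Complex 1 t))" using elim(1) d by linarith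
    hence "exp (euler_mascheroni - d + ln (ln (ln T))) \<le> exp (Re (log_zeta (Complex 1 t)))" by simp
    moreover have "cmod (zeta (Complex 1 t)) = exp (Re (log_zeta (Complex 1 t)))"
      using zeta_eq_exp_log_zeta[OF rh, of t] t1 by simp
    moreover have "exp (euler_mascheroni - d + ln (ln (ln T))) = exp (euler_mascheroni - d) * ln (ln T)"
      using elim(3) by (simp add: exp_add)
    ultimately show ?case using t1 tR(3) by (intro exI[of _ t]) simp
  qed
qed

lemma bdd_above_zeta_line: "bdd_above ((\<lambda>t. cmod (zeta (Complex 1 t))) ` {1..T})"
proof -
  have "continuous_on ((\<lambda>t. Complex 1 t) ` {1..T}) zeta"
    by (intro holomorphic_on_imp_continuous_on holomorphic_zeta) (auto simp: complex_eq_iff)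
  hence "continuous_on {1..T} (\<lambda>t. zeta (Complex 1 t))"
    by (rule continuous_on_compose2) (auto intro!: continuous_intros)
  hence "compact ((\<lambda>t. cmod (zeta (Complex 1 t))) ` {1..T})"
    by (intro compact_continuous_image continuous_intros) auto
  thus ?thesis by (intro bounded_imp_bdd_above compact_imp_bounded)
qed

theorem zeta_line_maximum:
  assumes rh: "riemann_hypothesis" and lim: "Limsup at_top S_exponent = ereal (1/2)"
  shows "(\<lambda>T::real. SUP t\<in>{1..T}. cmod (zeta (Complex 1 t))) \<sim>[at_top] (\<lambda>T. exp euler_mascheroni * ln (ln T))"
proof -
  define Z where "Z = (\<lambda>T::real. SUP t\<in>{1..T}. cmod (zeta (Complex 1 t)))"
  have Zge: "cmod (zeta (Complex 1 t)) \<le> Z T" if "1 \<le> t" "t \<le> T" for t T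
    unfolding Z_def by (intro cSUP_upper bdd_above_zeta_line) (use that in auto)
  have "((\<lambda>T. Z T / (exp euler_mascheroni * ln (ln T))) \<longlongrightarrow> 1) at_top"
  proof (rule order_tendstoI)
    fix a :: real
    show "eventually (\<lambda>T. a < Z T / (exp euler_mascheroni * ln (ln T))) at_top" if a: "a < 1"
    proof -
      define d where "d = (if a \<le> 0 then 1 else - ln a / 2)"
      have d: "d > 0" "a < exp (- d)"
      proof -
        show "d > 0" using a by (simp add: d_def)
        show "a < exp (- d)"
        proof (cases "a \<le> 0")
          case False
          hence "ln a < - d" using a by (simp add: d_def)
          hence "exp (ln a) < exp (- d)" by simp
          thus ?thesis using False by simp
        qed (auto intro: le_less_trans)
      qed
      have "eventually (\<lambda>T::real. ln (ln T) > 0) at_top" by real_asymp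
      with zeta_line_lower[OF rh lim d(1)] show ?thesis
      proof eventually_elim
        case (elim T)
        then obtain t where t: "1 \<le> t" "t \<le> T" "exp (euler_mascheroni - d) * ln (ln T) \<le> cmod (zeta (Complex 1 t))" by blast
        have "a * (exp euler_mascheroni * ln (ln T)) < exp (- d) * (exp euler_mascheroni * ln (ln T))"
          using d(2) elim by (intro mult_strict_right_mono) auto
        also have "\<dots> = exp (euler_mascheroni - d) * ln (ln T)" by (simp add: exp_diff exp_minus field_simps)
        also have "\<dots> \<le> Z T" using t Zge[of t T] by linarith
        finally show ?case using elim by (simp add: less_divide_eq)
      qed
    qed
    show "eventually (\<lambda>T. Z T / (exp euler_mascheroni * ln (ln T)) < a) at_top" if a: "1 < a"
    proof -
      define d where "d = (a - 1) / 2"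
      have d: "d > 0" "1 + d < a" using a by (auto simp: d_def field_simps)
      obtain T0 where T0: "T0 \<ge> 3" "\<And>t. t \<ge> T0 \<Longrightarrow> cmod (zeta (Complex 1 t)) \<le> exp euler_mascheroni * (1 + d) * ln (ln t)"
      proof -
        obtain T1 where "\<And>t. t \<ge> T1 \<Longrightarrow> cmod (zeta (Complex 1 t)) \<le> exp euler_mascheroni * (1 + d) * ln (ln t)"
          using zeta_line_upper[OF rh lim d(1)] by (auto simp: eventually_at_top_linorder)
        thus ?thesis by (intro that[of "max T1 3"]) auto
      qed
      have "eventually (\<lambda>T::real. exp euler_mascheroni * (1 + d) * ln (ln T) \<ge> Z T0) at_top"
      proof -
        have "filterlim (\<lambda>T::real. exp euler_mascheroni * (1 + d) * ln (ln T)) at_top at_top"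
        proof (rule filterlim_tendsto_pos_mult_at_top[OF tendsto_const])
          show "exp euler_mascheroni * (1 + d) > (0::real)" using d by simp
          show "filterlim (\<lambda>T::real. ln (ln T)) at_top at_top" by real_asymp
        qed
        thus ?thesis by (simp add: filterlim_at_top)
      qed
      moreover have "eventually (\<lambda>T::real. ln (ln T) > 0) at_top" by real_asymp
      ultimately show ?thesis using eventually_ge_at_top[of T0]
      proof eventually_elim
        case (elim T)
        have "Z T \<le> exp euler_mascheroni * (1 + d) * ln (ln T)"
          unfolding Z_def
        proof (rule cSUP_least)
          show "{1..T} \<noteq> {}" using elim T0 by auto
          fix t assume t: "t \<in> {1..T}"
          show "cmod (zeta (Complex 1 t)) \<le> exp euler_mascheroni * (1 + d) * ln (ln T)"
          proof (cases "t \<le> T0")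
            case True
            thus ?thesis using Zge[of t T0] t elim by simp
          next
            case False
            have "exp 1 < t" using False T0 exp_le by simp
            hence "ln t > 0" using exp_ge_add_one_self[of 1] by (intro ln_gt_zero) linarith
            hence "ln (ln t) \<le> ln (ln T)" using t by (intro ln_mono) auto
            hence "exp euler_mascheroni * (1 + d) * ln (ln t) \<le> exp euler_mascheroni * (1 + d) * ln (ln T)" using d by (intro mult_left_mono) auto
            thus ?thesis using T0(2)[of t] False by linarith
          qed
        qed
        also have "\<dots> < exp euler_mascheroni * a * ln (ln T)" using d elim by (intro mult_strict_right_mono mult_strict_left_mono) auto
        finally show ?case using elim by (simp add: divide_less_eq mult_ac)
      qed
    qed
  qed
  thus ?thesis unfolding Z_def by (rule asymp_equivI')
qed

theorem theorem1:
  assumes "riemann_hypothesis"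
  shows "(\<forall>C::real. C > 1 / pi \<longrightarrow>
            (\<forall>X::real \<Rightarrow> real.
               (\<forall>\<^sub>F t in at_top. X t > 0) \<and>
               (\<lambda>t. max ((L C t)\<^sup>2) (ln t)) \<in> o[at_top](X) \<longrightarrow>
               (\<lambda>t. zeta (Complex 1 t)) \<sim>[at_top] (\<lambda>t. euler_prod (X t) (Complex 1 t))) \<and>
            (\<exists>\<epsilon>::real \<Rightarrow> real. (\<epsilon> \<longlongrightarrow> 0) at_top \<and>
               (\<forall>\<^sub>F t in at_top. cmod (zeta (Complex 1 t)) \<le>
                  exp euler_mascheroni * (1 + \<epsilon> t) * ln ((L C t)\<^sup>2 + ln t)))) \<and>
         (Limsup at_top S_exponent = ereal (1 / 2) \<longrightarrow>
            (\<lambda>T::real. SUP t\<in>{1..T}. cmod (zeta (Complex 1 t))) \<sim>[at_top]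
            (\<lambda>T. exp euler_mascheroni * ln (ln T)))"
proof (intro conjI allI impI)
  fix C :: real assume "C > 1 / pi"
  hence C: "C > 0" by (rule less_trans[rotated]) simp
  fix X :: "real \<Rightarrow> real"
  assume "(\<forall>\<^sub>F t in at_top. X t > 0) \<and> (\<lambda>t. max ((L C t)\<^sup>2) (ln t)) \<in> o[at_top](X)"
  thus "(\<lambda>t. zeta (Complex 1 t)) \<sim>[at_top] (\<lambda>t. euler_prod (X t) (Complex 1 t))"
    using zeta_asymp_euler_prod[OF assms C] by blast
next
  fix C :: real assume "C > 1 / pi"
  hence C: "C > 0" by (rule less_trans[rotated]) simp
  show "\<exists>\<epsilon>::real \<Rightarrow> real. (\<epsilon> \<longlongrightarrow> 0) at_top \<and>
     (\<forall>\<^sub>F t in at_top. cmod (zeta (Complex 1 t)) \<le> exp euler_mascheroni * (1 + \<epsilon> t) * ln ((L C t)\<^sup>2 + ln t))"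
    by (rule zeta_upper_bound[OF assms C])
next
  assume "Limsup at_top S_exponent = ereal (1 / 2)"
  thus "(\<lambda>T::real. SUP t\<in>{1..T}. cmod (zeta (Complex 1 t))) \<sim>[at_top] (\<lambda>T. exp euler_mascheroni * ln (ln T))"
    by (rule zeta_line_maximum[OF assms])
qed

end
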